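(* Let $\Omega$ be a bounded domain in $\mathbb R$ and let $T>0$. Let $u_0\in H^1_0(\Omega)$ with $u_0\ge0$ and $v_0\in H^1_0(\Omega)$ be such that $u_0+hv_0\ge0$ for all sufficiently small $h>0$. Then the hyperbolic free boundary problem $$\begin{cases}\chi_{\overline{\{u>0\}}}\,u_{tt}=\Delta u & \text{in }\Omega\times(0,T),\\ u(x,0)=u_0(x) & \text{in }\Omega,\\ u_t(x,0)=v_0(x) & \text{in }\Omega\end{cases}$$ has a weak solution (in the sense defined in the context).
   Context: A weak solution is a function $u\in H^1((0,T);L^2(\Omega))\cap L^\infty((0,T);H^1_0(\Omega))$ such that $$\int_0^T\int_\Omega\bigl(-u_t\phi_t+\nabla u\cdot\nabla\phi\bigr)\,dx\,dt-\int_\Omega v_0\,\phi(x,0)\,dx=0$$ for all test functions $\phi\in C_0^\infty(\Omega\times[0,T)\cap\{u>0\})$, i.e. smooth functions with compact support contained in $\{(x,t)\in\Omega\times[0,T):u(x,t)>0\}$ (so $\phi(\cdot,0)$ need not vanish); moreover $u\equiv0$ outside of $\{u>0\}$, and $u(x,0)=u_0(x)$ in $\Omega$ in the sense of traces. In one space dimension $u$ is understood as its continuous representative on $\Omega\times[0,T)$, so that the set $\{u>0\}$ is well defined. *)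

theory Defs
  imports "HOL-Analysis.Analysis"
begin

section \<open>Smooth functions and test functions\<close>

text \<open>
  Derivatives are taken within \<open>S\<close>, so that smoothness is also meaningful for relatively open
  subsets of \<open>\<Omega> \<times> [0,T)\<close>, where it means smoothness up to the initial time \<open>t = 0\<close>
  (one-sided in \<open>t\<close>). On all sets used below the derivative within the set is unique, and for
  open \<open>S\<close> it is the ordinary one.
\<close>

primrec Ck_on :: "nat \<Rightarrow> 'a::euclidean_space set \<Rightarrow> ('a \<Rightarrow> real) \<Rightarrow> bool" where
  "Ck_on 0 S f \<longleftrightarrow> continuous_on S f"
| "Ck_on (Suc k) S f \<longleftrightarrow>
    (\<exists>grad :: 'a \<Rightarrow> 'a.
       (\<forall>x\<in>S. (f has_derivative (\<lambda>h. grad x \<bullet> h)) (at x within S)) \<and>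
       (\<forall>b\<in>Basis. Ck_on k S (\<lambda>x. grad x \<bullet> b)))"

definition smooth_on :: "'a::euclidean_space set \<Rightarrow> ('a \<Rightarrow> real) \<Rightarrow> bool" where
  "smooth_on S f \<longleftrightarrow> (\<forall>k. Ck_on k S f)"

text \<open>
  The class \<open>C\<^sub>0\<^sup>\<infinity>(U)\<close>; its members are total functions, extended by zero outside \<open>U\<close>. When \<open>U\<close>
  contains points with \<open>t = 0\<close>, the extension may jump there, as \<open>\<phi>(\<cdot>,0)\<close> need not vanish.
\<close>

definition test_function :: "'a::euclidean_space set \<Rightarrow> ('a \<Rightarrow> real) \<Rightarrow> bool" where
  "test_function U \<phi> \<longleftrightarrow>
     smooth_on U \<phi> \<and> compact (closure {x. \<phi> x \<noteq> 0}) \<and> closure {x. \<phi> x \<noteq> 0} \<subseteq> U"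

section \<open>Function spaces\<close>

text \<open>
  Elements of the Lebesgue and Sobolev spaces are represented by functions, of which only the
  values almost everywhere on the underlying set matter.
\<close>

definition L2_on :: "'a::euclidean_space set \<Rightarrow> ('a \<Rightarrow> real) \<Rightarrow> bool" where
  "L2_on S f \<longleftrightarrow>
     set_borel_measurable lebesgue S f \<and> set_integrable lebesgue S (\<lambda>x. (f x)\<^sup>2)"

definition L2_norm_on :: "'a::euclidean_space set \<Rightarrow> ('a \<Rightarrow> real) \<Rightarrow> real" where
  "L2_norm_on S f = sqrt (LINT x:S|lebesgue. (f x)\<^sup>2)"

definition L2_tendsto ::
  "'a::euclidean_space set \<Rightarrow> ('i \<Rightarrow> 'a \<Rightarrow> real) \<Rightarrow> ('a \<Rightarrow> real) \<Rightarrow> 'i filter \<Rightarrow> bool" where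
  "L2_tendsto S f g F \<longleftrightarrow>
     (\<forall>\<^sub>F i in F. L2_on S (f i)) \<and> L2_on S g \<and>
     ((\<lambda>i. L2_norm_on S (\<lambda>x. f i x - g x)) \<longlongrightarrow> 0) F"

text \<open>\<open>f \<in> H\<^sup>1(\<Omega>)\<close> with weak derivative \<open>g\<close>.\<close>

definition H1_deriv :: "real set \<Rightarrow> (real \<Rightarrow> real) \<Rightarrow> (real \<Rightarrow> real) \<Rightarrow> bool" where
  "H1_deriv \<Omega> f g \<longleftrightarrow> L2_on \<Omega> f \<and> L2_on \<Omega> g \<and>
     (\<forall>\<phi>. test_function \<Omega> \<phi> \<longrightarrow>
        (LINT x:\<Omega>|lebesgue. f x * deriv \<phi> x) = - (LINT x:\<Omega>|lebesgue. g x * \<phi> x))"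

text \<open>\<open>H\<^sup>1\<^sub>0(\<Omega>)\<close> is the closure of \<open>C\<^sub>0\<^sup>\<infinity>(\<Omega>)\<close> in \<open>H\<^sup>1(\<Omega>)\<close>.\<close>

definition H10 :: "real set \<Rightarrow> (real \<Rightarrow> real) set" where
  "H10 \<Omega> = {f. \<exists>g. H1_deriv \<Omega> f g \<and>
     (\<exists>\<phi> :: nat \<Rightarrow> real \<Rightarrow> real. (\<forall>n. test_function \<Omega> (\<phi> n)) \<and>
        L2_tendsto \<Omega> \<phi> f sequentially \<and>
        L2_tendsto \<Omega> (\<lambda>n. deriv (\<phi> n)) g sequentially)}"

text \<open>
  \<open>u \<in> H\<^sup>1((0,T); L\<^sup>2(\<Omega>))\<close> with weak time derivative \<open>u\<^sub>t\<close>. The space \<open>L\<^sup>2((0,T); L\<^sup>2(\<Omega>))\<close> is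
  identified with \<open>L\<^sup>2(\<Omega> \<times> (0,T))\<close>. Under this identification the Bochner integral of \<open>\<psi>' u\<close> over
  \<open>(0,T)\<close> is, as an element of \<open>L\<^sup>2(\<Omega>)\<close>, given by the integrals of \<open>\<psi>'(t) u(x,t)\<close> over \<open>t\<close> for
  almost every \<open>x\<close>.
\<close>

definition H1_L2_deriv ::
  "real set \<Rightarrow> real \<Rightarrow> (real \<times> real \<Rightarrow> real) \<Rightarrow> (real \<times> real \<Rightarrow> real) \<Rightarrow> bool" where
  "H1_L2_deriv \<Omega> T u u\<^sub>t \<longleftrightarrow>
     L2_on (\<Omega> \<times> {0<..<T}) u \<and> L2_on (\<Omega> \<times> {0<..<T}) u\<^sub>t \<and>
     (\<forall>\<psi>. test_function {0<..<T} \<psi> \<longrightarrow>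
        (AE x in lebesgue. x \<in> \<Omega> \<longrightarrow>
           (LINT t:{0<..<T}|lebesgue. u (x, t) * deriv \<psi> t) =
           - (LINT t:{0<..<T}|lebesgue. u\<^sub>t (x, t) * \<psi> t)))"

text \<open>
  \<open>u \<in> L\<^sup>\<infinity>((0,T); H\<^sup>1\<^sub>0(\<Omega>))\<close> with spatial gradient \<open>u\<^sub>x\<close>. Joint measurability of \<open>u\<close> and \<open>u\<^sub>x\<close>
  expresses the measurability of \<open>t \<mapsto> u(\<cdot>,t)\<close> as a map into \<open>H\<^sup>1\<^sub>0(\<Omega>)\<close>; square integrability of
  both is a consequence of the bound, as \<open>T\<close> is finite.
\<close>

definition Linf_H10_grad ::
  "real set \<Rightarrow> real \<Rightarrow> (real \<times> real \<Rightarrow> real) \<Rightarrow> (real \<times> real \<Rightarrow> real) \<Rightarrow> bool" where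
  "Linf_H10_grad \<Omega> T u u\<^sub>x \<longleftrightarrow>
     set_borel_measurable lebesgue (\<Omega> \<times> {0<..<T}) u \<and>
     set_borel_measurable lebesgue (\<Omega> \<times> {0<..<T}) u\<^sub>x \<and>
     (\<exists>C. AE t in lebesgue. t \<in> {0<..<T} \<longrightarrow>
        (\<lambda>x. u (x, t)) \<in> H10 \<Omega> \<and>
        H1_deriv \<Omega> (\<lambda>x. u (x, t)) (\<lambda>x. u\<^sub>x (x, t)) \<and>
        sqrt ((L2_norm_on \<Omega> (\<lambda>x. u (x, t)))\<^sup>2 + (L2_norm_on \<Omega> (\<lambda>x. u\<^sub>x (x, t)))\<^sup>2) \<le> C)"

section \<open>Weak solutions of the hyperbolic free boundary problem\<close>

definition positivity_set :: "real set \<Rightarrow> real \<Rightarrow> (real \<times> real \<Rightarrow> real) \<Rightarrow> (real \<times> real) set" where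
  "positivity_set \<Omega> T u = {p \<in> \<Omega> \<times> {0..<T}. u p > 0}"

text \<open>
  Weak solutions of \<open>\<chi> u\<^sub>t\<^sub>t = u\<^sub>x\<^sub>x\<close> in \<open>\<Omega> \<times> (0,T)\<close>, where \<open>\<chi>\<close> is the characteristic function of the
  closure of \<open>{u > 0}\<close>, with initial data \<open>u\<^sub>0\<close> and \<open>v\<^sub>0\<close>. The function \<open>u\<close> is the continuous
  representative. Its trace at \<open>t = 0\<close> is the limit of \<open>u(\<cdot>,t)\<close> in \<open>L\<^sup>2(\<Omega>)\<close> as \<open>t\<close> decreases
  to \<open>0\<close>. The derivatives \<open>u\<^sub>t\<close> and \<open>u\<^sub>x\<close> are unique up to null sets.
\<close>

definition weak_solution ::
  "real set \<Rightarrow> real \<Rightarrow> (real \<Rightarrow> real) \<Rightarrow> (real \<Rightarrow> real) \<Rightarrow> (real \<times> real \<Rightarrow> real) \<Rightarrow> bool" where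
  "weak_solution \<Omega> T u\<^sub>0 v\<^sub>0 u \<longleftrightarrow>
     continuous_on (\<Omega> \<times> {0..<T}) u \<and>
     (\<exists>u\<^sub>t u\<^sub>x. H1_L2_deriv \<Omega> T u u\<^sub>t \<and> Linf_H10_grad \<Omega> T u u\<^sub>x \<and>
        (\<forall>\<phi>. test_function (positivity_set \<Omega> T u) \<phi> \<longrightarrow>
           (LINT p:\<Omega> \<times> {0<..<T}|lebesgue.
              - u\<^sub>t p * deriv (\<lambda>t. \<phi> (fst p, t)) (snd p)
              + u\<^sub>x p * deriv (\<lambda>x. \<phi> (x, snd p)) (fst p))
           - (LINT x:\<Omega>|lebesgue. v\<^sub>0 x * \<phi> (x, 0)) = 0)) \<and>
     (\<forall>p \<in> \<Omega> \<times> {0..<T} - positivity_set \<Omega> T u. u p = 0) \<and>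
     L2_tendsto \<Omega> (\<lambda>t x. u (x, t)) u\<^sub>0 (at_right 0)"

end

theory Submission
  imports Defs
begin

text \<open>
  The equation is only tested inside \<open>{u > 0}\<close>, so the positive part \<open>u = max 0 w\<close> of the solution
  \<open>w\<close> of the linear wave equation with Dirichlet data is a weak solution: there \<open>u\<close> coincides with
  \<open>w\<close>, and truncation preserves the Sobolev regularity. On an interval \<open>w\<close> is given by
  d'Alembert's formula, and its weak formulation reduces, after the change of variables to
  characteristic coordinates, to the fundamental theorem of calculus for the test function along
  the characteristics. No regularity of the profile beyond square integrability of its derivative
  is used.
\<close>

section \<open>Test functions on an interval\<close>

text \<open>Weak derivatives are defined by testing and the data are only square integrable, so
  neither the positive part nor a product can be differentiated pointwise. The remedy is to write
  every Sobolev function as a constant plus \<open>prim k\<close>, with \<open>k\<close> a Borel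
  function of class \<open>sq_int\<close>. The chain rule and integration by parts are classical
  when \<open>k\<close> is a test function, and they survive limits in \<open>k\<close>: L2
  convergence on a bounded interval gives L1 convergence, hence uniform convergence of primitives.
  What has to be supplied is the density of test functions in L2, obtained from smooth bumps by a
  Dynkin class argument.

  In this language H^1_0 on (a,b) consists of the primitives of mean-zero \<open>k\<close>, the mean
  being the boundary value at b. The same condition on the derivative of \<open>u\<^sub>0\<close>
  makes the primitive of the profile periodic and so carries the Dirichlet condition from a to b.
  Every slice of the wave, in x or in t, is again a constant plus a primitive, so one formula for
  the maximum yields both derivatives of the truncated wave. Nonnegativity of
  \<open>u\<^sub>0\<close> makes the truncation return the initial value at t = 0.\<close>

lemma Ck_on_Suc_real:
  fixes f :: "real \<Rightarrow> real"
  shows "Ck_on (Suc k) S f \<longleftrightarrow>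
    (\<exists>g. (\<forall>x\<in>S. (f has_real_derivative g x) (at x within S)) \<and> Ck_on k S g)"
  by (simp add: has_field_derivative_def)

declare Ck_on.simps(2) [simp del]

text \<open>No induction is called for: derivatives are taken within \<open>S\<close>, so a
  derivative of \<open>f\<close> on \<open>S\<close> is one of \<open>g\<close> as it stands, and
  the higher orders concern that derivative alone.\<close>

lemma Ck_on_cong:
  fixes f g :: "real \<Rightarrow> real"
  assumes "Ck_on k S f" "\<And>x. x \<in> S \<Longrightarrow> f x = g x"
  shows "Ck_on k S g"
proof (cases k)
  case 0
  then show ?thesis using assms by (simp cong: continuous_on_cong)
next
  case (Suc m)
  then show ?thesis
    using assms(1) has_field_derivative_transform_within[OF _ zero_less_one, of f _ _ S g] assms(2)
    unfolding Suc Ck_on_Suc_real by metis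
qed

lemma Ck_on_subset:
  fixes f :: "real \<Rightarrow> real"
  shows "Ck_on k S f \<Longrightarrow> T \<subseteq> S \<Longrightarrow> Ck_on k T f"
proof (induction k arbitrary: f)
  case 0
  then show ?case using continuous_on_subset by auto
next
  case (Suc k)
  then show ?case unfolding Ck_on_Suc_real by (meson DERIV_subset subsetD)
qed

lemma Ck_on_Suc_imp:
  fixes f :: "real \<Rightarrow> real"
  shows "Ck_on (Suc k) S f \<Longrightarrow> Ck_on k S f"
proof (induction k arbitrary: f)
  case 0
  then show ?case unfolding Ck_on_Suc_real by (auto intro: DERIV_continuous_on)
next
  case (Suc k)
  then show ?case by (metis Ck_on_Suc_real)
qed

lemma Ck_on_add:
  fixes f g :: "real \<Rightarrow> real"
  shows "Ck_on k S f \<Longrightarrow> Ck_on k S g \<Longrightarrow> Ck_on k S (\<lambda>x. f x + g x)"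
proof (induction k arbitrary: f g)
  case 0
  then show ?case by (simp add: continuous_on_add)
next
  case (Suc k)
  obtain f' g' where "\<forall>x\<in>S. (f has_real_derivative f' x) (at x within S)" "Ck_on k S f'"
    "\<forall>x\<in>S. (g has_real_derivative g' x) (at x within S)" "Ck_on k S g'"
    using Suc.prems unfolding Ck_on_Suc_real by blast
  then show ?case using Suc.IH[of f' g'] unfolding Ck_on_Suc_real
    by (intro exI[of _ "\<lambda>x. f' x + g' x"]) (auto intro: DERIV_add)
qed

lemma Ck_on_mult:
  fixes f g :: "real \<Rightarrow> real"
  shows "Ck_on k S f \<Longrightarrow> Ck_on k S g \<Longrightarrow> Ck_on k S (\<lambda>x. f x * g x)"
proof (induction k arbitrary: f g)
  case 0
  then show ?case by (simp add: continuous_on_mult)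
next
  case (Suc k)
  obtain f' g' where *: "\<forall>x\<in>S. (f has_real_derivative f' x) (at x within S)" "Ck_on k S f'"
    "\<forall>x\<in>S. (g has_real_derivative g' x) (at x within S)" "Ck_on k S g'"
    using Suc.prems unfolding Ck_on_Suc_real by blast
  have "Ck_on k S (\<lambda>x. f' x * g x + g' x * f x)"
    using * Suc by (intro Ck_on_add Suc.IH) (auto dest: Ck_on_Suc_imp)
  then show ?case using * unfolding Ck_on_Suc_real
    by (intro exI[of _ "\<lambda>x. f' x * g x + g' x * f x"]) (auto intro: DERIV_mult)
qed

lemma Ck_on_const: "Ck_on k S (\<lambda>x::real. c :: real)"
proof (induction k arbitrary: c)
  case (Suc k)
  then show ?case unfolding Ck_on_Suc_real by (intro exI[of _ "\<lambda>x. 0"]) auto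
qed simp

lemma Ck_on_affine:
  fixes f :: "real \<Rightarrow> real"
  shows "Ck_on k UNIV f \<Longrightarrow> Ck_on k UNIV (\<lambda>x. f (m * x + q))"
proof (induction k arbitrary: f)
  case 0
  then show ?case
    by (auto intro!: continuous_on_compose2[of UNIV f] continuous_intros)
next
  case (Suc k)
  obtain f' where *: "\<And>x. (f has_real_derivative f' x) (at x)" "Ck_on k UNIV f'"
    using Suc.prems unfolding Ck_on_Suc_real by auto
  have "Ck_on k UNIV (\<lambda>x. f' (m * x + q) * m)"
    using Suc.IH[OF *(2)] by (intro Ck_on_mult Ck_on_const)
  moreover have "((\<lambda>x. f (m * x + q)) has_real_derivative f' (m * x + q) * m) (at x)" for x
    by (rule DERIV_chain2[OF *(1)]) (auto intro!: derivative_eq_intros)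
  ultimately show ?case unfolding Ck_on_Suc_real
    by (intro exI[of _ "\<lambda>x. f' (m * x + q) * m"]) auto
qed

section \<open>Supports inside an open interval\<close>

lemma test_functionI:
  fixes \<phi> :: "real \<Rightarrow> real"
  assumes "\<And>k. Ck_on k {a<..<b} \<phi>" "a < c" "d < b" "\<And>x. x \<notin> {c..d} \<Longrightarrow> \<phi> x = 0"
  shows "test_function {a<..<b} \<phi>"
proof -
  have "closure {x. \<phi> x \<noteq> 0} \<subseteq> {c..d}"
    using assms(4) by (intro closure_minimal) (blast, simp)
  moreover from this have "compact (closure {x. \<phi> x \<noteq> 0})"
    by (meson bounded_closed_interval bounded_subset closed_closure compact_eq_bounded_closed)
  ultimately show ?thesis
    using assms unfolding test_function_def smooth_on_def by fastforce
qed

lemma test_function_vanishes: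
  fixes \<phi> :: "real \<Rightarrow> real"
  assumes "test_function {a<..<b} \<phi>"
  obtains c d where "a < c" "d < b" "\<And>x. x \<notin> {c..d} \<Longrightarrow> \<phi> x = 0"
proof (cases "a < b")
  case True
  define K where "K = closure {x. \<phi> x \<noteq> 0}"
  have K: "compact K" "K \<subseteq> {a<..<b}" "\<And>x. x \<notin> K \<Longrightarrow> \<phi> x = 0"
    using assms closure_subset[of "{x. \<phi> x \<noteq> 0}"] unfolding test_function_def K_def by auto
  show ?thesis
  proof (cases "K = {}")
    case True
    \<comment> \<open>The empty interval \<open>{b..a}\<close> encodes the zero function, and a < b
      supplies both strict bounds.\<close>
    then show ?thesis using that[of b a] K \<open>a < b\<close> by auto
  next
    case False
    obtain c where c: "c \<in> K" "\<And>x. x \<in> K \<Longrightarrow> c \<le> x"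
      using compact_attains_inf[OF K(1) False] by blast
    obtain d where d: "d \<in> K" "\<And>x. x \<in> K \<Longrightarrow> x \<le> d"
      using compact_attains_sup[OF K(1) False] by blast
    show ?thesis
    proof (rule that[of c d])
      show "a < c" "d < b" using c(1) d(1) K(2) by auto
      show "\<phi> x = 0" if "x \<notin> {c..d}" for x
        using that c(2)[of x] d(2)[of x] K(3)[of x] by auto
    qed
  qed
next
  case False
  then have "\<phi> x = 0" for x
    using assms closure_subset[of "{x. \<phi> x \<noteq> 0}"] unfolding test_function_def by auto
  then show ?thesis using that[of "a+1" "b-1"] by auto
qed

lemma test_function_outside:
  fixes \<phi> :: "real \<Rightarrow> real"
  assumes "test_function {a<..<b} \<phi>" "x \<notin> {a<..<b}"
  shows "\<phi> x = 0"
  using assms closure_subset[of "{x. \<phi> x \<noteq> 0}"] unfolding test_function_def by blast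

lemma has_derivative_zero_outside:
  fixes \<phi> :: "real \<Rightarrow> real"
  assumes "\<And>x. x \<notin> {c..d} \<Longrightarrow> \<phi> x = 0" "x \<notin> {c..d}"
  shows "(\<phi> has_real_derivative 0) (at x)"
proof (rule has_field_derivative_transform_within_open[of "\<lambda>_. 0" 0 x "- {c..d}"])
  show "0 = \<phi> y" if "y \<in> - {c..d}" for y
    using assms(1)[of y] that by simp
qed (use assms(2) in auto)

text \<open>The support stays away from the endpoints, so the extension by zero is differentiable on
  the whole line and \<open>deriv\<close> can be used without restriction to the interval.\<close>

lemma test_function_has_deriv:
  fixes \<phi> :: "real \<Rightarrow> real"
  assumes "test_function {a<..<b} \<phi>"
  shows "(\<phi> has_real_derivative deriv \<phi> x) (at x)"
proof -
  obtain c d where cd: "a < c" "d < b" "\<And>x. x \<notin> {c..d} \<Longrightarrow> \<phi> x = 0"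
    using test_function_vanishes[OF assms] by blast
  have "\<exists>D. (\<phi> has_real_derivative D) (at x)"
  proof (cases "x \<in> {a<..<b}")
    case True
    have "Ck_on (Suc 0) {a<..<b} \<phi>"
      using assms unfolding test_function_def smooth_on_def by blast
    then show ?thesis using True unfolding Ck_on_Suc_real
      by (metis at_within_open open_greaterThanLessThan)
  next
    case False
    then have "x \<notin> {c..d}" using cd by auto
    then show ?thesis using has_derivative_zero_outside[of c d \<phi> x] cd(3) by blast
  qed
  then show ?thesis by (metis DERIV_imp_deriv)
qed

lemma test_function_continuous:
  fixes \<phi> :: "real \<Rightarrow> real"
  assumes "test_function {a<..<b} \<phi>"
  shows "continuous_on A \<phi>"
  by (rule DERIV_continuous_on[OF has_field_derivative_at_within[OF test_function_has_deriv[OF assms]]])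

lemma test_function_deriv:
  fixes \<phi> :: "real \<Rightarrow> real"
  assumes "test_function {a<..<b} \<phi>"
  shows "test_function {a<..<b} (deriv \<phi>)"
proof -
  obtain c d where cd: "a < c" "d < b" "\<And>x. x \<notin> {c..d} \<Longrightarrow> \<phi> x = 0"
    using test_function_vanishes[OF assms] by blast
  show ?thesis
  proof (rule test_functionI[OF _ cd(1,2)])
    fix k
    have "Ck_on (Suc k) {a<..<b} \<phi>"
      using assms unfolding test_function_def smooth_on_def by blast
    then obtain g where g: "\<forall>x\<in>{a<..<b}. (\<phi> has_real_derivative g x) (at x within {a<..<b})"
      "Ck_on k {a<..<b} g" unfolding Ck_on_Suc_real by blast
    then have "g x = deriv \<phi> x" if "x \<in> {a<..<b}" for x
      using that by (metis DERIV_imp_deriv at_within_open open_greaterThanLessThan)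
    then show "Ck_on k {a<..<b} (deriv \<phi>)" using g(2) Ck_on_cong by blast
  next
    fix x assume "x \<notin> {c..d}"
    then show "deriv \<phi> x = 0"
      using has_derivative_zero_outside[of c d \<phi> x] cd(3) DERIV_imp_deriv by blast
  qed
qed

lemma test_function_lincomb:
  fixes \<phi> \<psi> :: "real \<Rightarrow> real"
  assumes "test_function {a<..<b} \<phi>" "test_function {a<..<b} \<psi>"
  shows "test_function {a<..<b} (\<lambda>x. \<alpha> * \<phi> x + \<beta> * \<psi> x)"
proof -
  obtain c d where cd: "a < c" "d < b" "\<And>x. x \<notin> {c..d} \<Longrightarrow> \<phi> x = 0"
    using test_function_vanishes[OF assms(1)] by blast
  obtain c' d' where cd': "a < c'" "d' < b" "\<And>x. x \<notin> {c'..d'} \<Longrightarrow> \<psi> x = 0"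
    using test_function_vanishes[OF assms(2)] by blast
  show ?thesis
  proof (rule test_functionI[of _ _ _ "min c c'" "max d d'"])
    show "Ck_on k {a<..<b} (\<lambda>x. \<alpha> * \<phi> x + \<beta> * \<psi> x)" for k
      using assms unfolding test_function_def smooth_on_def
      by (intro Ck_on_add Ck_on_mult Ck_on_const) auto
    show "\<alpha> * \<phi> x + \<beta> * \<psi> x = 0" if "x \<notin> {min c c'..max d d'}" for x
      using cd(3)[of x] cd'(3)[of x] that by (auto simp: min_le_iff_disj le_max_iff_disj)
  qed (use cd cd' in auto)
qed

lemma test_function_zero: "test_function {a<..<b} (\<lambda>x::real. 0)"
  by (simp add: test_function_def smooth_on_def Ck_on_const)

subsection \<open>Smooth bump functions\<close>

text \<open>Polynomials in 1/x times exp(-1/x) form a family closed under differentiation, so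
  smoothness at 0 of all members follows by a single induction over the order with \<open>p\<close>
  arbitrary.\<close>

definition flat :: "real poly \<Rightarrow> real \<Rightarrow> real" where
  "flat p x = (if x > 0 then poly p (1 / x) * exp (- (1 / x)) else 0)"

lemma poly_times_exp_tendsto_0: "((\<lambda>y. poly p y * exp (- y)) \<longlongrightarrow> (0::real)) at_top"
proof -
  have "((\<lambda>y. \<Sum>i\<le>degree p. coeff p i * (y ^ i / exp y)) \<longlongrightarrow> (\<Sum>i\<le>degree p. coeff p i * 0)) at_top"
    by (intro tendsto_intros tendsto_power_div_exp_0)
  then show ?thesis
    by (simp add: poly_altdef exp_minus sum_distrib_right divide_inverse mult.assoc)
qed

lemma flat_tendsto_0: "(flat p \<longlongrightarrow> 0) (at_right 0)"
proof -
  have "((\<lambda>x. poly p (inverse x) * exp (- inverse x)) \<longlongrightarrow> 0) (at_right 0)"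
    using filterlim_compose[OF poly_times_exp_tendsto_0 filterlim_inverse_at_top_right] .
  then show ?thesis
    by (rule Lim_transform_eventually)
      (auto simp: flat_def eventually_at_right_field inverse_eq_divide intro: exI[of _ 1])
qed

text \<open>In the variable y = 1/x differentiation acts as -y^2 d/dy; applied to p(y) exp(-y) it
  gives y^2 (p - p')(y) exp(-y).\<close>

lemma flat_has_derivative:
  "(flat p has_real_derivative flat ([:0, 0, 1:] * (p - pderiv p)) x) (at x)"
proof -
  consider "x > 0" | "x < 0" | "x = 0" by linarith
  then show ?thesis
  proof cases
    case 1
    have "((\<lambda>x. poly p (1 / x) * exp (- (1 / x))) has_real_derivative
        flat ([:0, 0, 1:] * (p - pderiv p)) x) (at x)"
      using 1 by (auto intro!: derivative_eq_intros DERIV_chain2[OF poly_DERIV]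
        simp: flat_def power2_eq_square field_simps)
    then show ?thesis
      by (rule has_field_derivative_transform_within_open[of _ _ _ "{0<..}"])
        (use 1 in \<open>auto simp: flat_def\<close>)
  next
    case 2
    have "((\<lambda>x. 0) has_real_derivative 0) (at x)" by simp
    then have "(flat p has_real_derivative 0) (at x)"
      by (rule has_field_derivative_transform_within_open[of _ _ _ "{..<0}"])
        (use 2 in \<open>auto simp: flat_def\<close>)
    then show ?thesis using 2 by (simp add: flat_def)
  next
    case 3
    \<comment> \<open>Division by h is multiplication by y = 1/h, so the difference quotient at 0 is
      itself a member of the family, \<open>flat (pCons 0 p)\<close>.\<close>
    have "((\<lambda>h. flat p h / h) \<longlongrightarrow> 0) (at_right 0)"
      using flat_tendsto_0[of "pCons 0 p"]
      by (rule Lim_transform_eventually)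
        (auto simp: flat_def eventually_at_right_field intro: exI[of _ 1])
    moreover have "((\<lambda>h. flat p h / h) \<longlongrightarrow> 0) (at_left 0)"
      by (rule Lim_transform_eventually[OF tendsto_const])
        (auto simp: flat_def eventually_at_left_field intro: exI[of _ "-1"])
    ultimately have "((\<lambda>h. flat p h / h) \<longlongrightarrow> 0) (at 0)"
      by (simp add: filterlim_split_at)
    then show ?thesis using 3 by (simp add: DERIV_def flat_def)
  qed
qed

lemma Ck_on_flat: "Ck_on k UNIV (flat p)"
proof (induction k arbitrary: p)
  case 0
  then show ?case
    using DERIV_continuous_on[of UNIV "flat p"] flat_has_derivative by auto
next
  case (Suc k)
  then show ?case unfolding Ck_on_Suc_real
    using flat_has_derivative by auto
qed

text \<open>The rescaled arguments make \<open>exp (-1/s)\<close> tend to \<open>1\<close> inside and the support compact in \<open>(c,d)\<close>.\<close>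

definition bump :: "real \<Rightarrow> real \<Rightarrow> nat \<Rightarrow> real \<Rightarrow> real" where
  "bump c d n x = flat 1 (real n * (x - c) - 1) * flat 1 (real n * (d - x) - 1)"

lemma bump_range: "0 \<le> bump c d n x" "bump c d n x \<le> 1"
  by (auto simp: bump_def flat_def intro!: mult_le_one)

lemma Ck_on_bump: "Ck_on k UNIV (bump c d n)"
proof -
  have "Ck_on k UNIV (\<lambda>x. flat 1 (real n * x + (- real n * c - 1)) * flat 1 (- real n * x + (real n * d - 1)))"
    by (intro Ck_on_mult Ck_on_affine Ck_on_flat)
  then show ?thesis
    by (rule Ck_on_cong) (simp add: bump_def algebra_simps)
qed

lemma bump_test_function: "test_function {c<..<d} (bump c d n)"
proof (cases "n = 0")
  \<comment> \<open>For n = 0 both factors are evaluated at -1 and vanish.\<close>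
  case True
  then have "bump c d n = (\<lambda>x. 0)" by (auto simp: bump_def flat_def)
  then show ?thesis using test_function_zero by simp
next
  case False
  have "bump c d n x = 0" if "x \<notin> {c + 1 / n..d - 1 / n}" for x
    using that False by (auto simp: bump_def flat_def field_simps)
  then show ?thesis
    using False by (intro test_functionI[of _ _ _ "c + 1 / n" "d - 1 / n"])
      (auto intro: Ck_on_subset[OF Ck_on_bump])
qed

lemma flat_tendsto_1: "filterlim f at_top F \<Longrightarrow> ((\<lambda>n. flat 1 (f n)) \<longlongrightarrow> 1) F"
proof -
  assume f: "filterlim f at_top F"
  have "((\<lambda>n. exp (- inverse (f n))) \<longlongrightarrow> exp (- 0)) F"
    by (intro tendsto_intros tendsto_inverse_0_at_top f)
  then have "((\<lambda>n. exp (- inverse (f n))) \<longlongrightarrow> 1) F" by simp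
  then show ?thesis
    by (rule Lim_transform_eventually)
      (use eventually_gt_at_top[of 0] f in \<open>auto simp: flat_def inverse_eq_divide filterlim_iff elim!: eventually_mono\<close>)
qed

lemma bump_tendsto: "(\<lambda>n. bump c d n x) \<longlonglongrightarrow> indicator {c<..<d} x"
proof (cases "x \<in> {c<..<d}")
  case True
  have *: "filterlim (\<lambda>n. real n * r - 1) at_top sequentially" if "r > 0" for r
    using that filterlim_tendsto_add_at_top[OF tendsto_const
      filterlim_at_top_mult_tendsto_pos[OF tendsto_const that filterlim_real_sequentially], of "-1"]
    by simp
  have "(\<lambda>n. bump c d n x) \<longlonglongrightarrow> 1 * 1"
    unfolding bump_def using True by (intro tendsto_mult flat_tendsto_1 *) auto
  then show ?thesis using True by simp
next
  case False
  then have "bump c d n x = 0" for n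
    using test_function_outside[OF bump_test_function] by blast
  then show ?thesis using False by simp
qed

section \<open>Density of test functions\<close>

lemma tendsto_zero_sandwich:
  fixes f g :: "'a \<Rightarrow> real"
  assumes "\<And>n. 0 \<le> f n" "\<And>n. f n \<le> g n" "(g \<longlongrightarrow> 0) F"
  shows "(f \<longlongrightarrow> 0) F"
  by (rule tendsto_sandwich[OF _ _ tendsto_const assms(3)]) (use assms in auto)

text \<open>A Borel representative of an element of L2(a,b), extended by zero. All integrals then
  run over the whole line with respect to \<open>lborel\<close>, so that translations and
  reflections need no change of domain and products need no completion.\<close>

definition sq_int :: "real \<Rightarrow> real \<Rightarrow> (real \<Rightarrow> real) \<Rightarrow> bool" where
  "sq_int a b k \<longleftrightarrow> k \<in> borel_measurable borel \<and> (\<forall>x. x \<notin> {a<..<b} \<longrightarrow> k x = 0) \<and>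
     integrable lborel (\<lambda>x. (k x)\<^sup>2)"

lemma sq_int_measurable [measurable_dest]: "sq_int a b k \<Longrightarrow> k \<in> borel_measurable borel"
  by (simp add: sq_int_def)

lemma sq_int_outside: "sq_int a b k \<Longrightarrow> x \<notin> {a<..<b} \<Longrightarrow> k x = 0"
  by (simp add: sq_int_def)

lemma sq_int_square: "sq_int a b k \<Longrightarrow> integrable lborel (\<lambda>x. (k x)\<^sup>2)"
  by (simp add: sq_int_def)

lemma integrable_indicator_interval: "integrable lborel (\<lambda>x. indicator {a<..<b::real} x :: real)"
  using emeasure_lborel_box_finite[of a b] by (intro integrable_real_indicator) auto

lemma abs_le_one_plus_square: "\<bar>y::real\<bar> \<le> 1 + y\<^sup>2"
proof -
  have "0 \<le> (\<bar>y\<bar> - 1)\<^sup>2" "0 \<le> \<bar>y\<bar>" by simp_all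
  then show ?thesis unfolding power2_diff by (simp add: abs_if split: if_splits)
qed

lemma sq_int_integrable:
  assumes "sq_int a b k"
  shows "integrable lborel k"
proof (rule Bochner_Integration.integrable_bound)
  show "integrable lborel (\<lambda>x. indicator {a<..<b} x + (k x)\<^sup>2)"
    using assms by (intro Bochner_Integration.integrable_add integrable_indicator_interval sq_int_square)
  show "AE x in lborel. norm (k x) \<le> norm (indicator {a<..<b} x + (k x)\<^sup>2)"
    using assms abs_le_one_plus_square by (auto simp: sq_int_outside indicator_def)
  show "k \<in> borel_measurable lborel" using assms by (simp add: sq_int_def)
qed

lemma sq_int_bounded:
  assumes "k \<in> borel_measurable borel" "\<And>x. x \<notin> {a<..<b} \<Longrightarrow> k x = 0" "\<And>x. \<bar>k x\<bar> \<le> C"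
  shows "sq_int a b k"
proof -
  have "integrable lborel (\<lambda>x. (k x)\<^sup>2)"
  proof (rule Bochner_Integration.integrable_bound)
    show "integrable lborel (\<lambda>x. C\<^sup>2 * indicator {a<..<b} x)"
      by (intro integrable_mult_right integrable_indicator_interval)
    have "(k x)\<^sup>2 \<le> C\<^sup>2" for x
      using power_mono[OF assms(3)[of x], of 2] by simp
    then show "AE x in lborel. norm ((k x)\<^sup>2) \<le> norm (C\<^sup>2 * indicator {a<..<b} x)"
      using assms(2) by (auto simp: indicator_def)
  qed (use assms(1) in measurable)
  then show ?thesis using assms by (auto simp: sq_int_def)
qed

lemma sq_int_lincomb:
  assumes "sq_int a b f" "sq_int a b g"
  shows "sq_int a b (\<lambda>x. \<alpha> * f x + \<beta> * g x)"
proof -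
  note [measurable] = sq_int_measurable[OF assms(1)] sq_int_measurable[OF assms(2)]
  have "integrable lborel (\<lambda>x. (\<alpha> * f x + \<beta> * g x)\<^sup>2)"
  proof (rule Bochner_Integration.integrable_bound)
    show "integrable lborel (\<lambda>x. 2 * \<alpha>\<^sup>2 * (f x)\<^sup>2 + 2 * \<beta>\<^sup>2 * (g x)\<^sup>2)"
      using assms by (intro Bochner_Integration.integrable_add integrable_mult_right sq_int_square)
    have "(\<alpha> * f x + \<beta> * g x)\<^sup>2 \<le> 2 * \<alpha>\<^sup>2 * (f x)\<^sup>2 + 2 * \<beta>\<^sup>2 * (g x)\<^sup>2" for x
      using zero_le_power2[of "\<alpha> * f x - \<beta> * g x"] by (simp add: power2_eq_square algebra_simps)
    then show "AE x in lborel. norm ((\<alpha> * f x + \<beta> * g x)\<^sup>2)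
        \<le> norm (2 * \<alpha>\<^sup>2 * (f x)\<^sup>2 + 2 * \<beta>\<^sup>2 * (g x)\<^sup>2)"
      by simp
  qed measurable
  then show ?thesis using assms by (auto simp: sq_int_def)
qed

lemma sq_int_diff: "sq_int a b f \<Longrightarrow> sq_int a b g \<Longrightarrow> sq_int a b (\<lambda>x. f x - g x)"
  using sq_int_lincomb[of a b f g 1 "-1"] by simp

lemma sq_int_mult_bounded:
  assumes "sq_int a b k" "m \<in> borel_measurable borel" "\<And>x. \<bar>m x\<bar> \<le> 1"
  shows "sq_int a b (\<lambda>x. m x * k x)"
proof -
  note [measurable] = sq_int_measurable[OF assms(1)] assms(2)
  have "integrable lborel (\<lambda>x. (m x * k x)\<^sup>2)"
  proof (rule Bochner_Integration.integrable_bound[OF sq_int_square[OF assms(1)]])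
    have "(m x)\<^sup>2 \<le> 1" for x using power_mono[OF assms(3)[of x], of 2] by simp
    then show "AE x in lborel. norm ((m x * k x)\<^sup>2) \<le> norm ((k x)\<^sup>2)"
      by (simp add: power_mult_distrib mult_left_le_one_le)
  qed measurable
  then show ?thesis using assms by (auto simp: sq_int_def)
qed

lemma sq_int_test_function:
  assumes "test_function {a<..<b} \<phi>"
  shows "sq_int a b \<phi>"
proof -
  have "continuous_on UNIV \<phi>" using test_function_continuous[OF assms] .
  moreover obtain C where "\<And>x. \<bar>\<phi> x\<bar> \<le> C"
  proof -
    have "compact (\<phi> ` {a..b})"
      using test_function_continuous[OF assms] compact_continuous_image by blast
    then obtain C where "\<forall>y\<in>\<phi> ` {a..b}. \<bar>y\<bar> \<le> C"
      using compact_imp_bounded[of "\<phi> ` {a..b}"] unfolding bounded_iff by auto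
    then have "\<bar>\<phi> x\<bar> \<le> max C 0" for x
      using test_function_outside[OF assms, of x] by (cases "x \<in> {a..b}") (auto simp: le_max_iff_disj)
    then show ?thesis using that by blast
  qed
  ultimately show ?thesis
    using test_function_outside[OF assms] borel_measurable_continuous_onI
    by (intro sq_int_bounded[of _ _ _ C]) auto
qed

lemma sq_int_triangle:
  assumes "sq_int a b f" "sq_int a b g" "sq_int a b h"
  shows "(LINT x|lborel. (f x - h x)\<^sup>2)
    \<le> 2 * (LINT x|lborel. (f x - g x)\<^sup>2) + 2 * (LINT x|lborel. (g x - h x)\<^sup>2)"
proof -
  have 1: "integrable lborel (\<lambda>x. (f x - g x)\<^sup>2)" "integrable lborel (\<lambda>x. (g x - h x)\<^sup>2)"
    "integrable lborel (\<lambda>x. (f x - h x)\<^sup>2)"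
    using assms sq_int_diff sq_int_square by blast+
  have "(f x - h x)\<^sup>2 \<le> 2 * (f x - g x)\<^sup>2 + 2 * (g x - h x)\<^sup>2" for x
    using zero_le_power2[of "(f x - g x) - (g x - h x)"] by (simp add: power2_eq_square algebra_simps)
  then have "(LINT x|lborel. (f x - h x)\<^sup>2)
      \<le> (LINT x|lborel. 2 * (f x - g x)\<^sup>2 + 2 * (g x - h x)\<^sup>2)"
    using 1 by (intro integral_mono) auto
  then show ?thesis using 1 by simp
qed

text \<open>The Cauchy-Schwarz inequality, by integrating 2 m |k| \<le> m^2 + k^2 over (a,b) with
  the optimal constant m, the mean of |k|.\<close>

lemma sq_int_L1_le:
  assumes "sq_int a b k" "a < b"
  shows "(LINT x|lborel. \<bar>k x\<bar>)\<^sup>2 \<le> (b - a) * (LINT x|lborel. (k x)\<^sup>2)"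
proof -
  define I where "I = (LINT x|lborel. \<bar>k x\<bar>)"
  define m where "m = I / (b - a)"
  have 1: "integrable lborel (\<lambda>x. \<bar>k x\<bar>)" "integrable lborel (\<lambda>x. (k x)\<^sup>2)"
    using assms sq_int_integrable sq_int_square by blast+
  have "2 * m * \<bar>k x\<bar> \<le> m\<^sup>2 * indicator {a<..<b} x + (k x)\<^sup>2" for x
  proof (cases "x \<in> {a<..<b}")
    case True
    have "0 \<le> (m - \<bar>k x\<bar>)\<^sup>2" by simp
    then show ?thesis using True unfolding power2_diff by simp
  next
    case False
    then show ?thesis using sq_int_outside[OF assms(1) False] by simp
  qed
  then have "(LINT x|lborel. 2 * m * \<bar>k x\<bar>) \<le> (LINT x|lborel. m\<^sup>2 * indicator {a<..<b} x + (k x)\<^sup>2)"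
    using 1 integrable_indicator_interval by (intro integral_mono) auto
  then have "2 * m * I \<le> m\<^sup>2 * (b - a) + (LINT x|lborel. (k x)\<^sup>2)"
    using 1 integrable_indicator_interval[of a b] assms by (simp add: I_def)
  then have "I\<^sup>2 / (b - a) \<le> (LINT x|lborel. (k x)\<^sup>2)"
    using assms(2) by (simp add: m_def power2_eq_square)
  then show ?thesis using assms(2) by (simp add: I_def field_simps)
qed

section \<open>The L2 closure of the test functions\<close>

lemma square_dominated_convergence:
  fixes s :: "nat \<Rightarrow> real \<Rightarrow> real"
  assumes [measurable]: "\<And>n. s n \<in> borel_measurable borel" "k \<in> borel_measurable borel"
    and "integrable lborel w" "\<And>n x. (s n x - k x)\<^sup>2 \<le> w x" "\<And>x. (\<lambda>n. s n x) \<longlonglongrightarrow> k x"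
  shows "(\<lambda>n. LINT x|lborel. (s n x - k x)\<^sup>2) \<longlonglongrightarrow> 0"
proof -
  have "(\<lambda>n. LINT x|lborel. (s n x - k x)\<^sup>2) \<longlonglongrightarrow> (LINT x::real|lborel. (0::real))"
  proof (rule integral_dominated_convergence[OF _ _ assms(3)])
    have "(\<lambda>n. (s n x - k x)\<^sup>2) \<longlonglongrightarrow> (k x - k x)\<^sup>2" for x
      by (intro tendsto_intros assms)
    then show "AE x in lborel. (\<lambda>n. (s n x - k x)\<^sup>2) \<longlonglongrightarrow> 0" by simp
  qed (use assms in auto)
  then show ?thesis by simp
qed

definition approximable :: "real \<Rightarrow> real \<Rightarrow> (real \<Rightarrow> real) \<Rightarrow> bool" where
  "approximable a b k \<longleftrightarrow> sq_int a b k \<and>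
     (\<forall>e>0. \<exists>\<phi>. test_function {a<..<b} \<phi> \<and> (LINT x|lborel. (\<phi> x - k x)\<^sup>2) < e)"

lemma approximable_limit:
  assumes "\<And>n. approximable a b (s n)" "sq_int a b k"
    and "(\<lambda>n. LINT x|lborel. (s n x - k x)\<^sup>2) \<longlonglongrightarrow> 0"
  shows "approximable a b k"
  unfolding approximable_def
proof (intro conjI allI impI)
  fix e :: real assume "e > 0"
  \<comment> \<open>The choice e/4 absorbs the factor 2 in front of both terms of
    \<open>sq_int_triangle\<close>.\<close>
  then obtain n where n: "(LINT x|lborel. (s n x - k x)\<^sup>2) < e / 4"
    using order_tendstoD(2)[OF assms(3), of "e/4"] by (auto simp: eventually_sequentially)
  obtain \<phi> where \<phi>: "test_function {a<..<b} \<phi>" "(LINT x|lborel. (\<phi> x - s n x)\<^sup>2) < e / 4"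
    using assms(1)[of n] \<open>e > 0\<close> unfolding approximable_def by (meson divide_pos_pos zero_less_numeral)
  have "(LINT x|lborel. (\<phi> x - k x)\<^sup>2)
      \<le> 2 * (LINT x|lborel. (\<phi> x - s n x)\<^sup>2) + 2 * (LINT x|lborel. (s n x - k x)\<^sup>2)"
    using assms(1)[of n] sq_int_triangle[OF sq_int_test_function[OF \<phi>(1)] _ assms(2), of "s n"]
    by (simp add: approximable_def)
  then show "\<exists>\<phi>. test_function {a<..<b} \<phi> \<and> (LINT x|lborel. (\<phi> x - k x)\<^sup>2) < e"
    using \<phi> n by (intro exI[of _ \<phi>]) auto
qed (rule assms)

lemma approximable_sequence:
  assumes "approximable a b k"
  obtains \<phi> :: "nat \<Rightarrow> real \<Rightarrow> real" where "\<And>n. test_function {a<..<b} (\<phi> n)"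
    "(\<lambda>n. LINT x|lborel. (\<phi> n x - k x)\<^sup>2) \<longlonglongrightarrow> 0"
proof -
  have "\<exists>\<phi>. test_function {a<..<b} \<phi> \<and> (LINT x|lborel. (\<phi> x - k x)\<^sup>2) < inverse (real (Suc n))" for n
    using assms unfolding approximable_def by simp
  then obtain \<phi> where \<phi>: "\<And>n. test_function {a<..<b} (\<phi> n)"
    "\<And>n. (LINT x|lborel. (\<phi> n x - k x)\<^sup>2) < inverse (real (Suc n))" by metis
  have "(\<lambda>n. LINT x|lborel. (\<phi> n x - k x)\<^sup>2) \<longlonglongrightarrow> 0"
    by (rule tendsto_zero_sandwich[OF _ less_imp_le[OF \<phi>(2)] LIMSEQ_inverse_real_of_nat]) simp
  then show ?thesis using that \<phi>(1) by blast
qed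

lemma approximable_test_function: "test_function {a<..<b} \<phi> \<Longrightarrow> approximable a b \<phi>"
  unfolding approximable_def using sq_int_test_function by (auto intro!: exI[of _ \<phi>])

lemma approximable_lincomb:
  assumes "approximable a b f" "approximable a b g"
  shows "approximable a b (\<lambda>x. \<alpha> * f x + \<beta> * g x)"
proof -
  obtain \<phi> where \<phi>: "\<And>n::nat. test_function {a<..<b} (\<phi> n)"
    "(\<lambda>n. LINT x|lborel. (\<phi> n x - f x)\<^sup>2) \<longlonglongrightarrow> 0"
    using approximable_sequence[OF assms(1)] by blast
  obtain \<psi> where \<psi>: "\<And>n::nat. test_function {a<..<b} (\<psi> n)"
    "(\<lambda>n. LINT x|lborel. (\<psi> n x - g x)\<^sup>2) \<longlonglongrightarrow> 0"
    using approximable_sequence[OF assms(2)] by blast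
  have fg: "sq_int a b f" "sq_int a b g" using assms by (auto simp: approximable_def)
  have i: "integrable lborel (\<lambda>x. (\<phi> n x - f x)\<^sup>2)" "integrable lborel (\<lambda>x. (\<psi> n x - g x)\<^sup>2)" for n
    using sq_int_diff[OF sq_int_test_function[OF \<phi>(1)] fg(1)]
      sq_int_diff[OF sq_int_test_function[OF \<psi>(1)] fg(2)] sq_int_square by blast+
  have s: "sq_int a b (\<lambda>x. \<alpha> * f x + \<beta> * g x)" using fg by (rule sq_int_lincomb)
  {
    fix n
    have "((\<alpha> * \<phi> n x + \<beta> * \<psi> n x) - (\<alpha> * f x + \<beta> * g x))\<^sup>2
        \<le> 2 * \<alpha>\<^sup>2 * (\<phi> n x - f x)\<^sup>2 + 2 * \<beta>\<^sup>2 * (\<psi> n x - g x)\<^sup>2" for x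
      using zero_le_power2[of "\<alpha> * (\<phi> n x - f x) - \<beta> * (\<psi> n x - g x)"]
      by (simp add: power2_eq_square algebra_simps)
    then have "(LINT x|lborel. ((\<alpha> * \<phi> n x + \<beta> * \<psi> n x) - (\<alpha> * f x + \<beta> * g x))\<^sup>2)
        \<le> (LINT x|lborel. 2 * \<alpha>\<^sup>2 * (\<phi> n x - f x)\<^sup>2 + 2 * \<beta>\<^sup>2 * (\<psi> n x - g x)\<^sup>2)"
      using i by (intro integral_mono sq_int_square[OF sq_int_diff[OF _ s]]
          sq_int_test_function[OF test_function_lincomb[OF \<phi>(1) \<psi>(1)]]) auto
    also have "\<dots> = 2 * \<alpha>\<^sup>2 * (LINT x|lborel. (\<phi> n x - f x)\<^sup>2) + 2 * \<beta>\<^sup>2 * (LINT x|lborel. (\<psi> n x - g x)\<^sup>2)"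
      using i by simp
    finally have "(LINT x|lborel. ((\<alpha> * \<phi> n x + \<beta> * \<psi> n x) - (\<alpha> * f x + \<beta> * g x))\<^sup>2) \<le> \<dots>" .
  } note le = this
  have "(\<lambda>n. 2 * \<alpha>\<^sup>2 * (LINT x|lborel. (\<phi> n x - f x)\<^sup>2) + 2 * \<beta>\<^sup>2 * (LINT x|lborel. (\<psi> n x - g x)\<^sup>2))
      \<longlonglongrightarrow> 2 * \<alpha>\<^sup>2 * 0 + 2 * \<beta>\<^sup>2 * 0"
    by (intro tendsto_intros \<phi> \<psi>)
  then have "(\<lambda>n. LINT x|lborel. ((\<alpha> * \<phi> n x + \<beta> * \<psi> n x) - (\<alpha> * f x + \<beta> * g x))\<^sup>2) \<longlonglongrightarrow> 0"
    by (intro tendsto_zero_sandwich[OF _ le]) simp_all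
  then show ?thesis
    by (rule approximable_limit[OF approximable_test_function[OF test_function_lincomb[OF \<phi>(1) \<psi>(1)]] s])
qed

lemma approximable_zero: "approximable a b (\<lambda>x. 0)"
  using approximable_test_function[OF test_function_zero] .

lemma sq_int_indicator:
  "A \<in> sets borel \<Longrightarrow> A \<subseteq> {a<..<b} \<Longrightarrow> sq_int a b (indicator A)"
  by (rule sq_int_bounded[of _ _ _ 1]) (auto simp: indicator_def)

lemma test_function_mono:
  fixes \<phi> :: "real \<Rightarrow> real"
  assumes "\<And>k. Ck_on k UNIV \<phi>" "test_function {c<..<d} \<phi>" "a \<le> c" "d \<le> b"
  shows "test_function {a<..<b} \<phi>"
proof -
  obtain c' d' where "c < c'" "d' < d" "\<And>x. x \<notin> {c'..d'} \<Longrightarrow> \<phi> x = 0"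
    using test_function_vanishes[OF assms(2)] by blast
  then show ?thesis
    using assms by (intro test_functionI[of a b \<phi> c' d']) (auto intro: Ck_on_subset)
qed

lemma approximable_interval:
  assumes "a \<le> c" "d \<le> b"
  shows "approximable a b (indicator {c<..<d})"
proof (rule approximable_limit)
  have "test_function {a<..<b} (bump c d n)" for n
    by (rule test_function_mono[OF Ck_on_bump bump_test_function]) (use assms in auto)
  then show "approximable a b (bump c d n)" for n by (rule approximable_test_function)
  then have m: "bump c d n \<in> borel_measurable borel" for n
    by (simp add: approximable_def sq_int_def)
  show "sq_int a b (indicator {c<..<d})" by (rule sq_int_indicator) (use assms in auto)
  have "(bump c d n x - indicator {c<..<d} x)\<^sup>2 \<le> indicator {c<..<d} x" for n x
  proof (cases "x \<in> {c<..<d}")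
    case True
    then show ?thesis using bump_range[of c d n x] by (simp add: power2_le_iff_abs_le abs_square_le_1)
  next
    case False
    then show ?thesis using test_function_outside[OF bump_test_function False] by simp
  qed
  then show "(\<lambda>n. LINT x|lborel. (bump c d n x - indicator {c<..<d} x)\<^sup>2) \<longlonglongrightarrow> 0"
    by (intro square_dominated_convergence[OF m _ integrable_indicator_interval] bump_tendsto) auto
qed

text \<open>The sets with this property form a Dynkin class containing the open intervals, which are
  stable under intersection and generate the Borel sets. Disjointness turns the indicator of a
  finite union into a sum, and dominated convergence handles the countable union. Intersecting with
  (a,b) keeps every complement of finite measure.\<close>

lemma approximable_indicator:
  assumes "A \<in> sets borel"
  shows "approximable a b (indicator (A \<inter> {a<..<b}))"
proof -
  let ?G = "range (\<lambda>(c, d). {c<..<d::real})"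
  have G: "borel = sigma UNIV ?G"
    using borel_eq_box[where 'a = real] by (simp add: box_real)
  have "Int_stable ?G"
    by (auto simp: Int_stable_def Int_greaterThanLessThan intro!: rangeI image_eqI)
  moreover have "?G \<subseteq> Pow UNIV" by simp
  moreover have "A \<in> sigma_sets UNIV ?G"
    using assms G by (metis sets_measure_of Pow_UNIV subset_UNIV)
  ultimately show ?thesis
  proof (induction rule: sigma_sets_induct_disjoint)
    case (basic A)
    then obtain c d where "A = {c<..<d}" by auto
    then have "A \<inter> {a<..<b} = {max c a<..<min d b}" by auto
    then show ?case by (simp add: approximable_interval)
  next
    case empty
    then show ?case using approximable_zero by simp
  next
    case (compl A)
    have "approximable a b (\<lambda>x. 1 * indicator {a<..<b} x + (-1) * indicator (A \<inter> {a<..<b}) x)"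
      by (intro approximable_lincomb approximable_interval compl) auto
    moreover have "(\<lambda>x. 1 * indicator {a<..<b} x + (-1) * indicator (A \<inter> {a<..<b}) x)
       = (indicator ((UNIV - A) \<inter> {a<..<b}) :: real \<Rightarrow> real)"
      by (auto simp: indicator_def fun_eq_iff)
    ultimately show ?case by simp
  next
    case (union A)
    define s where "s n = (indicator ((\<Union>i<n. A i) \<inter> {a<..<b}) :: real \<Rightarrow> real)" for n
    have A: "A i \<in> sets borel" for i
      using union(2) G
      by (metis sets_measure_of Pow_UNIV subset_UNIV range_subsetD)
    have s: "approximable a b (s n)" for n
    proof (induction n)
      case 0
      then show ?case using approximable_zero by (simp add: s_def)
    next
      case (Suc n)
      have disj: "x \<notin> A i" if "x \<in> A n" "i < n" for x i
        using disjoint_family_onD[OF union(1), of i n] that by auto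
      have "approximable a b (\<lambda>x. 1 * s n x + 1 * indicator (A n \<inter> {a<..<b}) x)"
        by (intro approximable_lincomb Suc union)
      moreover have "(\<lambda>x. 1 * s n x + 1 * indicator (A n \<inter> {a<..<b}) x) = s (Suc n)"
      proof
        fix x
        have "((\<Union>i<n. A i) \<inter> {a<..<b}) \<inter> (A n \<inter> {a<..<b}) = {}" using disj by blast
        moreover have "((\<Union>i<n. A i) \<inter> {a<..<b}) \<union> (A n \<inter> {a<..<b}) = (\<Union>i<Suc n. A i) \<inter> {a<..<b}"
          unfolding lessThan_Suc by blast
        ultimately show "1 * s n x + 1 * indicator (A n \<inter> {a<..<b}) x = s (Suc n) x"
          unfolding s_def by (metis indicator_add mult_1)
      qed
      ultimately show ?case by simp
    qed
    have m: "(\<Union>i. A i) \<in> sets borel" "(\<Union>i<n. A i) \<in> sets borel" for n using A by auto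
    have lim: "(\<lambda>n. LINT x|lborel. (s n x - indicator ((\<Union>i. A i) \<inter> {a<..<b}) x)\<^sup>2) \<longlonglongrightarrow> 0"
    proof (rule square_dominated_convergence[OF _ _ integrable_indicator_interval[of a b]])
      fix x
      show "(\<lambda>n. s n x) \<longlonglongrightarrow> indicator ((\<Union>i. A i) \<inter> {a<..<b}) x"
      proof (cases "\<exists>i. x \<in> A i \<inter> {a<..<b}")
        case True
        then obtain i where "x \<in> A i" "x \<in> {a<..<b}" by auto
        then have "s n x = indicator ((\<Union>i. A i) \<inter> {a<..<b}) x" if "n \<ge> Suc i" for n
          using that by (auto simp: s_def indicator_def)
        then show ?thesis
          by (intro tendsto_eventually eventually_sequentiallyI) blast
      next
        case False
        then show ?thesis by (auto simp: s_def indicator_def)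
      qed
    next
      show "s n \<in> borel_measurable borel" for n
        unfolding s_def using m(2)[of n] by (intro borel_measurable_indicator) auto
      show "indicator ((\<Union>i. A i) \<inter> {a<..<b}) \<in> borel_measurable borel"
        using m(1) by (intro borel_measurable_indicator) auto
      show "(s n x - indicator ((\<Union>i. A i) \<inter> {a<..<b}) x)\<^sup>2 \<le> indicator {a<..<b} x" for n x
        by (simp add: s_def indicator_def)
    qed
    have "sq_int a b (indicator ((\<Union>i. A i) \<inter> {a<..<b}))"
      using m(1) by (intro sq_int_indicator) auto
    then show ?case using approximable_limit[of a b s, OF s _ lim] by blast
  qed
qed

lemma approximable_sum:
  assumes "finite I" "\<And>i. i \<in> I \<Longrightarrow> approximable a b (f i)"
  shows "approximable a b (\<lambda>x. \<Sum>i\<in>I. c i * f i x)"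
  using assms
proof (induction I)
  case empty
  then show ?case using approximable_zero by simp
next
  case (insert i I)
  then show ?case using approximable_lincomb[of a b "f i" "\<lambda>x. \<Sum>i\<in>I. c i * f i x" "c i" 1] by simp
qed

text \<open>Density without mollification: simple functions dominated by 2 |k| are linear
  combinations of indicators, and they converge to \<open>k\<close> in L2 by dominated
  convergence.\<close>

theorem sq_int_approximable:
  assumes "sq_int a b k"
  shows "approximable a b k"
proof -
  note [measurable] = sq_int_measurable[OF assms]
  obtain s where s: "\<And>i. simple_function borel (s i)" "\<And>x. (\<lambda>i. s i x) \<longlonglongrightarrow> k x"
    "\<And>i x. dist (s i x) 0 \<le> 2 * dist (k x) 0"
    using borel_measurable_implies_sequence_metric[of k borel 0] assms by (auto simp: sq_int_def)
  show ?thesis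
  proof (rule approximable_limit[OF _ assms])
    fix n
    have fin: "finite (range (s n))" using s(1)[of n] by (simp add: simple_function_def)
    have z: "s n x = 0" if "x \<notin> {a<..<b}" for x
      using s(3)[of n x] sq_int_outside[OF assms that] by simp
    have "approximable a b (\<lambda>x. \<Sum>y\<in>range (s n). y * indicator (s n -` {y} \<inter> {a<..<b}) x)"
      using s(1)[of n] by (intro approximable_sum fin approximable_indicator) (auto simp: simple_function_def)
    moreover have "(\<Sum>y\<in>range (s n). y * indicator (s n -` {y} \<inter> {a<..<b}) x) = s n x" for x
    proof (cases "x \<in> {a<..<b}")
      case True
      then have "(\<Sum>y\<in>range (s n). y * indicator (s n -` {y} \<inter> {a<..<b}) x)
        = (\<Sum>y\<in>range (s n). if y = s n x then y else 0)"
        by (intro sum.cong) (auto simp: indicator_def)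
      then show ?thesis using fin by simp
    qed (use z in auto)
    ultimately show "approximable a b (s n)" by simp
  next
    \<comment> \<open>The bound |s| \<le> 2 |k| gives |s - k| \<le> 3 |k|, whence the factor
      9.\<close>
    have "(s n x - k x)\<^sup>2 \<le> 9 * (k x)\<^sup>2" for n x
    proof -
      have "\<bar>s n x - k x\<bar> \<le> 3 * \<bar>k x\<bar>" using s(3)[of n x] by (simp add: dist_norm)
      then show ?thesis using power_mono[of "\<bar>s n x - k x\<bar>" "3 * \<bar>k x\<bar>" 2] by (simp add: power_mult_distrib)
    qed
    then show "(\<lambda>n. LINT x|lborel. (s n x - k x)\<^sup>2) \<longlonglongrightarrow> 0"
      using s sq_int_square[OF assms]
      by (intro square_dominated_convergence[where w = "\<lambda>x. 9 * (k x)\<^sup>2"])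
        (auto intro: borel_measurable_simple_function)
  qed
qed

section \<open>Primitives of square integrable functions\<close>

text \<open>Starting at minus infinity makes the primitive independent of the interval on which
  \<open>k\<close> lives; for \<open>k\<close> of class \<open>sq_int a b\<close> it is the integral
  from a.\<close>

definition prim :: "(real \<Rightarrow> real) \<Rightarrow> real \<Rightarrow> real" where
  "prim k x = (LINT s|lborel. indicator {..x} s * k s)"

lemma integrable_indicator_mult:
  fixes k :: "real \<Rightarrow> real"
  assumes "integrable lborel k" "A \<in> sets borel"
  shows "integrable lborel (\<lambda>s. indicator A s * k s)"
  using integrable_mult_indicator[of A lborel k] assms by simp

lemma prim_abs_le:
  assumes "integrable lborel k"
  shows "\<bar>prim k x\<bar> \<le> (LINT s|lborel. \<bar>k s\<bar>)"
proof -
  have "\<bar>prim k x\<bar> \<le> (LINT s|lborel. \<bar>indicator {..x} s * k s\<bar>)"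
    unfolding prim_def using integral_norm_bound[of lborel "\<lambda>s. indicator {..x} s * k s"] by simp
  also have "\<dots> \<le> (LINT s|lborel. \<bar>k s\<bar>)"
    using assms integrable_indicator_mult[OF assms, of "{..x}"]
    by (intro integral_mono) (auto simp: indicator_def)
  finally show ?thesis .
qed

lemma prim_lincomb:
  assumes "integrable lborel f" "integrable lborel g"
  shows "prim (\<lambda>s. \<alpha> * f s + \<beta> * g s) x = \<alpha> * prim f x + \<beta> * prim g x"
proof -
  have "(\<lambda>s. indicator {..x} s * (\<alpha> * f s + \<beta> * g s)) =
      (\<lambda>s. \<alpha> * (indicator {..x} s * f s) + \<beta> * (indicator {..x} s * g s))"
    by (auto simp: algebra_simps)
  then show ?thesis
    using assms unfolding prim_def by (simp add: integrable_indicator_mult)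
qed

lemma prim_diff:
  assumes "integrable lborel f" "integrable lborel g"
  shows "prim (\<lambda>s. f s - g s) x = prim f x - prim g x"
  using prim_lincomb[OF assms, of 1 "-1"] by simp

lemma prim_eq_0:
  assumes "\<And>s. s \<le> x \<Longrightarrow> k s = 0"
  shows "prim k x = 0"
proof -
  have "(\<lambda>s. indicator {..x} s * k s) = (\<lambda>s. 0)" using assms by (auto simp: indicator_def)
  then show ?thesis by (simp add: prim_def)
qed

lemma prim_eq_integral:
  assumes "\<And>s. s > x \<Longrightarrow> k s = 0"
  shows "prim k x = (LINT s|lborel. k s)"
proof -
  have "(\<lambda>s. indicator {..x} s * k s) = k" using assms by (force simp: indicator_def)
  then show ?thesis by (simp add: prim_def)
qed

lemma prim_left: "sq_int a b k \<Longrightarrow> x \<le> a \<Longrightarrow> prim k x = 0"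
  by (intro prim_eq_0) (auto intro: sq_int_outside)

lemma prim_right: "sq_int a b k \<Longrightarrow> b \<le> x \<Longrightarrow> prim k x = (LINT s|lborel. k s)"
  by (intro prim_eq_integral) (auto intro: sq_int_outside)

lemma prim_continuous:
  assumes "integrable lborel k"
  shows "continuous_on A (prim k)"
proof (rule continuous_on_subset[OF _ subset_UNIV], rule continuous_on_sequentiallyI)
  fix u :: "nat \<Rightarrow> real" and c assume u: "u \<longlonglongrightarrow> c"
  have [measurable]: "k \<in> borel_measurable borel" using assms by auto
  show "(\<lambda>n. prim k (u n)) \<longlonglongrightarrow> prim k c"
    unfolding prim_def
  proof (rule integral_dominated_convergence[where w = "\<lambda>s. \<bar>k s\<bar>"])
    \<comment> \<open>Only at s = c may the indicators fail to converge, and a point is a null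
      set.\<close>
    have "(\<lambda>n. indicator {..u n} s * k s) \<longlonglongrightarrow> indicator {..c} s * k s" if ne: "s \<noteq> c" for s
    proof -
      consider "s < c" | "s > c" using ne by linarith
      then have "eventually (\<lambda>n. indicator {..u n} s * k s = indicator {..c} s * k s) sequentially"
      proof cases
        case 1
        show ?thesis using order_tendstoD(1)[OF u 1] by eventually_elim (use 1 in auto)
      next
        case 2
        show ?thesis using order_tendstoD(2)[OF u 2] by eventually_elim (use 2 in auto)
      qed
      then show ?thesis by (rule tendsto_eventually)
    qed
    then show "AE s in lborel. (\<lambda>n. indicator {..u n} s * k s) \<longlonglongrightarrow> indicator {..c} s * k s"
      using AE_lborel_singleton[of c] by (auto elim: AE_mp)
  qed (use assms in \<open>auto simp: indicator_def\<close>)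
qed

section \<open>The fundamental theorem of calculus for primitives\<close>

lemma prim_has_derivative:
  assumes "integrable lborel k" "continuous_on UNIV k" "\<And>s. s \<le> a \<Longrightarrow> k s = 0"
  shows "(prim k has_real_derivative k x) (at x)"
proof -
  \<comment> \<open>To the left of a nothing is lost by starting the integral at \<open>c\<close>,
    while x lies in the interior of the interval of integration.\<close>
  define c where "c = min a x - 1"
  have eq: "integral {c..y} k = prim k y" if "y \<in> {c<..<x+1}" for y
  proof -
    have "set_integrable lborel {c..y} k"
      unfolding set_integrable_def using integrable_indicator_mult[OF assms(1)] by simp
    then have "integral {c..y} k = (LINT s:{c..y}|lborel. k s)"
      using set_borel_integral_eq_integral(2) by metis
    also have "\<dots> = prim k y"
      unfolding prim_def set_lebesgue_integral_def
      using assms(3) by (intro Bochner_Integration.integral_cong) (auto simp: indicator_def c_def)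
    finally show ?thesis .
  qed
  have "((\<lambda>y. integral {c..y} k) has_real_derivative k x) (at x within {c..x+1})"
    by (rule integral_has_real_derivative) (use assms(2) in \<open>auto simp: c_def intro: continuous_on_subset\<close>)
  moreover have "at x within {c..x+1} = at x"
    by (rule at_within_interior) (auto simp: c_def)
  ultimately have "((\<lambda>y. integral {c..y} k) has_real_derivative k x) (at x)" by simp
  then show ?thesis
    by (rule has_field_derivative_transform_within_open[of _ _ _ "{c<..<x+1}"])
      (auto simp: c_def intro: eq[unfolded c_def])
qed

lemma prim_eqI:
  assumes "integrable lborel k" "continuous_on UNIV k" "\<And>s. s \<le> a \<Longrightarrow> k s = 0"
    and "\<And>x. (h has_real_derivative k x) (at x)"
  shows "h x = h a + prim k x"
proof -
  have "((\<lambda>x. h x - prim k x) has_real_derivative k x - k x) (at x)" for x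
    by (intro DERIV_diff assms(4) prim_has_derivative[OF assms(1-3)])
  then have "h x - prim k x = h a - prim k a"
    by (intro DERIV_const_ratio_const2 DERIV_isconst_all) auto
  moreover have "prim k a = 0" using assms(3) by (rule prim_eq_0)
  ultimately show ?thesis by simp
qed

lemma prim_test_function_deriv:
  "test_function {a<..<b} \<phi> \<Longrightarrow> (prim \<phi> has_real_derivative \<phi> x) (at x)"
  by (rule prim_has_derivative[of _ a])
    (auto intro: sq_int_integrable sq_int_test_function test_function_continuous test_function_outside)

lemma prim_deriv_test_function:
  assumes "test_function {a<..<b} \<phi>"
  shows "prim (deriv \<phi>) x = \<phi> x"
proof -
  note d = test_function_deriv[OF assms]
  have "\<phi> x = \<phi> a + prim (deriv \<phi>) x"
    by (rule prim_eqI) (auto intro: sq_int_integrable sq_int_test_function[OF d]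
      test_function_continuous[OF d] test_function_outside[OF d] test_function_has_deriv[OF assms])
  then show ?thesis using test_function_outside[OF assms, of a] by simp
qed

section \<open>Passage to the limit in primitives and products\<close>

lemma sq_int_tendsto_L1:
  assumes "\<And>n. sq_int a b (s n)" "sq_int a b k" "a < b"
    and "(\<lambda>n. LINT x|lborel. (s n x - k x)\<^sup>2) \<longlonglongrightarrow> 0"
  shows "(\<lambda>n. LINT x|lborel. \<bar>s n x - k x\<bar>) \<longlonglongrightarrow> 0"
proof -
  have "(\<lambda>n. (b - a) * (LINT x|lborel. (s n x - k x)\<^sup>2)) \<longlonglongrightarrow> (b - a) * 0"
    by (intro tendsto_intros assms)
  then have lim: "(\<lambda>n. (b - a) * (LINT x|lborel. (s n x - k x)\<^sup>2)) \<longlonglongrightarrow> 0" by simp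
  have "(\<lambda>n. (LINT x|lborel. \<bar>s n x - k x\<bar>)\<^sup>2) \<longlonglongrightarrow> 0"
    by (rule tendsto_zero_sandwich[OF zero_le_power2
          sq_int_L1_le[OF sq_int_diff[OF assms(1,2)] assms(3)] lim])
  then show ?thesis using tendsto_real_sqrt by fastforce
qed

lemma prim_tendsto:
  assumes "\<And>n. integrable lborel (s n)" "integrable lborel k"
    and "(\<lambda>n. LINT x|lborel. \<bar>s n x - k x\<bar>) \<longlonglongrightarrow> 0"
  shows "(\<lambda>n. prim (s n) x) \<longlonglongrightarrow> prim k x"
proof -
  have "(\<lambda>n. \<bar>prim (s n) x - prim k x\<bar>) \<longlonglongrightarrow> 0"
  proof (rule tendsto_zero_sandwich[OF _ _ assms(3)])
    show "\<bar>prim (s n) x - prim k x\<bar> \<le> (LINT x|lborel. \<bar>s n x - k x\<bar>)" for n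
      using prim_abs_le[OF Bochner_Integration.integrable_diff[OF assms(1)[of n] assms(2)], of x]
      by (simp add: prim_diff assms(1,2))
  qed simp
  then show ?thesis by (simp add: tendsto_rabs_zero_iff LIM_zero_iff)
qed

text \<open>The difference splits into m_n (s_n - k) and (m_n - l) k. The first part is controlled
  by the uniform bound \<open>C\<close>, the second by dominated convergence with 2 C |k|. This is
  the device that lets nonlinear factors such as \<open>pos_approx'\<close> of a primitive pass to
  the limit, as they converge only pointwise.\<close>

lemma integral_mult_tendsto:
  fixes m :: "nat \<Rightarrow> real \<Rightarrow> real"
  assumes [measurable]: "\<And>n. integrable lborel (s n)" "integrable lborel k"
    and [measurable]: "\<And>n. m n \<in> borel_measurable borel" "l \<in> borel_measurable borel"
    and lim: "(\<lambda>n. LINT x|lborel. \<bar>s n x - k x\<bar>) \<longlonglongrightarrow> 0"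
    and m: "\<And>n x. \<bar>m n x\<bar> \<le> C" "\<And>x. (\<lambda>n. m n x) \<longlonglongrightarrow> l x"
  shows "(\<lambda>n. LINT x|lborel. \<bar>m n x * s n x - l x * k x\<bar>) \<longlonglongrightarrow> 0"
proof -
  have l: "\<bar>l x\<bar> \<le> C" for x
    by (rule LIMSEQ_le_const2[OF tendsto_rabs[OF m(2)]]) (use m(1) in auto)
  have C: "0 \<le> C" using m(1)[of 0 0] by linarith
  have i1: "integrable lborel (\<lambda>x. \<bar>s n x - k x\<bar>)" for n using assms by auto
  have b: "\<bar>(m n x - l x) * k x\<bar> \<le> 2 * C * \<bar>k x\<bar>" for n x
    unfolding abs_mult using m(1)[of n x] l[of x] by (intro mult_right_mono) auto
  have i2: "integrable lborel (\<lambda>x. \<bar>(m n x - l x) * k x\<bar>)" for n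
    by (rule Bochner_Integration.integrable_bound[of _ "\<lambda>x. 2 * C * \<bar>k x\<bar>"])
      (use assms C b in \<open>auto simp: abs_mult\<close>)
  have "(\<lambda>n. LINT x|lborel. \<bar>(m n x - l x) * k x\<bar>) \<longlonglongrightarrow> (LINT x::real|lborel. (0::real))"
  proof (rule integral_dominated_convergence[where w = "\<lambda>x. 2 * C * \<bar>k x\<bar>"])
    have "(\<lambda>n. \<bar>(m n x - l x) * k x\<bar>) \<longlonglongrightarrow> \<bar>(l x - l x) * k x\<bar>" for x
      by (intro tendsto_intros m)
    then show "AE x in lborel. (\<lambda>n. \<bar>(m n x - l x) * k x\<bar>) \<longlonglongrightarrow> 0" by simp
  qed (use assms b in auto)
  then have "(\<lambda>n. C * (LINT x|lborel. \<bar>s n x - k x\<bar>) + (LINT x|lborel. \<bar>(m n x - l x) * k x\<bar>)) \<longlonglongrightarrow> C * 0 + 0"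
    using lim by (intro tendsto_intros) auto
  then have *: "(\<lambda>n. C * (LINT x|lborel. \<bar>s n x - k x\<bar>) + (LINT x|lborel. \<bar>(m n x - l x) * k x\<bar>)) \<longlonglongrightarrow> 0"
    by simp
  show ?thesis
  proof (rule tendsto_zero_sandwich[OF _ _ *])
    fix n
    have le: "\<bar>m n x * s n x - l x * k x\<bar> \<le> C * \<bar>s n x - k x\<bar> + \<bar>(m n x - l x) * k x\<bar>" for x
    proof -
      have "m n x * s n x - l x * k x = m n x * (s n x - k x) + (m n x - l x) * k x"
        by (simp add: algebra_simps)
      moreover have "\<bar>m n x * (s n x - k x)\<bar> \<le> C * \<bar>s n x - k x\<bar>"
        unfolding abs_mult using m(1) by (intro mult_right_mono) auto
      ultimately show ?thesis by linarith
    qed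
    have i3: "integrable lborel (\<lambda>x. C * \<bar>s n x - k x\<bar> + \<bar>(m n x - l x) * k x\<bar>)"
      using i1 i2 by auto
    have "integrable lborel (\<lambda>x. \<bar>m n x * s n x - l x * k x\<bar>)"
      by (rule Bochner_Integration.integrable_bound[OF i3]) (use le in \<open>auto intro: order_trans[OF _ abs_ge_self]\<close>)
    then have "(LINT x|lborel. \<bar>m n x * s n x - l x * k x\<bar>)
        \<le> (LINT x|lborel. C * \<bar>s n x - k x\<bar> + \<bar>(m n x - l x) * k x\<bar>)"
      using i3 le by (intro integral_mono) auto
    then show "(LINT x|lborel. \<bar>m n x * s n x - l x * k x\<bar>)
        \<le> C * (LINT x|lborel. \<bar>s n x - k x\<bar>) + (LINT x|lborel. \<bar>(m n x - l x) * k x\<bar>)"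
      using i1 i2 by simp
  qed simp
qed

lemma integral_tendsto_L1:
  fixes s :: "nat \<Rightarrow> real \<Rightarrow> real"
  assumes "\<And>n. integrable lborel (s n)" "integrable lborel k"
    and "(\<lambda>n. LINT x|lborel. \<bar>s n x - k x\<bar>) \<longlonglongrightarrow> 0"
  shows "(\<lambda>n. LINT x|lborel. s n x) \<longlonglongrightarrow> (LINT x|lborel. k x)"
proof -
  have "(\<lambda>n. \<bar>(LINT x|lborel. s n x) - (LINT x|lborel. k x)\<bar>) \<longlonglongrightarrow> 0"
  proof (rule tendsto_zero_sandwich[OF _ _ assms(3)])
    show "\<bar>(LINT x|lborel. s n x) - (LINT x|lborel. k x)\<bar> \<le> (LINT x|lborel. \<bar>s n x - k x\<bar>)" for n
      using integral_norm_bound[of lborel "\<lambda>x. s n x - k x"] assms(1,2) by simp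
  qed simp
  then show ?thesis by (simp add: tendsto_rabs_zero_iff LIM_zero_iff)
qed

subsection \<open>The positive part\<close>

lemma has_derivative_max_square:
  "((\<lambda>s. (max 0 s)\<^sup>2) has_real_derivative 2 * max 0 s) (at (s::real))"
proof -
  consider "s > 0" | "s < 0" | "s = 0" by linarith
  then show ?thesis
  proof cases
    case 1
    have "((\<lambda>s. s\<^sup>2) has_real_derivative 2 * s) (at s)" by (auto intro!: derivative_eq_intros)
    then have "((\<lambda>s. (max 0 s)\<^sup>2) has_real_derivative 2 * s) (at s)"
      by (rule has_field_derivative_transform_within_open[of _ _ _ "{0<..}"]) (use 1 in auto)
    then show ?thesis using 1 by simp
  next
    case 2
    have "((\<lambda>s. 0) has_real_derivative 0) (at s)" by simp
    then have "((\<lambda>s. (max 0 s)\<^sup>2) has_real_derivative 0) (at s)"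
      by (rule has_field_derivative_transform_within_open[of _ _ _ "{..<0}"]) (use 2 in auto)
    then show ?thesis using 2 by simp
  next
    case 3
    have "((\<lambda>h::real. (max 0 h)\<^sup>2 / h) \<longlongrightarrow> 0) (at 0)"
    proof (rule tendsto_rabs_zero_cancel, rule tendsto_zero_sandwich[where g = abs])
      show "\<bar>(max 0 h)\<^sup>2 / h\<bar> \<le> \<bar>h\<bar>" for h :: real
        by (auto simp: max_def power2_eq_square)
      show "(abs \<longlongrightarrow> (0::real)) (at 0)" by (rule tendsto_rabs_zero) (rule tendsto_ident_at)
    qed simp
    then show ?thesis using 3 by (simp add: DERIV_def)
  qed
qed

text \<open>
  Squaring first makes the regularisation continuously differentiable with a derivative that
  vanishes at \<open>s \<le> 0\<close>, so that the limit needs no information on the zero set of the truncated function.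
\<close>

definition pos_approx :: "real \<Rightarrow> real \<Rightarrow> real" where
  "pos_approx e s = sqrt ((max 0 s)\<^sup>2 + e\<^sup>2)"

definition pos_approx' :: "real \<Rightarrow> real \<Rightarrow> real" where
  "pos_approx' e s = max 0 s / sqrt ((max 0 s)\<^sup>2 + e\<^sup>2)"

lemma pos_approx_has_derivative:
  assumes "e > 0"
  shows "(pos_approx e has_real_derivative pos_approx' e s) (at s)"
proof -
  have p: "(max 0 s)\<^sup>2 + e\<^sup>2 > 0" using assms by (simp add: add_nonneg_pos)
  have "((\<lambda>s. (max 0 s)\<^sup>2 + e\<^sup>2) has_real_derivative 2 * max 0 s) (at s)"
    using DERIV_add[OF has_derivative_max_square DERIV_const] by simp
  then have "((\<lambda>s. sqrt ((max 0 s)\<^sup>2 + e\<^sup>2)) has_real_derivative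
      inverse (sqrt ((max 0 s)\<^sup>2 + e\<^sup>2)) / 2 * (2 * max 0 s)) (at s)"
    by (rule DERIV_chain2[of sqrt _ "\<lambda>s. (max 0 s)\<^sup>2 + e\<^sup>2" s, OF DERIV_real_sqrt[OF p]])
  moreover have "inverse (sqrt ((max 0 s)\<^sup>2 + e\<^sup>2)) / 2 * (2 * max 0 s) = pos_approx' e s"
    by (simp add: pos_approx'_def field_simps)
  moreover have "pos_approx e = (\<lambda>s. sqrt ((max 0 s)\<^sup>2 + e\<^sup>2))" by (rule ext) (rule pos_approx_def)
  ultimately show ?thesis by metis
qed

lemma pos_approx'_continuous: "e > 0 \<Longrightarrow> continuous_on UNIV (pos_approx' e)"
  unfolding pos_approx'_def[abs_def]
  by (intro continuous_intros) (auto simp: add_nonneg_eq_0_iff)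

lemma pos_approx'_bound: "\<bar>pos_approx' e s\<bar> \<le> 1"
proof -
  have "max 0 s \<le> sqrt ((max 0 s)\<^sup>2 + e\<^sup>2)" by (rule real_le_rsqrt) simp
  moreover have "0 \<le> max 0 s" by simp
  moreover have "\<bar>m / q\<bar> \<le> 1" if "0 \<le> m" "m \<le> q" for m q :: real
    using that by (cases "q = 0") auto
  ultimately show ?thesis unfolding pos_approx'_def by blast
qed

lemma pos_approx'_tendsto:
  "(\<lambda>n. pos_approx' (inverse (real (Suc n))) s) \<longlonglongrightarrow> (if s > 0 then 1 else 0)"
proof (cases "s > 0")
  case True
  have "(\<lambda>n. max 0 s / sqrt ((max 0 s)\<^sup>2 + (inverse (real (Suc n)))\<^sup>2)) \<longlonglongrightarrow>
      max 0 s / sqrt ((max 0 s)\<^sup>2 + 0\<^sup>2)"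
    using True by (intro tendsto_intros LIMSEQ_inverse_real_of_nat) auto
  then show ?thesis using True by (simp add: pos_approx'_def)
qed (simp add: pos_approx'_def)

lemma pos_approx_tendsto: "(\<lambda>n. pos_approx (inverse (real (Suc n))) s) \<longlonglongrightarrow> max 0 s"
proof -
  have "(\<lambda>n. sqrt ((max 0 s)\<^sup>2 + (inverse (real (Suc n)))\<^sup>2)) \<longlonglongrightarrow> sqrt ((max 0 s)\<^sup>2 + 0\<^sup>2)"
    by (intro tendsto_intros LIMSEQ_inverse_real_of_nat)
  then show ?thesis by (simp add: pos_approx_def)
qed

text \<open>The chain rule for the primitive of a merely square integrable function. For test
  functions in place of \<open>k\<close> the primitive is continuously differentiable and the rule
  is classical. In the limit the outer derivative stays bounded by 1 and converges pointwise,
  because the primitives do.\<close>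

lemma pos_approx_prim:
  assumes "sq_int a b k" "a < b" "e > 0"
  shows "pos_approx e (c + prim k x) = pos_approx e c + prim (\<lambda>s. pos_approx' e (c + prim k s) * k s) x"
proof -
  obtain \<phi> where \<phi>: "\<And>n::nat. test_function {a<..<b} (\<phi> n)"
    "(\<lambda>n. LINT x|lborel. (\<phi> n x - k x)\<^sup>2) \<longlonglongrightarrow> 0"
    using approximable_sequence[OF sq_int_approximable[OF assms(1)]] by blast
  have s: "sq_int a b (\<phi> n)" for n using sq_int_test_function[OF \<phi>(1)] .
  have L1: "(\<lambda>n. LINT x|lborel. \<bar>\<phi> n x - k x\<bar>) \<longlonglongrightarrow> 0"
    by (rule sq_int_tendsto_L1[OF s assms(1,2) \<phi>(2)])
  have lim: "(\<lambda>n. prim (\<phi> n) x) \<longlonglongrightarrow> prim k x" for x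
    by (rule prim_tendsto[OF sq_int_integrable[OF s] sq_int_integrable[OF assms(1)] L1])
  have c: "continuous_on UNIV (\<lambda>s. pos_approx' e (c + prim g s))" if "sq_int a b g" for g
    by (intro continuous_on_compose2[OF pos_approx'_continuous[OF assms(3)]] continuous_intros
        prim_continuous sq_int_integrable[OF that]) auto
  have m: "(\<lambda>s. pos_approx' e (c + prim g s)) \<in> borel_measurable borel" if "sq_int a b g" for g
    using borel_measurable_continuous_onI[OF c[OF that]] .
  have i: "sq_int a b (\<lambda>s. pos_approx' e (c + prim g s) * g s)" if "sq_int a b g" for g
    by (rule sq_int_mult_bounded[OF that m[OF that] pos_approx'_bound])
  have smooth: "pos_approx e (c + prim (\<phi> n) x) =
      pos_approx e c + prim (\<lambda>s. pos_approx' e (c + prim (\<phi> n) s) * \<phi> n s) x" for n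
  proof -
    have "((\<lambda>x. pos_approx e (c + prim (\<phi> n) x)) has_real_derivative
        pos_approx' e (c + prim (\<phi> n) x) * \<phi> n x) (at x)" for x
      by (rule DERIV_chain2[OF pos_approx_has_derivative[OF assms(3)]])
        (use DERIV_add[OF DERIV_const prim_test_function_deriv[OF \<phi>(1)]] in simp)
    then have "pos_approx e (c + prim (\<phi> n) x) = pos_approx e (c + prim (\<phi> n) a) +
        prim (\<lambda>s. pos_approx' e (c + prim (\<phi> n) s) * \<phi> n s) x"
      by (rule prim_eqI[rotated 3])
        (auto intro!: sq_int_integrable[OF i[OF s]] continuous_on_mult c[OF s]
          test_function_continuous[OF \<phi>(1)] simp: test_function_outside[OF \<phi>(1)])
    then show ?thesis by (simp add: prim_left[OF s])
  qed
  have cont: "isCont (pos_approx e) y" "isCont (pos_approx' e) y" for y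
    using DERIV_isCont[OF pos_approx_has_derivative[OF assms(3)]] pos_approx'_continuous[OF assms(3)]
    by (auto simp: continuous_on_eq_continuous_at)
  have "(\<lambda>n. pos_approx e (c + prim (\<phi> n) x)) \<longlonglongrightarrow> pos_approx e (c + prim k x)"
    by (intro isCont_tendsto_compose[OF cont(1)] tendsto_intros lim)
  moreover have "(\<lambda>n. prim (\<lambda>s. pos_approx' e (c + prim (\<phi> n) s) * \<phi> n s) x)
      \<longlonglongrightarrow> prim (\<lambda>s. pos_approx' e (c + prim k s) * k s) x"
  proof (rule prim_tendsto[OF sq_int_integrable[OF i[OF s]] sq_int_integrable[OF i[OF assms(1)]]])
    show "(\<lambda>n. LINT y|lborel. \<bar>pos_approx' e (c + prim (\<phi> n) y) * \<phi> n y
        - pos_approx' e (c + prim k y) * k y\<bar>) \<longlonglongrightarrow> 0"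
      by (rule integral_mult_tendsto[OF sq_int_integrable[OF s] sq_int_integrable[OF assms(1)]
            m[OF s] m[OF assms(1)] L1 pos_approx'_bound])
        (intro isCont_tendsto_compose[OF cont(2)] tendsto_intros lim)
  qed
  ultimately have "(\<lambda>n. pos_approx e (c + prim (\<phi> n) x)) \<longlonglongrightarrow>
      pos_approx e c + prim (\<lambda>s. pos_approx' e (c + prim k s) * k s) x"
    unfolding smooth by (intro tendsto_intros)
  then show ?thesis
    using \<open>(\<lambda>n. pos_approx e (c + prim (\<phi> n) x)) \<longlonglongrightarrow> pos_approx e (c + prim k x)\<close>
      LIMSEQ_unique by blast
qed

text \<open>The derivative of a positive part is the derivative cut off to the set of positivity. It
  arises from \<open>pos_approx_prim\<close> as e tends to 0, because \<open>pos_approx'\<close>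
  converges to the indicator of the positive reals at every point, 0 included.\<close>

theorem max_prim:
  assumes "sq_int a b k" "a < b"
  shows "max 0 (c + prim k x) = max 0 c + prim (\<lambda>s. (if c + prim k s > 0 then 1 else 0) * k s) x"
proof -
  have c: "continuous_on UNIV (\<lambda>s. c + prim k s)"
    by (intro continuous_intros prim_continuous sq_int_integrable[OF assms(1)])
  have m: "(\<lambda>s. pos_approx' (inverse (real (Suc n))) (c + prim k s)) \<in> borel_measurable borel" for n
    by (intro borel_measurable_continuous_onI continuous_on_compose2[OF pos_approx'_continuous c]) auto
  have [measurable]: "(\<lambda>s. c + prim k s) \<in> borel_measurable borel"
    by (rule borel_measurable_continuous_onI[OF c])
  have m': "(\<lambda>s. if c + prim k s > 0 then 1 else 0 :: real) \<in> borel_measurable borel" by measurable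
  note k = sq_int_integrable[OF assms(1)]
  \<comment> \<open>Here \<open>k\<close> is fixed and only the bounded factor varies, so the L1
    hypothesis of \<open>integral_mult_tendsto\<close> is met by the constant sequence.\<close>
  have L0: "(\<lambda>n::nat. LINT x|lborel. \<bar>k x - k x\<bar>) \<longlonglongrightarrow> 0" by simp
  have "(\<lambda>n. prim (\<lambda>s. pos_approx' (inverse (real (Suc n))) (c + prim k s) * k s) x)
      \<longlonglongrightarrow> prim (\<lambda>s. (if c + prim k s > 0 then 1 else 0) * k s) x"
    by (rule prim_tendsto[OF sq_int_integrable[OF sq_int_mult_bounded[OF assms(1) m pos_approx'_bound]]
          sq_int_integrable[OF sq_int_mult_bounded[OF assms(1) m']]
          integral_mult_tendsto[OF k k m m' L0 pos_approx'_bound pos_approx'_tendsto]])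
      auto
  moreover have "(\<lambda>n. pos_approx (inverse (real (Suc n))) c) \<longlonglongrightarrow> max 0 c" by (rule pos_approx_tendsto)
  ultimately have "(\<lambda>n. pos_approx (inverse (real (Suc n))) (c + prim k x)) \<longlonglongrightarrow>
      max 0 c + prim (\<lambda>s. (if c + prim k s > 0 then 1 else 0) * k s) x"
    using pos_approx_prim[OF assms] by (simp add: tendsto_add)
  then show ?thesis using pos_approx_tendsto LIMSEQ_unique by blast
qed

subsection \<open>Integration by parts\<close>

text \<open>For test functions in place of \<open>k\<close> this is the product rule integrated from
  a to b, the boundary terms vanishing with \<open>\<psi>\<close>; density does the rest. The
  constant \<open>c\<close> leaves no trace on the right since \<open>deriv \<psi>\<close> has
  integral 0.\<close>

theorem prim_by_parts:
  assumes "sq_int a b k" "a < b" "test_function {a<..<b} \<psi>"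
  shows "(LINT x|lborel. (c + prim k x) * deriv \<psi> x) = - (LINT x|lborel. k x * \<psi> x)"
proof -
  obtain \<phi> where \<phi>: "\<And>n::nat. test_function {a<..<b} (\<phi> n)"
    "(\<lambda>n. LINT x|lborel. (\<phi> n x - k x)\<^sup>2) \<longlonglongrightarrow> 0"
    using approximable_sequence[OF sq_int_approximable[OF assms(1)]] by blast
  have s: "sq_int a b (\<phi> n)" for n using sq_int_test_function[OF \<phi>(1)] .
  have L1: "(\<lambda>n. LINT x|lborel. \<bar>\<phi> n x - k x\<bar>) \<longlonglongrightarrow> 0"
    by (rule sq_int_tendsto_L1[OF s assms(1,2) \<phi>(2)])
  have lim: "(\<lambda>n. prim (\<phi> n) x) \<longlonglongrightarrow> prim k x" for x
    by (rule prim_tendsto[OF sq_int_integrable[OF s] sq_int_integrable[OF assms(1)] L1])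
  note d = test_function_deriv[OF assms(3)]
  note \<psi>i = sq_int_integrable[OF sq_int_test_function[OF assms(3)]]
  note di = sq_int_integrable[OF sq_int_test_function[OF d]]
  have pm: "(\<lambda>x. c + prim g x) \<in> borel_measurable borel" if "sq_int a b g" for g
    by (intro borel_measurable_continuous_onI continuous_intros prim_continuous sq_int_integrable[OF that])
  have \<psi>m: "\<psi> \<in> borel_measurable borel" "deriv \<psi> \<in> borel_measurable borel"
    using sq_int_test_function[OF assms(3)] sq_int_test_function[OF d] by (auto simp: sq_int_def)
  \<comment> \<open>\<open>\<psi>\<close> is the primitive of its derivative and hence bounded by
    the L1 norm of that derivative.\<close>
  obtain C where C: "\<And>x. \<bar>\<psi> x\<bar> \<le> C"
    using prim_abs_le[OF di] prim_deriv_test_function[OF assms(3)] by metis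
  have C0: "0 \<le> C" using C[of 0] by linarith
  have i1: "integrable lborel (\<lambda>x. (c + prim g x) * deriv \<psi> x)" if "sq_int a b g" for g
  proof (rule Bochner_Integration.integrable_bound)
    show "integrable lborel (\<lambda>x. (\<bar>c\<bar> + (LINT s|lborel. \<bar>g s\<bar>)) * \<bar>deriv \<psi> x\<bar>)"
      using di by auto
    have "\<bar>c + prim g x\<bar> \<le> \<bar>c\<bar> + (LINT s|lborel. \<bar>g s\<bar>)" for x
      using prim_abs_le[OF sq_int_integrable[OF that], of x] by linarith
    from order_trans[OF this abs_ge_self]
    show "AE x in lborel. norm ((c + prim g x) * deriv \<psi> x)
        \<le> norm ((\<bar>c\<bar> + (LINT s|lborel. \<bar>g s\<bar>)) * \<bar>deriv \<psi> x\<bar>)"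
      unfolding real_norm_def abs_mult abs_abs by (intro AE_I2 mult_right_mono abs_ge_zero)
  qed (use pm[OF that] \<psi>m in measurable)
  have i2: "integrable lborel (\<lambda>x. \<psi> x * g x)" if "sq_int a b g" for g
    by (rule Bochner_Integration.integrable_bound[of _ "\<lambda>x. C * \<bar>g x\<bar>"])
      (use sq_int_integrable[OF that] C C0 \<psi>m in \<open>auto simp: abs_mult intro!: mult_right_mono\<close>)
  have smooth: "(LINT x|lborel. (c + prim (\<phi> n) x) * deriv \<psi> x) = - (LINT x|lborel. \<psi> x * \<phi> n x)" for n
  proof -
    have der: "((\<lambda>x. (c + prim (\<phi> n) x) * \<psi> x) has_real_derivative
        \<phi> n x * \<psi> x + deriv \<psi> x * (c + prim (\<phi> n) x)) (at x)" for x
      by (intro DERIV_mult test_function_has_deriv[OF assms(3)])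
        (use DERIV_add[OF DERIV_const prim_test_function_deriv[OF \<phi>(1)]] in simp)
    have "(c + prim (\<phi> n) b) * \<psi> b = (c + prim (\<phi> n) a) * \<psi> a +
        prim (\<lambda>x. \<phi> n x * \<psi> x + deriv \<psi> x * (c + prim (\<phi> n) x)) b"
    proof (rule prim_eqI[OF _ _ _ der])
      show "integrable lborel (\<lambda>x. \<phi> n x * \<psi> x + deriv \<psi> x * (c + prim (\<phi> n) x))"
        using Bochner_Integration.integrable_add[OF i2[OF s] i1[OF s]] by (simp add: mult.commute)
      show "continuous_on UNIV (\<lambda>x. \<phi> n x * \<psi> x + deriv \<psi> x * (c + prim (\<phi> n) x))"
        by (intro continuous_intros test_function_continuous[OF \<phi>(1)] test_function_continuous[OF d]
            test_function_continuous[OF assms(3)] prim_continuous sq_int_integrable[OF s])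
    qed (simp add: test_function_outside[OF \<phi>(1)] test_function_outside[OF d])
    then have "prim (\<lambda>x. \<phi> n x * \<psi> x + deriv \<psi> x * (c + prim (\<phi> n) x)) b = 0"
      using test_function_outside[OF assms(3), of a] test_function_outside[OF assms(3), of b] by simp
    moreover have "prim (\<lambda>x. \<phi> n x * \<psi> x + deriv \<psi> x * (c + prim (\<phi> n) x)) b =
       (LINT x|lborel. \<phi> n x * \<psi> x + deriv \<psi> x * (c + prim (\<phi> n) x))"
      by (rule prim_eq_integral) (simp add: test_function_outside[OF \<phi>(1)] test_function_outside[OF d])
    ultimately show ?thesis
      using i1[OF s[of n]] i2[OF s[of n]] by (simp add: mult.commute)
  qed
  have "(\<lambda>n. LINT x|lborel. (c + prim (\<phi> n) x) * deriv \<psi> x) \<longlonglongrightarrow> (LINT x|lborel. (c + prim k x) * deriv \<psi> x)"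
  proof -
    \<comment> \<open>Convergence makes the L1 distances bounded, which bounds all primitives
      \<open>prim (\<phi> n)\<close> uniformly in n and x, as \<open>integral_mult_tendsto\<close>
      demands.\<close>
    obtain B where B: "\<And>n. (LINT x|lborel. \<bar>\<phi> n x - k x\<bar>) \<le> B"
      using convergent_imp_Bseq[OF convergentI[OF L1]] unfolding Bseq_def by (auto simp: abs_le_iff)
    have "\<bar>c + prim (\<phi> n) x\<bar> \<le> \<bar>c\<bar> + (B + (LINT x|lborel. \<bar>k x\<bar>))" for n x
      using prim_abs_le[OF sq_int_integrable[OF sq_int_diff[OF s[of n] assms(1)]], of x] B[of n]
        prim_abs_le[OF sq_int_integrable[OF assms(1)], of x]
        prim_diff[OF sq_int_integrable[OF s[of n]] sq_int_integrable[OF assms(1)], of x]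
      by linarith
    then show ?thesis
      by (intro integral_tendsto_L1 i1[OF s] i1[OF assms(1)]
          integral_mult_tendsto[OF di di pm[OF s] pm[OF assms(1)]]) (auto intro!: tendsto_intros lim)
  qed
  moreover have "(\<lambda>n. - (LINT x|lborel. \<psi> x * \<phi> n x)) \<longlonglongrightarrow> - (LINT x|lborel. \<psi> x * k x)"
    by (intro tendsto_minus integral_tendsto_L1 i2[OF s] i2[OF assms(1)] integral_mult_tendsto[OF
          sq_int_integrable[OF s] sq_int_integrable[OF assms(1)] \<psi>m(1) \<psi>m(1) L1 C]) auto
  ultimately show ?thesis
    unfolding smooth using LIMSEQ_unique by (auto simp: mult.commute)
qed

section \<open>Sobolev functions on an interval\<close>

lemma set_integral_lebesgue_borel:
  fixes f :: "'a::euclidean_space \<Rightarrow> real"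
  assumes "f \<in> borel_measurable borel" "S \<in> sets borel"
  shows "(LINT x:S|lebesgue. f x) = (LINT x|lborel. indicator S x * f x)"
  using assms unfolding set_lebesgue_integral_def by (simp add: integral_completion)

lemma L2_on_borel:
  fixes f :: "'a::euclidean_space \<Rightarrow> real"
  assumes [measurable]: "f \<in> borel_measurable borel" "S \<in> sets borel"
    and "integrable lborel (\<lambda>x. indicator S x * (f x)\<^sup>2)"
  shows "L2_on S f"
proof -
  have "(\<lambda>x. indicator S x *\<^sub>R f x) \<in> borel_measurable lebesgue"
    by (rule measurable_completion) measurable
  moreover have "integrable lebesgue (\<lambda>x. indicator S x *\<^sub>R (f x)\<^sup>2)"
    by (subst integrable_completion) (use assms in auto)
  ultimately show ?thesis unfolding L2_on_def set_borel_measurable_def set_integrable_def by simp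
qed

lemma L2_on_cong:
  assumes "L2_on S f" "\<And>x. x \<in> S \<Longrightarrow> f x = g x"
  shows "L2_on S g"
proof -
  have "(\<lambda>x. indicator S x *\<^sub>R f x) = (\<lambda>x. indicator S x *\<^sub>R g x)"
    "(\<lambda>x. indicator S x *\<^sub>R (f x)\<^sup>2) = (\<lambda>x. indicator S x *\<^sub>R (g x)\<^sup>2)"
    using assms(2) by (auto simp: indicator_def)
  then show ?thesis
    using assms(1) unfolding L2_on_def set_borel_measurable_def set_integrable_def by simp
qed

lemma L2_norm_on_cong:
  assumes "\<And>x. x \<in> S \<Longrightarrow> f x = g x"
  shows "L2_norm_on S f = L2_norm_on S g"
proof -
  have "(\<lambda>x. indicator S x *\<^sub>R (f x)\<^sup>2) = (\<lambda>x. indicator S x *\<^sub>R (g x)\<^sup>2)"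
    using assms by (auto simp: indicator_def)
  then show ?thesis by (simp add: L2_norm_on_def set_lebesgue_integral_def)
qed

lemma sq_int_L2_on: "sq_int a b k \<Longrightarrow> L2_on {a<..<b} k"
proof (rule L2_on_borel)
  assume k: "sq_int a b k"
  have "(\<lambda>x. indicator {a<..<b} x * (k x)\<^sup>2) = (\<lambda>x. (k x)\<^sup>2)"
    using sq_int_outside[OF k] by (force simp: indicator_def)
  then show "integrable lborel (\<lambda>x. indicator {a<..<b} x * (k x)\<^sup>2)"
    using sq_int_square[OF k] by simp
qed (auto simp: sq_int_def)

lemma L2_norm_on_sq_int:
  assumes "sq_int a b k"
  shows "L2_norm_on {a<..<b} k = sqrt (LINT x|lborel. (k x)\<^sup>2)"
proof -
  have "(\<lambda>x. indicator {a<..<b} x * (k x)\<^sup>2) = (\<lambda>x. (k x)\<^sup>2)"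
    using sq_int_outside[OF assms] by (force simp: indicator_def)
  moreover have "(\<lambda>x. (k x)\<^sup>2) \<in> borel_measurable borel" using assms by (auto simp: sq_int_def)
  ultimately show ?thesis unfolding L2_norm_on_def by (simp add: set_integral_lebesgue_borel)
qed

text \<open>The function spaces use the completed measure and ignore values outside the interval. A
  Borel function equal almost everywhere to the cut-off of \<open>g\<close>, cut off once more,
  leads back to \<open>sq_int\<close>.\<close>

lemma L2_on_representative:
  assumes "L2_on {a<..<b} g"
  obtains k where "sq_int a b k" "AE x in lborel. x \<in> {a<..<b} \<longrightarrow> g x = k x"
proof -
  let ?I = "indicator {a<..<b} :: real \<Rightarrow> real"
  have m: "(\<lambda>x. ?I x * g x) \<in> borel_measurable lebesgue"
    and i: "integrable lebesgue (\<lambda>x. ?I x * (g x)\<^sup>2)"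
    using assms unfolding L2_on_def set_borel_measurable_def set_integrable_def by auto
  obtain h where h: "h \<in> borel_measurable lborel" "AE x in lborel. ?I x * g x = h x"
    using completion_ex_borel_measurable_real[OF m] by blast
  define k where "k x = ?I x * h x" for x
  have km [measurable]: "k \<in> borel_measurable borel" using h(1) unfolding k_def by simp
  have ae: "AE x in lborel. ?I x * g x = k x"
    using h(2)
  proof eventually_elim
    case (elim x)
    then show ?case by (cases "x \<in> {a<..<b}") (simp_all add: k_def)
  qed
  have "AE x in lebesgue. ?I x * (g x)\<^sup>2 = (k x)\<^sup>2"
    using AE_completion[OF ae] by eventually_elim (auto simp: indicator_def split: if_splits)
  then have "integrable lebesgue (\<lambda>x. (k x)\<^sup>2)"
    by (rule integrable_cong_AE_imp[OF i, rotated]) (simp add: measurable_completion)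
  then have "integrable lborel (\<lambda>x. (k x)\<^sup>2)"
    by (subst (asm) integrable_completion) simp_all
  then have "sq_int a b k"
    unfolding sq_int_def using km by (simp add: k_def)
  moreover have "AE x in lborel. x \<in> {a<..<b} \<longrightarrow> g x = k x"
    using ae by eventually_elim auto
  ultimately show ?thesis by (rule that)
qed

lemma L2_norm_on_representative:
  assumes "L2_on {a<..<b} g" "sq_int a b k" "AE x in lborel. x \<in> {a<..<b} \<longrightarrow> g x = k x" "sq_int a b s"
  shows "L2_norm_on {a<..<b} (\<lambda>x. s x - g x) = sqrt (LINT x|lborel. (s x - k x)\<^sup>2)"
proof -
  let ?I = "indicator {a<..<b} :: real \<Rightarrow> real"
  have ig: "(\<lambda>x. ?I x * g x) \<in> borel_measurable lebesgue"
    using assms unfolding L2_on_def set_borel_measurable_def by auto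
  have sm: "s \<in> borel_measurable lebesgue" and [simp]: "k \<in> borel_measurable lebesgue"
    using assms by (auto simp: sq_int_def intro: measurable_completion)
  \<comment> \<open>Nothing is known about \<open>g\<close> outside the interval, not even
    measurability, so it has to be replaced by its cut-off.\<close>
  have "(\<lambda>x. ?I x * (s x - g x)\<^sup>2) = (\<lambda>x. ?I x * (s x - ?I x * g x)\<^sup>2)"
    by (auto simp: indicator_def)
  moreover have "(\<lambda>x. ?I x * (s x - ?I x * g x)\<^sup>2) \<in> borel_measurable lebesgue"
    by (rule borel_measurable_times[OF _ borel_measurable_power[OF borel_measurable_diff[OF sm ig]]])
      (simp add: measurable_completion)
  ultimately have m: "(\<lambda>x. ?I x * (s x - g x)\<^sup>2) \<in> borel_measurable lebesgue" by metis
  have "AE x in lebesgue. ?I x * (s x - g x)\<^sup>2 = (s x - k x)\<^sup>2"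
    using AE_completion[OF assms(3)]
    by eventually_elim (auto simp: indicator_def sq_int_outside[OF assms(2)] sq_int_outside[OF assms(4)])
  then have "(LINT x|lebesgue. ?I x * (s x - g x)\<^sup>2) = (LINT x|lebesgue. (s x - k x)\<^sup>2)"
    by (intro integral_cong_AE m borel_measurable_power borel_measurable_diff sm) auto
  also have "\<dots> = (LINT x|lborel. (s x - k x)\<^sup>2)"
    using assms by (intro integral_completion) (auto simp: sq_int_def)
  finally show ?thesis by (simp add: L2_norm_on_def set_lebesgue_integral_def)
qed

text \<open>L2 convergence of the derivatives bounds the difference of the primitives uniformly by
  the L1 distance \<open>d n\<close>, and on an interval of length b - a this controls the L2
  norm.\<close>

lemma prim_tendsto_L2:
  assumes "\<And>n. sq_int a b (s n)" "sq_int a b k" "a < b"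
    and "(\<lambda>n. LINT x|lborel. (s n x - k x)\<^sup>2) \<longlonglongrightarrow> 0"
  shows "(\<lambda>n. LINT x|lborel. (indicator {a<..<b} x * prim (s n) x - indicator {a<..<b} x * prim k x)\<^sup>2) \<longlonglongrightarrow> 0"
proof -
  let ?I = "indicator {a<..<b} :: real \<Rightarrow> real"
  define d where "d n = (LINT x|lborel. \<bar>s n x - k x\<bar>)" for n
  have "(\<lambda>n. (d n)\<^sup>2 * (b - a)) \<longlonglongrightarrow> 0\<^sup>2 * (b - a)"
    unfolding d_def by (intro tendsto_intros sq_int_tendsto_L1[OF assms])
  then have lim: "(\<lambda>n. (d n)\<^sup>2 * (b - a)) \<longlonglongrightarrow> 0" by simp
  show ?thesis
  proof (rule tendsto_zero_sandwich[OF _ _ lim])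
    fix n
    have le: "(?I x * prim (s n) x - ?I x * prim k x)\<^sup>2 \<le> (d n)\<^sup>2 * ?I x" for x
    proof -
      have "\<bar>prim (s n) x - prim k x\<bar> \<le> d n"
        using prim_abs_le[OF sq_int_integrable[OF sq_int_diff[OF assms(1)[of n] assms(2)]], of x]
          prim_diff[OF sq_int_integrable[OF assms(1)[of n]] sq_int_integrable[OF assms(2)], of x]
        by (simp add: d_def)
      then have "(prim (s n) x - prim k x)\<^sup>2 \<le> (d n)\<^sup>2" by (rule power2_le_iff_abs_le[THEN iffD2, rotated]) (simp add: d_def)
      then show ?thesis by (simp add: indicator_def)
    qed
    have m: "prim (s n) \<in> borel_measurable borel" "prim k \<in> borel_measurable borel"
      using prim_continuous[OF sq_int_integrable[OF assms(1)]]
        prim_continuous[OF sq_int_integrable[OF assms(2)]] borel_measurable_continuous_onI by blast+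
    have i: "integrable lborel (\<lambda>x. (d n)\<^sup>2 * ?I x)"
      by (intro integrable_mult_right integrable_indicator_interval)
    have "integrable lborel (\<lambda>x. (?I x * prim (s n) x - ?I x * prim k x)\<^sup>2)"
      by (rule Bochner_Integration.integrable_bound[OF i]) (use m le in auto)
    then have "(LINT x|lborel. (?I x * prim (s n) x - ?I x * prim k x)\<^sup>2) \<le> (LINT x|lborel. (d n)\<^sup>2 * ?I x)"
      using le i by (intro integral_mono) auto
    then show "(LINT x|lborel. (?I x * prim (s n) x - ?I x * prim k x)\<^sup>2) \<le> (d n)\<^sup>2 * (b - a)"
      using assms(3) by simp
  qed simp
qed

section \<open>Primitives as elements of H^1 and H^1_0\<close>

lemma sq_int_prim:
  assumes "integrable lborel k"
  shows "sq_int a b (\<lambda>x. indicator {a<..<b} x * (c + prim k x))"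
proof (rule sq_int_bounded)
  have "(\<lambda>x. c + prim k x) \<in> borel_measurable borel"
    by (intro borel_measurable_continuous_onI continuous_intros prim_continuous assms)
  then show "(\<lambda>x. indicator {a<..<b} x * (c + prim k x)) \<in> borel_measurable borel" by simp
  have "\<bar>c + prim k x\<bar> \<le> \<bar>c\<bar> + (LINT s|lborel. \<bar>k s\<bar>)" for x
    using prim_abs_le[OF assms, of x] by linarith
  moreover have "0 \<le> \<bar>c\<bar> + (LINT s|lborel. \<bar>k s\<bar>)" by simp
  ultimately show "\<bar>indicator {a<..<b} x * (c + prim k x)\<bar> \<le> \<bar>c\<bar> + (LINT s|lborel. \<bar>k s\<bar>)" for x
    by (cases "x \<in> {a<..<b}") simp_all
qed simp

lemma set_integral_prim_by_parts:
  assumes "sq_int a b k" "a < b" "test_function {a<..<b} \<psi>"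
    and "\<And>x. x \<in> {a<..<b} \<Longrightarrow> f x = c + prim k x" "\<And>x. x \<in> {a<..<b} \<Longrightarrow> g x = k x"
  shows "(LINT x:{a<..<b}|lebesgue. f x * deriv \<psi> x) = - (LINT x:{a<..<b}|lebesgue. g x * \<psi> x)"
proof -
  note d = test_function_deriv[OF assms(3)]
  have [measurable]: "prim k \<in> borel_measurable borel" "k \<in> borel_measurable borel"
    "\<psi> \<in> borel_measurable borel" "deriv \<psi> \<in> borel_measurable borel"
    using prim_continuous[OF sq_int_integrable[OF assms(1)]] borel_measurable_continuous_onI assms(1)
      sq_int_test_function[OF assms(3)] sq_int_test_function[OF d] by (auto simp: sq_int_def)
  have "(LINT x:{a<..<b}|lebesgue. f x * deriv \<psi> x) = (LINT x:{a<..<b}|lebesgue. (c + prim k x) * deriv \<psi> x)"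
    using assms(4) by (intro set_lebesgue_integral_cong) auto
  also have "\<dots> = (LINT x|lborel. indicator {a<..<b} x * ((c + prim k x) * deriv \<psi> x))"
    by (rule set_integral_lebesgue_borel) auto
  also have "\<dots> = (LINT x|lborel. (c + prim k x) * deriv \<psi> x)"
    using test_function_outside[OF d] by (intro Bochner_Integration.integral_cong) (auto simp: indicator_def)
  also have "\<dots> = - (LINT x|lborel. k x * \<psi> x)" by (rule prim_by_parts[OF assms(1-3)])
  also have "(LINT x|lborel. k x * \<psi> x) = (LINT x|lborel. indicator {a<..<b} x * (k x * \<psi> x))"
    using test_function_outside[OF assms(3)] by (intro Bochner_Integration.integral_cong) (auto simp: indicator_def)
  also have "\<dots> = (LINT x:{a<..<b}|lebesgue. k x * \<psi> x)"
    by (rule set_integral_lebesgue_borel[symmetric]) auto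
  also have "\<dots> = (LINT x:{a<..<b}|lebesgue. g x * \<psi> x)"
    using assms(5) by (intro set_lebesgue_integral_cong) auto
  finally show ?thesis .
qed

lemma H1_deriv_prim:
  assumes "sq_int a b k" "a < b"
    and f: "\<And>x. x \<in> {a<..<b} \<Longrightarrow> f x = c + prim k x" and g: "\<And>x. x \<in> {a<..<b} \<Longrightarrow> g x = k x"
  shows "H1_deriv {a<..<b} f g"
proof -
  have "L2_on {a<..<b} f"
    by (rule L2_on_cong[OF sq_int_L2_on[OF sq_int_prim[OF sq_int_integrable[OF assms(1)], of _ _ c]]])
      (use f in auto)
  moreover have "L2_on {a<..<b} g"
    by (rule L2_on_cong[OF sq_int_L2_on[OF assms(1)]]) (use g in auto)
  ultimately show ?thesis
    unfolding H1_deriv_def using set_integral_prim_by_parts[OF assms(1,2) _ f g] by blast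
qed

text \<open>To the right of the support the primitive equals the total integral, so mean zero is
  exactly what keeps its support compact.\<close>

lemma test_function_prim:
  assumes "test_function {a<..<b} \<phi>" "(LINT x|lborel. \<phi> x) = 0"
  shows "test_function {a<..<b} (prim \<phi>)"
proof -
  obtain c d where cd: "a < c" "d < b" "\<And>x. x \<notin> {c..d} \<Longrightarrow> \<phi> x = 0"
    using test_function_vanishes[OF assms(1)] by blast
  have Ck: "Ck_on k {a<..<b} \<phi>" for k using assms(1) unfolding test_function_def smooth_on_def by blast
  show ?thesis
  proof (rule test_functionI[OF _ cd(1,2)])
    fix k
    have "Ck_on (Suc k) {a<..<b} (prim \<phi>)"
      unfolding Ck_on_Suc_real
      using Ck[of k] has_field_derivative_at_within[OF prim_test_function_deriv[OF assms(1)]] by blast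
    then show "Ck_on k {a<..<b} (prim \<phi>)" by (rule Ck_on_Suc_imp)
  next
    fix x assume "x \<notin> {c..d}"
    then consider "x < c" | "x > d" by force
    then show "prim \<phi> x = 0"
    proof cases
      case 1
      then show ?thesis using cd(3) by (intro prim_eq_0) auto
    next
      case 2
      then show ?thesis using cd(3) assms(2) by (subst prim_eq_integral) auto
    qed
  qed
qed

text \<open>Test functions approximating the indicator of the interval have integrals tending to b -
  a > 0, so one of them can be normalised.\<close>

lemma test_function_unit_integral:
  fixes a b :: real
  assumes "a < b"
  obtains \<beta> where "test_function {a<..<b} \<beta>" "(LINT x|lborel. \<beta> x) = 1"
proof -
  have s: "sq_int a b (indicator {a<..<b})" by (rule sq_int_indicator) auto
  obtain \<phi> where \<phi>: "\<And>n::nat. test_function {a<..<b} (\<phi> n)"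
    "(\<lambda>n. LINT x|lborel. (\<phi> n x - indicator {a<..<b} x)\<^sup>2) \<longlonglongrightarrow> 0"
    using approximable_sequence[OF sq_int_approximable[OF s]] by blast
  have "(\<lambda>n. LINT x|lborel. \<phi> n x) \<longlonglongrightarrow> (LINT x|lborel. indicator {a<..<b} x)"
    by (intro integral_tendsto_L1 sq_int_integrable[OF s] sq_int_integrable[OF sq_int_test_function[OF \<phi>(1)]]
        sq_int_tendsto_L1[OF sq_int_test_function[OF \<phi>(1)] s assms \<phi>(2)])
  moreover have "(LINT x|lborel. indicator {a<..<b} x) > (0::real)" using assms by simp
  ultimately have "eventually (\<lambda>n. (LINT x|lborel. \<phi> n x) > 0) sequentially" by (rule order_tendstoD(1))
  then obtain n where n: "(LINT x|lborel. \<phi> n x) > 0" by (auto simp: eventually_sequentially)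
  show ?thesis
  proof (rule that)
    show "test_function {a<..<b} (\<lambda>x. inverse (LINT x|lborel. \<phi> n x) * \<phi> n x + 0 * \<phi> n x)"
      by (intro test_function_lincomb \<phi>)
    show "(LINT x|lborel. inverse (LINT x|lborel. \<phi> n x) * \<phi> n x + 0 * \<phi> n x) = 1"
      using n by simp
  qed
qed

text \<open>Primitives of test functions close to \<open>k\<close> need not have compact support, as
  their means \<open>m n\<close> may differ from 0. These means tend to that of \<open>k\<close>,
  which is 0, so subtracting \<open>m n\<close> times a fixed test function of integral 1 repairs
  the support and does not disturb the limit.\<close>

theorem H10_prim:
  assumes k: "sq_int a b k" "(LINT x|lborel. k x) = 0" and "a < b"
    and f: "\<And>x. x \<in> {a<..<b} \<Longrightarrow> f x = prim k x"
  shows "f \<in> H10 {a<..<b}"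
proof -
  let ?I = "indicator {a<..<b} :: real \<Rightarrow> real"
  obtain \<kappa> where \<kappa>: "\<And>n::nat. test_function {a<..<b} (\<kappa> n)"
    "(\<lambda>n. LINT x|lborel. (\<kappa> n x - k x)\<^sup>2) \<longlonglongrightarrow> 0"
    using approximable_sequence[OF sq_int_approximable[OF k(1)]] by blast
  obtain \<beta> where \<beta>: "test_function {a<..<b} \<beta>" "(LINT x|lborel. \<beta> x) = 1"
    using test_function_unit_integral[OF assms(3)] by blast
  note \<kappa>s = sq_int_test_function[OF \<kappa>(1)] and \<beta>s = sq_int_test_function[OF \<beta>(1)]
  define m where "m n = (LINT x|lborel. \<kappa> n x)" for n
  have m: "m \<longlonglongrightarrow> 0"
    using integral_tendsto_L1[OF sq_int_integrable[OF \<kappa>s] sq_int_integrable[OF k(1)]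
        sq_int_tendsto_L1[OF \<kappa>s k(1) assms(3) \<kappa>(2)]] by (simp add: m_def[abs_def] k(2))
  define \<tau> where "\<tau> n x = 1 * \<kappa> n x + (- m n) * \<beta> x" for n x
  have \<tau>: "test_function {a<..<b} (\<tau> n)" for n
    unfolding \<tau>_def by (intro test_function_lincomb \<kappa> \<beta>)
  note \<tau>s = sq_int_test_function[OF \<tau>]
  have \<tau>0: "(LINT x|lborel. \<tau> n x) = 0" for n
    unfolding \<tau>_def using sq_int_integrable[OF \<kappa>s] sq_int_integrable[OF \<beta>s] by (simp add: m_def \<beta>)
  have "(\<lambda>n. 2 * ((m n)\<^sup>2 * (LINT x|lborel. (\<beta> x)\<^sup>2)) + 2 * (LINT x|lborel. (\<kappa> n x - k x)\<^sup>2)) \<longlonglongrightarrow>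
      2 * (0\<^sup>2 * (LINT x|lborel. (\<beta> x)\<^sup>2)) + 2 * 0"
    by (intro tendsto_intros m \<kappa>)
  then have lim0: "(\<lambda>n. 2 * ((m n)\<^sup>2 * (LINT x|lborel. (\<beta> x)\<^sup>2)) + 2 * (LINT x|lborel. (\<kappa> n x - k x)\<^sup>2)) \<longlonglongrightarrow> 0"
    by simp
  have lim: "(\<lambda>n. LINT x|lborel. (\<tau> n x - k x)\<^sup>2) \<longlonglongrightarrow> 0"
  proof (rule tendsto_zero_sandwich[OF _ _ lim0])
    fix n
    have "(LINT x|lborel. (\<tau> n x - \<kappa> n x)\<^sup>2) = (m n)\<^sup>2 * (LINT x|lborel. (\<beta> x)\<^sup>2)"
      unfolding \<tau>_def by (simp add: power_mult_distrib)
    then show "(LINT x|lborel. (\<tau> n x - k x)\<^sup>2) \<le>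
        2 * ((m n)\<^sup>2 * (LINT x|lborel. (\<beta> x)\<^sup>2)) + 2 * (LINT x|lborel. (\<kappa> n x - k x)\<^sup>2)"
      using sq_int_triangle[OF \<tau>s \<kappa>s k(1), of n n] by simp
  qed simp
  have \<phi>: "test_function {a<..<b} (prim (\<tau> n))" for n by (rule test_function_prim[OF \<tau> \<tau>0])
  have d: "deriv (prim (\<tau> n)) = \<tau> n" for n
    using DERIV_imp_deriv[OF prim_test_function_deriv[OF \<tau>]] by blast
  have If: "sq_int a b (\<lambda>x. ?I x * prim k x)"
    using sq_int_prim[OF sq_int_integrable[OF k(1)], of a b 0] by simp
  have h: "H1_deriv {a<..<b} f k" by (rule H1_deriv_prim[OF k(1) assms(3), of _ 0]) (use f in auto)
  have "L2_tendsto {a<..<b} (\<lambda>n. prim (\<tau> n)) f sequentially"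
  proof -
    have "L2_norm_on {a<..<b} (\<lambda>x. prim (\<tau> n) x - f x) =
        sqrt (LINT x|lborel. (?I x * prim (\<tau> n) x - ?I x * prim k x)\<^sup>2)" for n
    proof -
      have "sq_int a b (\<lambda>x. ?I x * prim (\<tau> n) x - ?I x * prim k x)"
        using sq_int_prim[OF sq_int_integrable[OF \<tau>s], of a b 0 n] If by (intro sq_int_diff) simp_all
      then show ?thesis
        using L2_norm_on_sq_int by (subst L2_norm_on_cong[of _ _ "\<lambda>x. ?I x * prim (\<tau> n) x - ?I x * prim k x"])
          (auto simp: f)
    qed
    then show ?thesis
      unfolding L2_tendsto_def
      using tendsto_real_sqrt[OF prim_tendsto_L2[OF \<tau>s k(1) assms(3) lim]] h
      by (simp add: H1_deriv_def sq_int_L2_on[OF sq_int_test_function[OF \<phi>]])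
  qed
  moreover have "L2_tendsto {a<..<b} (\<lambda>n. deriv (prim (\<tau> n))) k sequentially"
    unfolding L2_tendsto_def d
    using tendsto_real_sqrt[OF lim] L2_norm_on_sq_int[OF sq_int_diff[OF \<tau>s k(1)]] h
    by (simp add: H1_deriv_def sq_int_L2_on[OF \<tau>s])
  ultimately show ?thesis unfolding H10_def mem_Collect_eq
    using h \<phi> by (intro exI[of _ k] conjI exI[of _ "\<lambda>n. prim (\<tau> n)"]) auto
qed

text \<open>The converse of \<open>H10_prim\<close>. The approximating test functions are primitives
  of their derivatives, so they converge in L2 both to \<open>f\<close> and to the primitive of the
  limit derivative, and the two limits agree almost everywhere. Their value 0 at b passes to the
  limit and is the mean of \<open>k\<close>.\<close>

theorem H10_representative:
  assumes "f \<in> H10 {a<..<b}" "a < b"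
  obtains k where "sq_int a b k" "(LINT x|lborel. k x) = 0"
    "AE x in lborel. x \<in> {a<..<b} \<longrightarrow> f x = prim k x"
proof -
  let ?I = "indicator {a<..<b} :: real \<Rightarrow> real"
  obtain g \<phi> where \<phi>: "\<And>n::nat. test_function {a<..<b} (\<phi> n)"
    and f: "L2_tendsto {a<..<b} \<phi> f sequentially"
    and g: "L2_tendsto {a<..<b} (\<lambda>n. deriv (\<phi> n)) g sequentially"
    using assms(1) unfolding H10_def by blast
  obtain m where m: "sq_int a b m" "AE x in lborel. x \<in> {a<..<b} \<longrightarrow> f x = m x"
    using f L2_on_representative unfolding L2_tendsto_def by blast
  obtain k where k: "sq_int a b k" "AE x in lborel. x \<in> {a<..<b} \<longrightarrow> g x = k x"
    using g L2_on_representative unfolding L2_tendsto_def by blast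
  note \<phi>s = sq_int_test_function[OF \<phi>] and ds = sq_int_test_function[OF test_function_deriv[OF \<phi>]]
  have sq: "(\<lambda>n. x n) \<longlonglongrightarrow> 0" if "(\<lambda>n. sqrt (x n)) \<longlonglongrightarrow> 0" "\<And>n. 0 \<le> x n" for x :: "nat \<Rightarrow> real"
    using tendsto_power[OF that(1), of 2] that(2) by simp
  have lm: "(\<lambda>n. LINT x|lborel. (\<phi> n x - m x)\<^sup>2) \<longlonglongrightarrow> 0"
    by (rule sq) (use f L2_norm_on_representative[OF _ m \<phi>s] in \<open>auto simp: L2_tendsto_def\<close>)
  have lk: "(\<lambda>n. LINT x|lborel. (deriv (\<phi> n) x - k x)\<^sup>2) \<longlonglongrightarrow> 0"
    by (rule sq) (use g L2_norm_on_representative[OF _ k ds] in \<open>auto simp: L2_tendsto_def\<close>)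
  have "(\<lambda>n. prim (deriv (\<phi> n)) b) \<longlonglongrightarrow> prim k b"
    by (intro prim_tendsto sq_int_integrable[OF ds] sq_int_integrable[OF k(1)]
        sq_int_tendsto_L1[OF ds k(1) assms(2) lk])
  then have "prim k b = 0"
    using LIMSEQ_unique[OF tendsto_const[of 0]]
    by (simp add: prim_deriv_test_function[OF \<phi>] test_function_outside[OF \<phi>])
  then have k0: "(LINT x|lborel. k x) = 0" using prim_right[OF k(1), of b] by simp
  have p: "sq_int a b (\<lambda>x. ?I x * prim k x)"
    using sq_int_prim[OF sq_int_integrable[OF k(1)], of a b 0] by simp
  have eq: "?I x * \<phi> n x = \<phi> n x" for n x
    using test_function_outside[OF \<phi>] by (auto simp: indicator_def)
  have lp: "(\<lambda>n. LINT x|lborel. (\<phi> n x - ?I x * prim k x)\<^sup>2) \<longlonglongrightarrow> 0"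
    using prim_tendsto_L2[OF ds k(1) assms(2) lk] unfolding prim_deriv_test_function[OF \<phi>] eq .
  have mp: "integrable lborel (\<lambda>x. (m x - ?I x * prim k x)\<^sup>2)"
    using sq_int_square[OF sq_int_diff[OF m(1) p]] .
  have "(\<lambda>n. 2 * (LINT x|lborel. (\<phi> n x - m x)\<^sup>2) + 2 * (LINT x|lborel. (\<phi> n x - ?I x * prim k x)\<^sup>2)) \<longlonglongrightarrow> 2 * 0 + 2 * 0"
    by (intro tendsto_intros lm lp)
  moreover have "(LINT x|lborel. (m x - ?I x * prim k x)\<^sup>2) \<le>
      2 * (LINT x|lborel. (\<phi> n x - m x)\<^sup>2) + 2 * (LINT x|lborel. (\<phi> n x - ?I x * prim k x)\<^sup>2)" for n
    using sq_int_triangle[OF m(1) \<phi>s p, of n] by (simp add: power2_commute)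
  ultimately have "(LINT x|lborel. (m x - ?I x * prim k x)\<^sup>2) \<le> 2 * 0 + 2 * 0"
    by (intro LIMSEQ_le_const) auto
  then have "(LINT x|lborel. (m x - ?I x * prim k x)\<^sup>2) = 0"
    by (simp add: antisym)
  then have "AE x in lborel. (m x - ?I x * prim k x)\<^sup>2 = 0"
    using integral_nonneg_eq_0_iff_AE[OF mp] by simp
  then have "AE x in lborel. x \<in> {a<..<b} \<longrightarrow> f x = prim k x"
    using m(2) by eventually_elim auto
  then show ?thesis using that k(1) k0 by blast
qed

section \<open>Translation and reflection\<close>

lemma sq_int_mono:
  assumes "sq_int a b k" "a' \<le> a" "b \<le> b'"
  shows "sq_int a' b' k"
  using assms unfolding sq_int_def by force

lemma integrable_affine:
  assumes "integrable lborel (k :: real \<Rightarrow> real)"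
  shows "integrable lborel (\<lambda>x. k (m + x))" "integrable lborel (\<lambda>x. k (m - x))"
  using lborel_integrable_real_affine[OF assms, of 1 m] lborel_integrable_real_affine[OF assms, of "-1" m]
  by simp_all

lemma integral_affine:
  fixes k :: "real \<Rightarrow> real"
  shows "(LINT x|lborel. k (m + x)) = (LINT x|lborel. k x)" "(LINT x|lborel. k (m - x)) = (LINT x|lborel. k x)"
  using lborel_integral_real_affine[of 1 k m] lborel_integral_real_affine[of "-1" k m] by simp_all

lemma sq_int_shift:
  assumes "sq_int a b k"
  shows "sq_int (a + h) (b + h) (\<lambda>x. k (x - h))"
  using assms integrable_affine(1)[of "\<lambda>x. (k x)\<^sup>2" "- h"] unfolding sq_int_def by auto

lemma sq_int_reflect:
  assumes "sq_int a b k"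
  shows "sq_int (m - b) (m - a) (\<lambda>x. k (m - x))"
  using assms integrable_affine(2)[of "\<lambda>x. (k x)\<^sup>2" m] unfolding sq_int_def by auto

lemma prim_shift: "prim (\<lambda>s. k (s - h)) x = prim k (x - h)"
proof -
  have "prim k (x - h) = (LINT s|lborel. indicator {..x - h} (- h + s) * k (- h + s))"
    unfolding prim_def by (rule integral_affine(1)[symmetric])
  also have "\<dots> = prim (\<lambda>s. k (s - h)) x"
    unfolding prim_def by (intro Bochner_Integration.integral_cong) (auto simp: indicator_def)
  finally show ?thesis by simp
qed

text \<open>Used to write a slice of the wave as a primitive on an open interval: z is x or 2 a - x
  when t varies, and t when x varies. The window omits its right endpoint, which matters for y =
  \<beta> and only on a null set.\<close>

lemma prim_window:
  assumes "integrable lborel f" "\<alpha> \<le> y" "y \<le> \<beta>"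
  shows "prim (\<lambda>s. indicator {\<alpha><..<\<beta>} s * f (z + s)) y = prim f (z + y) - prim f (z + \<alpha>)"
proof -
  have [measurable]: "f \<in> borel_measurable borel" using assms(1) by auto
  have "prim f (z + y) - prim f (z + \<alpha>) = (LINT s|lborel. indicator {..z + y} s * f s - indicator {..z + \<alpha>} s * f s)"
    unfolding prim_def using assms(1) by (simp add: integrable_indicator_mult)
  also have "\<dots> = (LINT s|lborel. indicator {..z + y} (z + s) * f (z + s) - indicator {..z + \<alpha>} (z + s) * f (z + s))"
    by (rule integral_affine(1)[symmetric])
  also have "\<dots> = (LINT s|lborel. indicator {..y} s * (indicator {\<alpha><..<\<beta>} s * f (z + s)))"
  proof (rule integral_cong_AE)
    show "AE s in lborel. indicator {..z + y} (z + s) * f (z + s) - indicator {..z + \<alpha>} (z + s) * f (z + s) =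
        indicator {..y} s * (indicator {\<alpha><..<\<beta>} s * f (z + s))"
      using AE_lborel_singleton[of \<beta>] by eventually_elim (use assms in \<open>auto simp: indicator_def\<close>)
  qed measurable
  finally show ?thesis unfolding prim_def by simp
qed

text \<open>The counterpart for the left-hand family of arguments 2 a - x + t, which decrease in x;
  here the two indicators may differ at both ends of the interval from \<alpha> to y.\<close>

lemma prim_window_reflect:
  assumes "integrable lborel f" "\<alpha> \<le> y" "y \<le> \<beta>"
  shows "prim (\<lambda>s. indicator {\<alpha><..<\<beta>} s * f (z - s)) y = prim f (z - \<alpha>) - prim f (z - y)"
proof -
  have [measurable]: "f \<in> borel_measurable borel" using assms(1) by auto
  have "prim f (z - \<alpha>) - prim f (z - y) = (LINT s|lborel. indicator {..z - \<alpha>} s * f s - indicator {..z - y} s * f s)"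
    unfolding prim_def using assms(1) by (simp add: integrable_indicator_mult)
  also have "\<dots> = (LINT s|lborel. indicator {..z - \<alpha>} (z - s) * f (z - s) - indicator {..z - y} (z - s) * f (z - s))"
    by (rule integral_affine(2)[symmetric])
  also have "\<dots> = (LINT s|lborel. indicator {..y} s * (indicator {\<alpha><..<\<beta>} s * f (z - s)))"
  proof (rule integral_cong_AE)
    show "AE s in lborel. indicator {..z - \<alpha>} (z - s) * f (z - s) - indicator {..z - y} (z - s) * f (z - s) =
        indicator {..y} s * (indicator {\<alpha><..<\<beta>} s * f (z - s))"
      using AE_lborel_singleton[of \<beta>] AE_lborel_singleton[of y] AE_lborel_singleton[of \<alpha>]
      by eventually_elim (use assms in \<open>auto simp: indicator_def\<close>)
  qed measurable
  finally show ?thesis unfolding prim_def by simp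
qed

lemma prim_reflect:
  assumes "integrable lborel k"
  shows "prim (\<lambda>s. k (m - s)) x = (LINT s|lborel. k s) - prim k (m - x)"
proof -
  have [measurable]: "k \<in> borel_measurable borel" using assms by auto
  have "(LINT s|lborel. k s) - prim k (m - x) = (LINT s|lborel. k s - indicator {..m - x} s * k s)"
    unfolding prim_def using assms by (simp add: integrable_indicator_mult)
  also have "\<dots> = (LINT s|lborel. k (m - s) - indicator {..m - x} (m - s) * k (m - s))"
    by (rule integral_affine(2)[symmetric])
  also have "\<dots> = (LINT s|lborel. indicator {..x} s * k (m - s))"
  proof (rule integral_cong_AE)
    show "AE s in lborel. k (m - s) - indicator {..m - x} (m - s) * k (m - s) = indicator {..x} s * k (m - s)"
      using AE_lborel_singleton[of x] by eventually_elim (auto simp: indicator_def)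
  qed measurable
  finally show ?thesis unfolding prim_def by simp
qed

lemma sq_int_sum:
  assumes "finite I" "\<And>i. i \<in> I \<Longrightarrow> sq_int a b (f i)"
  shows "sq_int a b (\<lambda>x. \<Sum>i\<in>I. f i x)"
  using assms
proof (induction I)
  case empty
  then show ?case by (simp add: sq_int_def)
next
  case (insert i I)
  then show ?case using sq_int_lincomb[of a b "f i" "\<lambda>x. \<Sum>i\<in>I. f i x" 1 1] by simp
qed

lemma prim_sum:
  assumes "\<And>i. i \<in> I \<Longrightarrow> integrable lborel (f i)"
  shows "prim (\<lambda>x. \<Sum>i\<in>I. f i x) x = (\<Sum>i\<in>I. prim (f i) x)"
  unfolding prim_def sum_distrib_left
  using assms by (intro Bochner_Integration.integral_sum integrable_indicator_mult) auto

section \<open>The d'Alembert solution\<close>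

text \<open>
  With \<open>F = prim f\<close> the wave is \<open>w(x,t) = F (x + t) - F (2 a - x + t)\<close>, which vanishes at \<open>x = a\<close>,
  and also at \<open>x = b\<close> as \<open>F\<close> has period \<open>2 (b - a)\<close> up to time \<open>T\<close>. On one period \<open>f\<close> is
  \<open>(g + v) / 2\<close> to the right of \<open>a\<close> and the reflection of \<open>(g - v) / 2\<close> to the left of it, where
  \<open>g = u\<^sub>0'\<close> and \<open>v = v\<^sub>0\<close>; finitely many translates suffice.
\<close>

lemma dalembert_profile:
  assumes "a < b" "T > 0" "sq_int a b g" "sq_int a b v" "(LINT x|lborel. g x) = 0"
  obtains f B where "sq_int (2 * a - b) B f"
    "\<And>x. x \<in> {a<..<b} \<Longrightarrow> f x - f (2 * a - x) = v x"
    "\<And>x. x \<in> {a..b} \<Longrightarrow> prim f x - prim f (2 * a - x) = prim g x"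
    "\<And>t. 0 \<le> t \<Longrightarrow> t \<le> T \<Longrightarrow> prim f (b + t) = prim f (2 * a - b + t)"
proof -
  define L where "L = b - a"
  \<comment> \<open>The mirror image of b in a; one period is the interval from c to b, with a at
    its centre.\<close>
  define c where "c = 2 * a - b"
  have L: "L > 0" "b = c + 2 * L" "a = c + L" using assms by (auto simp: L_def c_def)
  define p where "p x = 1/2 * g x + 1/2 * v x" for x
  define q where "q x = 1/2 * g x + (-1/2) * v x" for x
  have pq: "sq_int a b p" "sq_int a b q"
    unfolding p_def q_def by (intro sq_int_lincomb assms)+
  define f\<^sub>0 where "f\<^sub>0 x = 1 * p x + 1 * q (2 * a - x)" for x
  have qr: "sq_int c a (\<lambda>x. q (2 * a - x))"
    using sq_int_reflect[OF pq(2), of "2 * a"] by (simp add: c_def)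
  have f\<^sub>0: "sq_int c b f\<^sub>0"
    unfolding f\<^sub>0_def using assms(1)
    by (intro sq_int_lincomb sq_int_mono[OF pq(1)] sq_int_mono[OF qr]) (auto simp: c_def)
  note gi = sq_int_integrable[OF assms(3)] and vi = sq_int_integrable[OF assms(4)]
  define V where "V = (LINT x|lborel. v x)"
  have prim_p: "prim p x = 1/2 * prim g x + 1/2 * prim v x" for x
    unfolding p_def by (rule prim_lincomb[OF gi vi])
  have prim_q: "prim q x = 1/2 * prim g x + (-1/2) * prim v x" for x
    unfolding q_def by (rule prim_lincomb[OF gi vi])
  \<comment> \<open>As \<open>g\<close> has mean zero, p and q have the opposite integrals V/2 and
    -V/2, so that \<open>f\<^sub>0\<close> has mean zero over its period.\<close>
  have int_q: "(LINT x|lborel. q x) = - 1/2 * V"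
    unfolding q_def using gi vi assms(5) by (simp add: V_def)
  have prim_f\<^sub>0: "prim f\<^sub>0 x = prim p x - 1/2 * V - prim q (2 * a - x)" for x
    unfolding f\<^sub>0_def
    using prim_lincomb[OF sq_int_integrable[OF pq(1)] sq_int_integrable[OF qr], of 1 1 x]
      prim_reflect[OF sq_int_integrable[OF pq(2)], of "2 * a" x] int_q by simp
  \<comment> \<open>Since 2 L M is at least T, the translate with number M has not set in at c + t
    for t \<le> T. Of the \<open>Suc M\<close> translates, numbered from 0, this leaves those below
    M at c + t.\<close>
  obtain M :: nat where M: "T / (2 * L) \<le> real M" using real_arch_simple by blast
  then have M: "T \<le> 2 * L * real M" using L by (simp add: field_simps)
  define f where "f x = (\<Sum>k<Suc M. f\<^sub>0 (x - 2 * L * real k))" for x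
  have fk: "sq_int c (b + 2 * L * real M) (\<lambda>x. f\<^sub>0 (x - 2 * L * real k))" if "k < Suc M" for k
    by (rule sq_int_mono[OF sq_int_shift[OF f\<^sub>0, of "2 * L * real k"]])
      (use that L in \<open>auto intro!: mult_left_mono\<close>)
  have f: "sq_int c (b + 2 * L * real M) f"
    unfolding f_def using fk by (intro sq_int_sum) auto
  have prim_f: "prim f x = (\<Sum>k<Suc M. prim f\<^sub>0 (x - 2 * L * real k))" for x
    unfolding f_def using sq_int_integrable[OF fk] by (subst prim_sum) (auto simp: prim_shift)
  \<comment> \<open>Every translate but the first lives to the right of b, so up to b the profile
    and its primitive are those of \<open>f\<^sub>0\<close>.\<close>
  have far: "x - 2 * L * real (Suc k) \<le> c" if "x \<le> b" for x k
  proof -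
    have "0 \<le> 2 * L * real k" using L by simp
    moreover have "2 * L * real (Suc k) = 2 * L + 2 * L * real k" by (simp add: algebra_simps)
    ultimately show ?thesis using that L(2) by linarith
  qed
  have f_first: "f x = f\<^sub>0 x" if "x \<le> b" for x
  proof -
    have "f\<^sub>0 (x - 2 * L * real (Suc k)) = 0" for k
      using sq_int_outside[OF f\<^sub>0] far[OF that, of k] by (auto simp del: of_nat_Suc)
    then show ?thesis unfolding f_def sum.lessThan_Suc_shift by simp
  qed
  have F_first: "prim f x = prim f\<^sub>0 x" if "x \<le> b" for x
  proof -
    have "prim f\<^sub>0 (x - 2 * L * real (Suc k)) = 0" for k
      using prim_left[OF f\<^sub>0 far[OF that, of k]] .
    then show ?thesis unfolding prim_f sum.lessThan_Suc_shift by simp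
  qed
  show ?thesis
  proof (rule that[of "b + 2 * L * real M" f])
    show "sq_int (2 * a - b) (b + 2 * L * real M) f" using f by (simp add: c_def)
    show "f x - f (2 * a - x) = v x" if "x \<in> {a<..<b}" for x
      using that sq_int_outside[OF pq(1), of "2 * a - x"] sq_int_outside[OF pq(2), of "2 * a - x"]
      by (simp add: f_first f\<^sub>0_def) (simp add: p_def q_def)
    show "prim f x - prim f (2 * a - x) = prim g x" if "x \<in> {a..b}" for x
      using that prim_left[OF pq(1), of "2 * a - x"] prim_left[OF pq(2), of "2 * a - x"]
      by (simp add: F_first prim_f\<^sub>0) (simp add: prim_p prim_q)
    \<comment> \<open>Passing from c + t to b + t = c + t + 2 L shifts the numbering of the
      translates by one. The translate number 0 at b + t has run through its full period and
      contributes its mean, which is 0; the translate number M at c + t has not begun.\<close>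
    show "prim f (b + t) = prim f (2 * a - b + t)" if t: "0 \<le> t" "t \<le> T" for t
    proof -
      have "prim f\<^sub>0 (c + t - 2 * L * real M) = 0"
        using M t by (intro prim_left[OF f\<^sub>0]) auto
      then have "prim f (c + t) = (\<Sum>k<M. prim f\<^sub>0 (c + t - 2 * L * real k))"
        unfolding prim_f by simp
      moreover have "prim f\<^sub>0 (b + t) = 0"
        using t assms(1) prim_right[OF pq(1), of "b + t"] prim_left[OF pq(2), of "2 * a - (b + t)"]
          prim_right[OF assms(3), of "b + t"] prim_right[OF assms(4), of "b + t"] assms(5)
        by (simp add: prim_f\<^sub>0 prim_p V_def)
      moreover have "prim f (b + t) = prim f\<^sub>0 (b + t) + (\<Sum>k<M. prim f\<^sub>0 (b + t - 2 * L * real (Suc k)))"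
        unfolding prim_f sum.lessThan_Suc_shift by simp
      moreover have eq: "b + t - 2 * L * real (Suc k) = c + t - 2 * L * real k" for k
        using L by (simp add: algebra_simps)
      ultimately show ?thesis unfolding eq by (simp add: c_def)
    qed
  qed
qed

section \<open>Test functions in space-time\<close>

text \<open>The positivity set is the trace on t \<ge> 0 of an open set, because \<open>u\<close> is
  continuous. Near its support \<open>\<phi>\<close> is therefore differentiable relative to the
  closed half-space, and off the compact support it is locally zero. So the extension by zero is
  differentiable on all of t \<ge> 0, and bounded Borel partial derivatives can be integrated
  without regard to the shape of the positivity set.\<close>

lemma test_function_spacetime:
  fixes \<Omega> :: "real set" and u :: "real \<times> real \<Rightarrow> real"
  assumes "open \<Omega>" "continuous_on (\<Omega> \<times> {0..<T}) u" "test_function (positivity_set \<Omega> T u) \<phi>"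
  obtains K P Q C where "K \<subseteq> positivity_set \<Omega> T u" "\<And>p. p \<notin> K \<Longrightarrow> P p = 0 \<and> Q p = 0 \<and> \<phi> p = 0"
    "P \<in> borel_measurable borel" "Q \<in> borel_measurable borel" "\<And>p. \<bar>P p\<bar> \<le> C \<and> \<bar>Q p\<bar> \<le> C"
    "\<And>x t. 0 \<le> t \<Longrightarrow>
      (\<phi> has_derivative (\<lambda>h. P (x, t) * fst h + Q (x, t) * snd h)) (at (x, t) within UNIV \<times> {0..})"
proof -
  define U where "U = positivity_set \<Omega> T u"
  define K where "K = closure {p. \<phi> p \<noteq> 0}"
  have K: "compact K" "K \<subseteq> U" and \<phi>0: "\<And>p. p \<notin> K \<Longrightarrow> \<phi> p = 0"
    using assms(3) closure_subset[of "{p. \<phi> p \<noteq> 0}"] unfolding test_function_def K_def U_def by auto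
  have "openin (top_of_set (\<Omega> \<times> {0..<T})) (\<Omega> \<times> {0..<T} \<inter> u -` {0<..})"
    using assms(2) by (intro continuous_openin_preimage_gen) auto
  then obtain V where V: "open V" "\<Omega> \<times> {0..<T} \<inter> u -` {0<..} = (\<Omega> \<times> {0..<T}) \<inter> V"
    by (auto simp: openin_open)
  define W where "W = V \<inter> (\<Omega> \<times> {..<T})"
  have W: "open W" unfolding W_def using V(1) assms(1) by (intro open_Int open_Times) auto
  have "U = \<Omega> \<times> {0..<T} \<inter> u -` {0<..}" unfolding U_def positivity_set_def by auto
  then have UW: "U = W \<inter> (UNIV \<times> {0..})" unfolding V(2) W_def by auto
  have "Ck_on (Suc 0) U \<phi>" using assms(3) unfolding test_function_def smooth_on_def U_def by blast
  then obtain D where D: "\<And>p. p \<in> U \<Longrightarrow> (\<phi> has_derivative (\<lambda>h. D p \<bullet> h)) (at p within U)"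
    "\<And>b. b \<in> Basis \<Longrightarrow> continuous_on U (\<lambda>p. D p \<bullet> b)"
    unfolding Ck_on.simps by blast
  have "continuous_on U (\<lambda>p. D p \<bullet> (1, 0))" "continuous_on U (\<lambda>p. D p \<bullet> (0, 1))"
    using D(2)[of "(1, 0)"] D(2)[of "(0, 1)"] by (simp_all add: Basis_prod_def)
  then have c: "continuous_on K (\<lambda>p. fst (D p))" "continuous_on K (\<lambda>p. snd (D p))"
    using K(2) by (auto simp: inner_prod_def elim: continuous_on_subset)
  define P where "P p = indicator K p *\<^sub>R fst (D p)" for p
  define Q where "Q p = indicator K p *\<^sub>R snd (D p)" for p
  have Kb: "K \<in> sets borel" using K(1) by (simp add: compact_imp_closed)
  have PQ: "P \<in> borel_measurable borel" "Q \<in> borel_measurable borel"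
    unfolding P_def[abs_def] Q_def[abs_def]
    by (intro borel_measurable_continuous_on_indicator Kb c)+
  obtain C\<^sub>1 where C1: "\<And>p. p \<in> K \<Longrightarrow> \<bar>fst (D p)\<bar> \<le> C\<^sub>1"
    using compact_imp_bounded[OF compact_continuous_image[OF c(1) K(1)]] unfolding bounded_iff by auto
  obtain C\<^sub>2 where C2: "\<And>p. p \<in> K \<Longrightarrow> \<bar>snd (D p)\<bar> \<le> C\<^sub>2"
    using compact_imp_bounded[OF compact_continuous_image[OF c(2) K(1)]] unfolding bounded_iff by auto
  have C: "\<bar>P p\<bar> \<le> \<bar>C\<^sub>1\<bar> + \<bar>C\<^sub>2\<bar> \<and> \<bar>Q p\<bar> \<le> \<bar>C\<^sub>1\<bar> + \<bar>C\<^sub>2\<bar>" for p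
    using C1[of p] C2[of p] by (cases "p \<in> K") (auto simp: P_def Q_def)
  have der: "(\<phi> has_derivative (\<lambda>h. P (x, t) * fst h + Q (x, t) * snd h)) (at (x, t) within UNIV \<times> {0..})"
    if t: "0 \<le> t" for x t
  proof (cases "(x, t) \<in> K")
    case True
    then have "(x, t) \<in> U" using K by auto
    \<comment> \<open>Inside the open set \<open>W\<close> the sets \<open>U\<close> and t \<ge> 0
      coincide, so derivatives relative to them are the same.\<close>
    then have "at (x, t) within U = at (x, t) within UNIV \<times> {0..}"
      using UW by (intro at_within_nhd[OF _ W]) auto
    moreover have "(\<lambda>h. D (x, t) \<bullet> h) = (\<lambda>h. P (x, t) * fst h + Q (x, t) * snd h)"
      using True by (auto simp: P_def Q_def inner_prod_def)
    ultimately show ?thesis using D(1)[OF \<open>(x, t) \<in> U\<close>] by simp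
  next
    case False
    have "((\<lambda>p. 0) has_derivative (\<lambda>h. 0)) (at (x, t))" by simp
    then have "(\<phi> has_derivative (\<lambda>h. 0)) (at (x, t))"
      by (rule has_derivative_transform_within_open[of _ _ _ _ "- K"])
        (use False K(1) \<phi>0 in \<open>auto simp: compact_imp_closed\<close>)
    then show ?thesis using False by (simp add: P_def Q_def has_derivative_at_withinI)
  qed
  show ?thesis
    by (rule that[of K P Q "\<bar>C\<^sub>1\<bar> + \<bar>C\<^sub>2\<bar>", OF _ _ PQ C der])
      (use K(2) \<phi>0 in \<open>auto simp: U_def P_def Q_def\<close>)
qed

lemma deriv_spacetime:
  fixes \<phi> :: "real \<times> real \<Rightarrow> real"
  assumes "(\<phi> has_derivative (\<lambda>h. p * fst h + q * snd h)) (at (x, t) within UNIV \<times> {0..})" "0 < t"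
  shows "deriv (\<lambda>t. \<phi> (x, t)) t = q" "deriv (\<lambda>x. \<phi> (x, t)) x = p"
proof -
  have "at (x, t) within UNIV \<times> {0..} = at (x, t)"
    using assms(2) by (intro at_within_interior) (auto simp: interior_Times)
  then have d: "(\<phi> has_derivative (\<lambda>h. p * fst h + q * snd h)) (at (x, t))" using assms(1) by simp
  have "((\<lambda>s. (x, s)) has_derivative (\<lambda>h. (0, h))) (at t)"
    by (auto intro!: derivative_eq_intros)
  from has_derivative_compose[OF this, of \<phi>, OF d]
  show "deriv (\<lambda>t. \<phi> (x, t)) t = q"
    by (intro DERIV_imp_deriv) (simp add: has_field_derivative_def)
  have "((\<lambda>s. (s, t)) has_derivative (\<lambda>h. (h, 0))) (at x)"
    by (auto intro!: derivative_eq_intros)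
  from has_derivative_compose[OF this, of \<phi>, OF d]
  show "deriv (\<lambda>x. \<phi> (x, t)) x = p"
    by (intro DERIV_imp_deriv) (simp add: has_field_derivative_def)
qed

section \<open>Integration along characteristics\<close>

text \<open>Tonelli: a bound on the spatial L1 norm that is uniform in t is integrable over a
  bounded time interval. No decay in x has to be known.\<close>

lemma integrable_strip:
  fixes h :: "real \<Rightarrow> real \<Rightarrow> real"
  assumes [measurable]: "(\<lambda>(x, t). h x t) \<in> borel_measurable (borel \<Otimes>\<^sub>M borel)"
    and i: "\<And>t. integrable lborel (\<lambda>x. h x t)"
    and A: "\<And>t. (LINT x|lborel. \<bar>h x t\<bar>) \<le> A"
  shows "integrable (lborel \<Otimes>\<^sub>M lborel) (\<lambda>(x, t). indicator {0<..<T} t * h x t)"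
proof -
  have [measurable]: "(\<lambda>(t, x). h x t) \<in> borel_measurable (borel \<Otimes>\<^sub>M borel)"
    using measurable_compose[OF measurable_pair_swap' assms(1)] by (simp add: split_beta')
  \<comment> \<open>The coordinates are exchanged so that the inner integral of the Fubini criterion
    is the one in x, for which the bound \<open>A\<close> is available.\<close>
  have "integrable (lborel \<Otimes>\<^sub>M lborel) (\<lambda>(t, x). indicator {0<..<T} t * h x t)"
  proof (rule lborel_pair.Fubini_integrable)
    show "(\<lambda>(t, x). indicator {0<..<T} t * h x t) \<in> borel_measurable (lborel \<Otimes>\<^sub>M lborel)" by measurable
    show "integrable lborel (\<lambda>t. LINT x|lborel. norm (case (t, x) of (t, x) \<Rightarrow> indicator {0<..<T} t * h x t))"
    proof (rule Bochner_Integration.integrable_bound)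
      show "integrable lborel (\<lambda>t. A * indicator {0<..<T} t)"
        by (intro integrable_mult_right integrable_indicator_interval)
      have "\<bar>LINT x|lborel. \<bar>h x t\<bar>\<bar> = (LINT x|lborel. \<bar>h x t\<bar>)" for t
        by (rule abs_of_nonneg) simp
      then have "\<bar>LINT x|lborel. \<bar>h x t\<bar>\<bar> \<le> \<bar>A\<bar>" for t
        using order_trans[OF A abs_ge_self] by metis
      then show "AE t in lborel. norm (LINT x|lborel. norm (case (t, x) of (t, x) \<Rightarrow> indicator {0<..<T} t * h x t))
          \<le> norm (A * indicator {0<..<T} t)"
        by (simp add: abs_mult indicator_def)
    qed measurable
    show "AE t in lborel. integrable lborel (\<lambda>x. case (t, x) of (t, x) \<Rightarrow> indicator {0<..<T} t * h x t)"
      using i by simp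
  qed
  from lborel_pair.integrable_product_swap[OF this] show ?thesis by (simp add: split_beta')
qed

lemma integrable_wave:
  assumes "integrable lborel (f :: real \<Rightarrow> real)" "\<sigma> = 1 \<or> \<sigma> = -1"
  shows "integrable (lborel \<Otimes>\<^sub>M lborel) (\<lambda>(x, t). indicator {0<..<T} t * f (q + \<sigma> * x + t))"
proof (rule integrable_strip)
  have [measurable]: "f \<in> borel_measurable borel" using assms by auto
  show "(\<lambda>(x, t). f (q + \<sigma> * x + t)) \<in> borel_measurable (borel \<Otimes>\<^sub>M borel)" by measurable
  fix t
  consider "(\<lambda>x. f (q + \<sigma> * x + t)) = (\<lambda>x. f ((q + t) + x))"
    | "(\<lambda>x. f (q + \<sigma> * x + t)) = (\<lambda>x. f ((q + t) - x))"
    using assms(2) by (force simp: algebra_simps)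
  then show "integrable lborel (\<lambda>x. f (q + \<sigma> * x + t))"
  proof cases
    case 1
    show ?thesis unfolding 1 by (rule integrable_affine(1)[OF assms(1)])
  next
    case 2
    show ?thesis unfolding 2 by (rule integrable_affine(2)[OF assms(1)])
  qed
  have "(LINT x|lborel. \<bar>f (q + \<sigma> * x + t)\<bar>) = (LINT x|lborel. \<bar>f x\<bar>)"
    using assms(2) integral_affine[of "\<lambda>x. \<bar>f x\<bar>" "q + t"] by (auto simp: algebra_simps)
  then show "(LINT x|lborel. \<bar>f (q + \<sigma> * x + t)\<bar>) \<le> (LINT x|lborel. \<bar>f x\<bar>)" by simp
qed

text \<open>Along \<open>x = \<sigma> (s - q - t)\<close> the factor \<open>f\<close> is constant and \<open>Q - \<sigma> P\<close> is the derivative of \<open>\<phi>\<close>.\<close>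

lemma characteristic_integral:
  fixes \<phi> P Q :: "real \<times> real \<Rightarrow> real"
  assumes "T > 0"
    and [measurable]: "P \<in> borel_measurable borel" "Q \<in> borel_measurable borel"
    and C: "\<And>p. \<bar>P p\<bar> \<le> C \<and> \<bar>Q p\<bar> \<le> C"
    and der: "\<And>x t. 0 \<le> t \<Longrightarrow>
      (\<phi> has_derivative (\<lambda>h. P (x, t) * fst h + Q (x, t) * snd h)) (at (x, t) within UNIV \<times> {0..})"
    and final: "\<And>x. \<phi> (x, T) = 0"
  shows "(LINT t|lborel. indicator {0<..<T} t * (Q (\<sigma> * (s - q - t), t) - \<sigma> * P (\<sigma> * (s - q - t), t))) = - \<phi> (\<sigma> * (s - q), 0)"
proof -
  define h where "h t = Q (\<sigma> * (s - q - t), t) - \<sigma> * P (\<sigma> * (s - q - t), t)" for t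
  have [measurable]: "h \<in> borel_measurable borel" unfolding h_def[abs_def] by measurable
  have "(h has_integral \<phi> (\<sigma> * (s - q - T), T) - \<phi> (\<sigma> * (s - q - 0), 0)) {0..T}"
  proof (rule fundamental_theorem_of_calculus)
    fix t assume t: "t \<in> {0..T}"
    have 1: "((\<lambda>t. (\<sigma> * (s - q - t), t)) has_derivative (\<lambda>h. (- \<sigma> * h, h))) (at t within {0..T})"
      by (auto intro!: derivative_eq_intros)
    \<comment> \<open>The characteristic stays in t \<ge> 0, so the derivative relative to the
      half-space restricts to it; at t = 0 only a one-sided derivative is involved.\<close>
    have 2: "(\<phi> has_derivative (\<lambda>h. P (\<sigma> * (s - q - t), t) * fst h + Q (\<sigma> * (s - q - t), t) * snd h))
        (at (\<sigma> * (s - q - t), t) within (\<lambda>t. (\<sigma> * (s - q - t), t)) ` {0..T})"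
      by (rule has_derivative_subset[OF der]) (use t in auto)
    have "((\<lambda>t. \<phi> (\<sigma> * (s - q - t), t)) has_derivative (\<lambda>k. P (\<sigma> * (s - q - t), t) * (- \<sigma> * k) + Q (\<sigma> * (s - q - t), t) * k)) (at t within {0..T})"
      using has_derivative_in_compose[OF 1 2] by simp
    moreover have "(\<lambda>k. P (\<sigma> * (s - q - t), t) * (- \<sigma> * k) + Q (\<sigma> * (s - q - t), t) * k) = (\<lambda>k. k *\<^sub>R h t)"
      by (auto simp: h_def algebra_simps)
    ultimately show "((\<lambda>t. \<phi> (\<sigma> * (s - q - t), t)) has_vector_derivative h t) (at t within {0..T})"
      by (simp add: has_vector_derivative_def)
  qed (use assms in auto)
  then have "(h has_integral - \<phi> (\<sigma> * (s - q), 0)) {0<..<T}"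
    by (simp add: final has_integral_Icc_iff_Ioo)
  moreover have "set_integrable lborel {0<..<T} h"
  proof -
    have "integrable lborel (\<lambda>t. indicator {0<..<T} t * h t)"
    proof (rule Bochner_Integration.integrable_bound)
      show "integrable lborel (\<lambda>t. (C + \<bar>\<sigma>\<bar> * C) * indicator {0<..<T} t)"
        by (intro integrable_mult_right integrable_indicator_interval)
      have "\<bar>h t\<bar> \<le> \<bar>C + \<bar>\<sigma>\<bar> * C\<bar>" for t
      proof -
        have "\<bar>h t\<bar> \<le> \<bar>Q (\<sigma> * (s - q - t), t)\<bar> + \<bar>\<sigma>\<bar> * \<bar>P (\<sigma> * (s - q - t), t)\<bar>"
          unfolding h_def abs_mult[symmetric] by (rule abs_triangle_ineq4)
        also have "\<dots> \<le> C + \<bar>\<sigma>\<bar> * C" using C by (intro add_mono mult_left_mono) auto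
        finally show ?thesis by simp
      qed
      then show "AE t in lborel. norm (indicator {0<..<T} t * h t) \<le> norm ((C + \<bar>\<sigma>\<bar> * C) * indicator {0<..<T} t)"
        by (intro AE_I2) (auto simp: indicator_def)
    qed measurable
    then show ?thesis by (simp add: set_integrable_def)
  qed
  ultimately have "(LINT t:{0<..<T}|lborel. h t) = - \<phi> (\<sigma> * (s - q), 0)"
    using set_borel_integral_eq_integral(2) integral_unique by metis
  then show ?thesis by (simp add: set_lebesgue_integral_def h_def)
qed

text \<open>For fixed t the substitution s = q + \<sigma> x + t has Jacobian of modulus 1 and turns
  the profile into \<open>f s\<close>. After the integrals are exchanged, \<open>f s\<close> is
  constant in the inner one, which \<open>characteristic_integral\<close> evaluates to a value at t
  = 0; hence no derivative of \<open>f\<close> ever appears. The two families of characteristics are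
  the cases \<sigma> = 1 and \<sigma> = -1.\<close>

lemma wave_weak_form:
  fixes q :: real and \<phi> P Q :: "real \<times> real \<Rightarrow> real"
  assumes "T > 0" "integrable lborel f" and \<sigma>: "\<sigma> = 1 \<or> \<sigma> = -1"
    and [measurable]: "P \<in> borel_measurable borel" "Q \<in> borel_measurable borel"
    and C: "\<And>p. \<bar>P p\<bar> \<le> C \<and> \<bar>Q p\<bar> \<le> C"
    and der: "\<And>x t. 0 \<le> t \<Longrightarrow>
      (\<phi> has_derivative (\<lambda>h. P (x, t) * fst h + Q (x, t) * snd h)) (at (x, t) within UNIV \<times> {0..})"
    and final: "\<And>x. \<phi> (x, T) = 0"
  defines "G \<equiv> \<lambda>(x, t). indicator {0<..<T} t * f (q + \<sigma> * x + t) * (Q (x, t) - \<sigma> * P (x, t))"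
  shows "integrable lborel G" "(LINT p|lborel. G p) = - (LINT x|lborel. f (q + \<sigma> * x) * \<phi> (x, 0))"
    "integrable lborel (\<lambda>x. f (q + \<sigma> * x) * \<phi> (x, 0))"
proof -
  have [measurable]: "f \<in> borel_measurable borel" using assms(2) by auto
  have [measurable]: "(\<lambda>(x, t). P (x, t)) \<in> borel_measurable (borel \<Otimes>\<^sub>M borel)"
    "(\<lambda>(x, t). Q (x, t)) \<in> borel_measurable (borel \<Otimes>\<^sub>M borel)"
    by (simp_all add: borel_prod)
  define R where "R x t = Q (x, t) - \<sigma> * P (x, t)" for x t
  have Rm [measurable]: "(\<lambda>(x, t). R x t) \<in> borel_measurable (borel \<Otimes>\<^sub>M borel)"
    unfolding R_def by measurable
  have R: "\<bar>R x t\<bar> \<le> 2 * C" for x t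
  proof -
    have "\<bar>R x t\<bar> \<le> \<bar>Q (x, t)\<bar> + \<bar>P (x, t)\<bar>" using \<sigma> unfolding R_def by auto
    then show ?thesis using C[of "(x, t)"] by linarith
  qed
  have G: "G = (\<lambda>(x, t). indicator {0<..<T} t * (f (q + \<sigma> * x + t) * R x t))"
    by (auto simp: G_def R_def)
  \<comment> \<open>One majorant serves both \<open>G\<close> and its transform \<open>H\<close>:
    the factor made of P and Q is at most 2 C, and the remaining factor is integrable on the
    strip.\<close>
  have bound: "integrable (lborel \<Otimes>\<^sub>M lborel) (\<lambda>(x, t). indicator {0<..<T} t * (F x t * S x t))"
    if "integrable (lborel \<Otimes>\<^sub>M lborel) (\<lambda>(x, t). indicator {0<..<T} t * F x t)"
      and [measurable]: "(\<lambda>(x, t). F x t) \<in> borel_measurable (borel \<Otimes>\<^sub>M borel)"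
        "(\<lambda>(x, t). S x t) \<in> borel_measurable (borel \<Otimes>\<^sub>M borel)"
      and S: "\<And>x t. \<bar>S x t\<bar> \<le> 2 * C" for F S :: "real \<Rightarrow> real \<Rightarrow> real"
  proof (rule Bochner_Integration.integrable_bound)
    show "integrable (lborel \<Otimes>\<^sub>M lborel) (\<lambda>p. 2 * C * (case p of (x, t) \<Rightarrow> indicator {0<..<T} t * F x t))"
      using that(1) by (rule integrable_mult_right)
    have "\<bar>F x t\<bar> * \<bar>S x t\<bar> \<le> \<bar>2 * C\<bar> * \<bar>F x t\<bar>" for x t
      using mult_left_mono[OF order_trans[OF S abs_ge_self], of "\<bar>F x t\<bar>" x t] by (simp add: mult.commute)
    then show "AE p in lborel \<Otimes>\<^sub>M lborel. norm (case p of (x, t) \<Rightarrow> indicator {0<..<T} t * (F x t * S x t))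
        \<le> norm (2 * C * (case p of (x, t) \<Rightarrow> indicator {0<..<T} t * F x t))"
      by (intro AE_I2) (auto simp: abs_mult indicator_def)
  qed measurable
  have iG: "integrable (lborel \<Otimes>\<^sub>M lborel) G"
    unfolding G using integrable_wave[OF assms(2) \<sigma>] by (intro bound R) measurable
  then show "integrable lborel G" by (simp add: lborel_prod)
  \<comment> \<open>The integrand in characteristic coordinates; the inverse substitution is x =
    \<sigma> (s - q - t) because \<sigma>^2 = 1.\<close>
  define H where "H s t = indicator {0<..<T} t * (f s * R (\<sigma> * (s - q - t)) t)" for s t
  have iH: "integrable (lborel \<Otimes>\<^sub>M lborel) (\<lambda>(s, t). H s t)"
    unfolding H_def
  proof (rule bound)
    show "integrable (lborel \<Otimes>\<^sub>M lborel) (\<lambda>(s, t). indicator {0<..<T} t * f s)"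
      using assms(2) by (intro integrable_strip[where A = "LINT s|lborel. \<bar>f s\<bar>"]) auto
  qed (use R in measurable)
  have inner: "(LINT x|lborel. G (x, t)) = (LINT s|lborel. H s t)" for t
  proof -
    define k where "k x = f (q + \<sigma> * x + t) * R x t" for x
    have "(LINT x|lborel. k x) = (LINT s|lborel. k (\<sigma> * (s - q - t)))"
      using \<sigma>
    proof
      assume "\<sigma> = 1"
      then show ?thesis using integral_affine(1)[of k "- q - t"] by (simp add: algebra_simps)
    next
      assume "\<sigma> = -1"
      then show ?thesis using integral_affine(2)[of k "q + t"] by (simp add: algebra_simps)
    qed
    also have "(\<lambda>s. k (\<sigma> * (s - q - t))) = (\<lambda>s. f s * R (\<sigma> * (s - q - t)) t)"
      using \<sigma> by (auto simp: k_def)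
    finally show ?thesis by (simp add: G H_def k_def)
  qed
  have outer: "(LINT t|lborel. H s t) = f s * - \<phi> (\<sigma> * (s - q), 0)" for s
  proof -
    have eq: "H s = (\<lambda>t. f s * (indicator {0<..<T} t * (Q (\<sigma> * (s - q - t), t) - \<sigma> * P (\<sigma> * (s - q - t), t))))"
      by (rule ext) (simp add: H_def R_def)
    have "(LINT t|lborel. H s t) =
        f s * (LINT t|lborel. indicator {0<..<T} t * (Q (\<sigma> * (s - q - t), t) - \<sigma> * P (\<sigma> * (s - q - t), t)))"
      unfolding eq by (rule integral_mult_right_zero)
    then show ?thesis using characteristic_integral[OF assms(1,4,5) C der final] by simp
  qed
  have "integrable lborel (\<lambda>s. f s * - \<phi> (\<sigma> * (s - q), 0))"
    using lborel_pair.integrable_fst'[OF iH] by (simp add: outer)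
  then have i: "integrable lborel (\<lambda>s. f s * \<phi> (\<sigma> * (s - q), 0))" by simp
  show "integrable lborel (\<lambda>x. f (q + \<sigma> * x) * \<phi> (x, 0))"
    using integrable_affine[OF i, of q] \<sigma> by auto
  have "(LINT p|lborel. G p) = (LINT t|lborel. LINT x|lborel. G (x, t))"
    using lborel_pair.integral_snd[of "\<lambda>x t. G (x, t)"] iG by (simp add: lborel_prod)
  also have "\<dots> = (LINT t|lborel. LINT s|lborel. H s t)" by (simp add: inner)
  also have "\<dots> = (LINT s|lborel. LINT t|lborel. H s t)" by (rule lborel_pair.Fubini_integral[OF iH])
  also have "\<dots> = - (LINT s|lborel. f s * \<phi> (\<sigma> * (s - q), 0))" by (simp add: outer)
  also have "(LINT s|lborel. f s * \<phi> (\<sigma> * (s - q), 0)) = (LINT x|lborel. f (q + \<sigma> * x) * \<phi> (x, 0))"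
    using integral_affine[of "\<lambda>s. f s * \<phi> (\<sigma> * (s - q), 0)" q] \<sigma> by auto
  finally show "(LINT p|lborel. G p) = - (LINT x|lborel. f (q + \<sigma> * x) * \<phi> (x, 0))" .
qed

section \<open>The weak solution\<close>

lemma open_connected_bounded_real:
  fixes \<Omega> :: "real set"
  assumes "open \<Omega>" "connected \<Omega>" "\<Omega> \<noteq> {}" "bounded \<Omega>"
  obtains a b where "a < b" "\<Omega> = {a<..<b}"
proof -
  have bd: "bdd_above \<Omega>" "bdd_below \<Omega>"
    using assms(4) by (auto intro: bounded_imp_bdd_above bounded_imp_bdd_below)
  have "\<Omega> = {Inf \<Omega><..<Sup \<Omega>}"
  proof (intro equalityI subsetI)
    fix x assume x: "x \<in> \<Omega>"
    obtain e where e: "e > 0" "cball x e \<subseteq> \<Omega>" using assms(1) x open_contains_cball by blast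
    then have "x - e \<in> \<Omega>" "x + e \<in> \<Omega>" by (auto simp: subset_eq dist_real_def)
    then have "Inf \<Omega> \<le> x - e" "x + e \<le> Sup \<Omega>" using bd by (auto intro: cInf_lower cSup_upper)
    then show "x \<in> {Inf \<Omega><..<Sup \<Omega>}" using e by auto
  next
    fix x assume x: "x \<in> {Inf \<Omega><..<Sup \<Omega>}"
    obtain y where y: "y \<in> \<Omega>" "y < x" using x cInf_lessD[OF assms(3)] by auto
    obtain z where z: "z \<in> \<Omega>" "x < z" using x less_cSupD[OF assms(3)] by auto
    show "x \<in> \<Omega>" using connectedD_interval[OF assms(2) y(1) z(1)] y z by auto
  qed
  moreover from this have "Inf \<Omega> < Sup \<Omega>" using assms(3) by fastforce
  ultimately show ?thesis using that by blast
qed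

lemma sq_int_window:
  assumes "sq_int c B f"
  shows "sq_int \<alpha> \<beta> (\<lambda>s. indicator {\<alpha><..<\<beta>} s * f (z + s))" "sq_int \<alpha> \<beta> (\<lambda>s. indicator {\<alpha><..<\<beta>} s * f (z - s))"
proof -
  have [measurable]: "f \<in> borel_measurable borel" using assms by (simp add: sq_int_def)
  have sq: "(\<lambda>s. (indicator {\<alpha><..<\<beta>} s * h s)\<^sup>2) = (\<lambda>s. indicator {\<alpha><..<\<beta>} s * (h s)\<^sup>2)"
    for h :: "real \<Rightarrow> real" by (auto simp: indicator_def)
  show "sq_int \<alpha> \<beta> (\<lambda>s. indicator {\<alpha><..<\<beta>} s * f (z + s))" "sq_int \<alpha> \<beta> (\<lambda>s. indicator {\<alpha><..<\<beta>} s * f (z - s))"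
    unfolding sq_int_def sq using integrable_affine[OF sq_int_square[OF assms], of z]
    by (auto intro!: integrable_indicator_mult)
qed

lemma square_lincomb_le: "(p * x + q * y)\<^sup>2 \<le> 2 * (x\<^sup>2 + y\<^sup>2)"
  if "\<bar>p\<bar> \<le> 1" "\<bar>q\<bar> \<le> 1" for p q x y :: real
proof -
  have "(p * x)\<^sup>2 \<le> x\<^sup>2" "(q * y)\<^sup>2 \<le> y\<^sup>2"
    using that by (auto simp: power_mult_distrib abs_square_le_1 intro!: mult_left_le_one_le)
  moreover have "(p * x + q * y)\<^sup>2 \<le> 2 * (p * x)\<^sup>2 + 2 * (q * y)\<^sup>2"
    using zero_le_power2[of "p * x - q * y"] by (simp add: power2_eq_square algebra_simps)
  ultimately show ?thesis by (simp add: algebra_simps)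
qed

section \<open>The truncated d'Alembert wave and its derivatives\<close>

locale dalembert =
  fixes a b T B :: real and f :: "real \<Rightarrow> real"
  assumes ab: "a < b" and T: "T > 0" and f: "sq_int (2 * a - b) B f"
    and periodic: "\<And>t. 0 \<le> t \<Longrightarrow> t \<le> T \<Longrightarrow> prim f (b + t) = prim f (2 * a - b + t)"
begin

definition w :: "real \<times> real \<Rightarrow> real" where
  "w p = prim f (fst p + snd p) - prim f (2 * a - fst p + snd p)"

definition u :: "real \<times> real \<Rightarrow> real" where
  "u p = max 0 (w p)"

definition pos :: "real \<times> real \<Rightarrow> real" where
  "pos p = (if w p > 0 then 1 else 0)"

definition u\<^sub>t :: "real \<times> real \<Rightarrow> real" where
  "u\<^sub>t p = pos p * (f (fst p + snd p) - f (2 * a - fst p + snd p))"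

definition u\<^sub>x :: "real \<times> real \<Rightarrow> real" where
  "u\<^sub>x p = pos p * (f (fst p + snd p) + f (2 * a - fst p + snd p))"

text \<open>A bound for \<open>w\<close> in the supremum norm, one L1 norm of \<open>f\<close> for
  each of its two primitives.\<close>

definition m :: real where
  "m = 2 * (LINT s|lborel. \<bar>f s\<bar>)"

lemmas fi = sq_int_integrable[OF f]

lemma f_measurable [measurable]: "f \<in> borel_measurable borel"
  using f by (simp add: sq_int_def)

lemma w_continuous: "continuous_on A w"
  unfolding w_def[abs_def]
  by (intro continuous_intros continuous_on_compose2[OF prim_continuous[OF fi, of UNIV]]) auto

lemma u_continuous: "continuous_on A u"
  unfolding u_def[abs_def] by (intro continuous_intros w_continuous)

lemma w_measurable [measurable]: "w \<in> borel_measurable borel"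
  by (rule borel_measurable_continuous_onI[OF w_continuous])

lemma u_measurable [measurable]: "u \<in> borel_measurable borel"
  by (rule borel_measurable_continuous_onI[OF u_continuous])

lemma pos_measurable [measurable]: "pos \<in> borel_measurable borel"
  unfolding pos_def[abs_def] by measurable

lemma derivatives_measurable [measurable]:
  "u\<^sub>t \<in> borel_measurable borel" "u\<^sub>x \<in> borel_measurable borel"
proof -
  have [measurable]: "(\<lambda>p::real \<times> real. f (fst p + snd p)) \<in> borel_measurable borel"
    "(\<lambda>p::real \<times> real. f (2 * a - fst p + snd p)) \<in> borel_measurable borel"
    by (rule measurable_compose[OF _ f_measurable], rule borel_measurable_continuous_onI,
        intro continuous_intros)+
  show "u\<^sub>t \<in> borel_measurable borel" "u\<^sub>x \<in> borel_measurable borel"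
    unfolding u\<^sub>t_def[abs_def] u\<^sub>x_def[abs_def] by measurable
qed

lemma u_bound: "0 \<le> u p" "u p \<le> m"
proof -
  have "w p \<le> m"
    using prim_abs_le[OF fi, of "fst p + snd p"] prim_abs_le[OF fi, of "2 * a - fst p + snd p"]
    unfolding w_def m_def by linarith
  moreover have "0 \<le> m" by (simp add: m_def)
  ultimately show "0 \<le> u p" "u p \<le> m" by (auto simp: u_def)
qed

text \<open>The squares of the two copies of \<open>f\<close> have integrals in x that do not depend
  on t, so they are integrable over the strip; \<open>square_lincomb_le\<close> with coefficients
  \<open>pos\<close> and its negative transfers this to both derivatives. For \<open>u\<close>
  itself the bound \<open>m\<close> suffices.\<close>

lemma square_integrable_strip:
  "integrable lborel (\<lambda>p. indicator ({a<..<b} \<times> {0<..<T}) p * (u p)\<^sup>2)"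
  "integrable lborel (\<lambda>p. indicator ({a<..<b} \<times> {0<..<T}) p * (u\<^sub>t p)\<^sup>2)"
  "integrable lborel (\<lambda>p. indicator ({a<..<b} \<times> {0<..<T}) p * (u\<^sub>x p)\<^sup>2)"
proof -
  let ?S = "{a<..<b} \<times> {0<..<T}"
  have S [measurable]: "?S \<in> sets borel" by (intro borel_open open_Times) auto
  have 1: "integrable lborel (\<lambda>(x, t). indicator {0<..<T} t * (m\<^sup>2 * indicator {a<..<b} x))"
    unfolding lborel_prod[symmetric]
  proof (rule integrable_strip[where A = "LINT x|lborel. \<bar>m\<^sup>2 * indicator {a<..<b} x\<bar>"])
    show "(\<lambda>(x, t). m\<^sup>2 * indicator {a<..<b} x) \<in> borel_measurable (borel \<Otimes>\<^sub>M borel)" by measurable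
  qed (auto intro!: integrable_mult_right integrable_indicator_interval)
  show "integrable lborel (\<lambda>p. indicator ?S p * (u p)\<^sup>2)"
  proof (rule Bochner_Integration.integrable_bound[OF 1])
    have "(u p)\<^sup>2 \<le> m\<^sup>2" for p using u_bound by (intro power_mono)
    then show "AE p in lborel. norm (indicator ?S p * (u p)\<^sup>2)
        \<le> norm (case p of (x, t) \<Rightarrow> indicator {0<..<T} t * (m\<^sup>2 * indicator {a<..<b} x))"
      by (intro AE_I2) (auto simp: indicator_def)
  qed measurable
  have 2: "integrable lborel (\<lambda>(x, t). indicator {0<..<T} t * (f (q + \<sigma> * x + t))\<^sup>2)" if "\<sigma> = 1 \<or> \<sigma> = -1" for q \<sigma>
    using integrable_wave[OF sq_int_square[OF f] that] by (simp add: lborel_prod)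
  have 3: "integrable lborel (\<lambda>p. 2 * ((case p of (x, t) \<Rightarrow> indicator {0<..<T} t * (f (0 + 1 * x + t))\<^sup>2)
      + (case p of (x, t) \<Rightarrow> indicator {0<..<T} t * (f (2 * a + (-1) * x + t))\<^sup>2)))"
    by (intro integrable_mult_right Bochner_Integration.integrable_add 2) auto
  have *: "integrable lborel (\<lambda>p. indicator ?S p * (h p)\<^sup>2)"
    if [measurable]: "h \<in> borel_measurable borel"
      and h: "\<And>p. (h p)\<^sup>2 \<le> 2 * ((f (fst p + snd p))\<^sup>2 + (f (2 * a - fst p + snd p))\<^sup>2)" for h
  proof (rule Bochner_Integration.integrable_bound[OF 3])
    show "AE p in lborel. norm (indicator ?S p * (h p)\<^sup>2)
        \<le> norm (2 * ((case p of (x, t) \<Rightarrow> indicator {0<..<T} t * (f (0 + 1 * x + t))\<^sup>2)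
      + (case p of (x, t) \<Rightarrow> indicator {0<..<T} t * (f (2 * a + (-1) * x + t))\<^sup>2)))"
    proof (rule AE_I2)
      fix p :: "real \<times> real"
      show "norm (indicator ?S p * (h p)\<^sup>2)
        \<le> norm (2 * ((case p of (x, t) \<Rightarrow> indicator {0<..<T} t * (f (0 + 1 * x + t))\<^sup>2)
      + (case p of (x, t) \<Rightarrow> indicator {0<..<T} t * (f (2 * a + (-1) * x + t))\<^sup>2)))"
        using h[of p] by (cases p) (auto simp: indicator_def)
    qed
  qed measurable
  show "integrable lborel (\<lambda>p. indicator ?S p * (u\<^sub>t p)\<^sup>2)"
  proof (rule *)
    show "(u\<^sub>t p)\<^sup>2 \<le> 2 * ((f (fst p + snd p))\<^sup>2 + (f (2 * a - fst p + snd p))\<^sup>2)" for p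
    proof -
      have "u\<^sub>t p = pos p * f (fst p + snd p) + (- pos p) * f (2 * a - fst p + snd p)"
        by (simp add: u\<^sub>t_def algebra_simps)
      then show ?thesis using square_lincomb_le[of "pos p" "- pos p"] by (simp add: pos_def)
    qed
  qed measurable
  show "integrable lborel (\<lambda>p. indicator ?S p * (u\<^sub>x p)\<^sup>2)"
  proof (rule *)
    show "(u\<^sub>x p)\<^sup>2 \<le> 2 * ((f (fst p + snd p))\<^sup>2 + (f (2 * a - fst p + snd p))\<^sup>2)" for p
    proof -
      have "u\<^sub>x p = pos p * f (fst p + snd p) + pos p * f (2 * a - fst p + snd p)"
        by (simp add: u\<^sub>x_def algebra_simps)
      then show ?thesis using square_lincomb_le[of "pos p" "pos p"] by (simp add: pos_def)
    qed
  qed measurable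
qed

lemma L2_on_strip:
  "L2_on ({a<..<b} \<times> {0<..<T}) u" "L2_on ({a<..<b} \<times> {0<..<T}) u\<^sub>t" "L2_on ({a<..<b} \<times> {0<..<T}) u\<^sub>x"
  using square_integrable_strip by (auto intro!: L2_on_borel borel_open open_Times)

text \<open>For every single x the function of t is \<open>w (x, 0)\<close> plus a primitive on the
  window from 0 to T, so \<open>max_prim\<close> and integration by parts apply slice by
  slice.\<close>

lemma H1_L2_deriv_u: "H1_L2_deriv {a<..<b} T u u\<^sub>t"
proof -
  have "(LINT t:{0<..<T}|lebesgue. u (x, t) * deriv \<psi> t) = - (LINT t:{0<..<T}|lebesgue. u\<^sub>t (x, t) * \<psi> t)"
    if \<psi>: "test_function {0<..<T} \<psi>" for \<psi> x
  proof -
    define k where "k s = 1 * (indicator {0<..<T} s * f (x + s)) + (-1) * (indicator {0<..<T} s * f ((2 * a - x) + s))" for s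
    have k: "sq_int 0 T k" unfolding k_def by (intro sq_int_lincomb sq_int_window[OF f])
    have w: "w (x, 0) + prim k t = w (x, t)" if "0 \<le> t" "t \<le> T" for t
      unfolding k_def
        prim_lincomb[OF sq_int_integrable[OF sq_int_window(1)[OF f]] sq_int_integrable[OF sq_int_window(1)[OF f]]]
      using that by (simp add: prim_window[OF fi] w_def)
    define k' where "k' s = (if w (x, 0) + prim k s > 0 then 1 else 0) * k s" for s
    have pk [measurable]: "prim k \<in> borel_measurable borel"
      by (rule borel_measurable_continuous_onI[OF prim_continuous[OF sq_int_integrable[OF k]]])
    have k': "sq_int 0 T k'" unfolding k'_def by (rule sq_int_mult_bounded[OF k]) auto
    show ?thesis
    proof (rule set_integral_prim_by_parts[OF k' T \<psi>, of _ "max 0 (w (x, 0))"])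
      fix t assume t: "t \<in> {0<..<T}"
      show "u (x, t) = max 0 (w (x, 0)) + prim k' t"
        using max_prim[OF k T, of "w (x, 0)" t] w[of t] t by (simp add: u_def k'_def[abs_def])
      show "u\<^sub>t (x, t) = k' t" using w[of t] t by (simp add: u\<^sub>t_def k'_def k_def pos_def)
    qed
  qed
  then show ?thesis unfolding H1_L2_deriv_def using L2_on_strip by blast
qed

text \<open>At each time the slice vanishes at a, where its primitive starts, and at b by
  \<open>periodic\<close>. The derivative of the truncated slice therefore has mean zero, which is
  the hypothesis of \<open>H10_prim\<close>.\<close>

lemma Linf_H10_grad_u: "Linf_H10_grad {a<..<b} T u u\<^sub>x"
proof -
  \<comment> \<open>The first term comes from the bound \<open>m\<close> on \<open>u\<close>. In the
    second, the 4 is the factor 2 of \<open>square_lincomb_le\<close> times the two copies of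
    \<open>f\<close>, each with its full norm after translation or reflection.\<close>
  define C where "C = sqrt (m\<^sup>2 * (b - a) + 4 * (LINT s|lborel. (f s)\<^sup>2))"
  have "(\<lambda>x. u (x, t)) \<in> H10 {a<..<b} \<and> H1_deriv {a<..<b} (\<lambda>x. u (x, t)) (\<lambda>x. u\<^sub>x (x, t)) \<and>
      sqrt ((L2_norm_on {a<..<b} (\<lambda>x. u (x, t)))\<^sup>2 + (L2_norm_on {a<..<b} (\<lambda>x. u\<^sub>x (x, t)))\<^sup>2) \<le> C"
    if t: "t \<in> {0<..<T}" for t
  proof -
    \<comment> \<open>The argument 2 a - x + t decreases in x, so its primitive enters
      \<open>w\<close> with a minus sign and its derivative with a plus sign.\<close>
    define k where "k s = 1 * (indicator {a<..<b} s * f (t + s)) + 1 * (indicator {a<..<b} s * f ((2 * a + t) - s))" for s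
    have k: "sq_int a b k" unfolding k_def by (intro sq_int_lincomb sq_int_window[OF f])
    have w: "prim k x = w (x, t)" if "a \<le> x" "x \<le> b" for x
      unfolding k_def
        prim_lincomb[OF sq_int_integrable[OF sq_int_window(1)[OF f]] sq_int_integrable[OF sq_int_window(2)[OF f]]]
      using that by (simp add: prim_window[OF fi] prim_window_reflect[OF fi] w_def) (simp add: algebra_simps)
    define k' where "k' s = (if 0 + prim k s > 0 then 1 else 0) * k s" for s
    have pk [measurable]: "prim k \<in> borel_measurable borel"
      by (rule borel_measurable_continuous_onI[OF prim_continuous[OF sq_int_integrable[OF k]]])
    have k': "sq_int a b k'" unfolding k'_def by (rule sq_int_mult_bounded[OF k]) auto
    have ueq: "u (x, t) = prim k' x" if "a \<le> x" "x \<le> b" for x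
      using max_prim[OF k ab, of 0 x] w[OF that] by (simp add: u_def k'_def[abs_def])
    have uxeq: "u\<^sub>x (x, t) = k' x" if "x \<in> {a<..<b}" for x
      using w[of x] that by (simp add: u\<^sub>x_def k'_def k_def pos_def algebra_simps)
    have "w (b, t) = 0" using periodic[of t] t by (simp add: w_def)
    then have "prim k' b = 0" using ueq[of b] ab by (simp add: u_def)
    then have k'0: "(LINT s|lborel. k' s) = 0" using prim_right[OF k', of b] by simp
    have "(L2_norm_on {a<..<b} (\<lambda>x. u (x, t)))\<^sup>2 \<le> m\<^sup>2 * (b - a)"
    proof -
      have s: "sq_int a b (\<lambda>x. indicator {a<..<b} x * (0 + prim k' x))"
        by (rule sq_int_prim[OF sq_int_integrable[OF k']])
      have "L2_norm_on {a<..<b} (\<lambda>x. u (x, t)) = L2_norm_on {a<..<b} (\<lambda>x. indicator {a<..<b} x * (0 + prim k' x))"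
        by (rule L2_norm_on_cong) (simp add: ueq)
      then have "(L2_norm_on {a<..<b} (\<lambda>x. u (x, t)))\<^sup>2 = (LINT x|lborel. (indicator {a<..<b} x * (0 + prim k' x))\<^sup>2)"
        using L2_norm_on_sq_int[OF s] by simp
      also have "\<dots> \<le> (LINT x|lborel. m\<^sup>2 * indicator {a<..<b} x)"
      proof (rule integral_mono[OF sq_int_square[OF s]])
        show "integrable lborel (\<lambda>x. m\<^sup>2 * indicator {a<..<b} x)"
          by (intro integrable_mult_right integrable_indicator_interval)
        show "(indicator {a<..<b} x * (0 + prim k' x))\<^sup>2 \<le> m\<^sup>2 * indicator {a<..<b} x" for x
        proof (cases "x \<in> {a<..<b}")
          case True
          have "(u (x, t))\<^sup>2 \<le> m\<^sup>2" using u_bound by (intro power_mono)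
          then show ?thesis using True by (simp add: ueq)
        qed simp
      qed
      finally show ?thesis using ab by simp
    qed
    moreover have "(L2_norm_on {a<..<b} (\<lambda>x. u\<^sub>x (x, t)))\<^sup>2 \<le> 4 * (LINT s|lborel. (f s)\<^sup>2)"
    proof -
      have "L2_norm_on {a<..<b} (\<lambda>x. u\<^sub>x (x, t)) = L2_norm_on {a<..<b} k'"
        by (rule L2_norm_on_cong) (simp add: uxeq)
      then have "(L2_norm_on {a<..<b} (\<lambda>x. u\<^sub>x (x, t)))\<^sup>2 = (LINT x|lborel. (k' x)\<^sup>2)"
        using L2_norm_on_sq_int[OF k'] by simp
      also have "\<dots> \<le> (LINT x|lborel. 2 * ((f (t + x))\<^sup>2 + (f ((2 * a + t) - x))\<^sup>2))"
      proof (rule integral_mono[OF sq_int_square[OF k']])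
        show "integrable lborel (\<lambda>x. 2 * ((f (t + x))\<^sup>2 + (f ((2 * a + t) - x))\<^sup>2))"
          by (intro integrable_mult_right Bochner_Integration.integrable_add
              integrable_affine(1)[OF sq_int_square[OF f]] integrable_affine(2)[OF sq_int_square[OF f]])
        show "(k' x)\<^sup>2 \<le> 2 * ((f (t + x))\<^sup>2 + (f ((2 * a + t) - x))\<^sup>2)" for x
        proof -
          define r where "r = (if 0 + prim k x > 0 then 1 else 0) * (indicator {a<..<b} x :: real)"
          have "k' x = r * f (t + x) + r * f ((2 * a + t) - x)"
            by (simp add: k'_def k_def r_def algebra_simps)
          moreover have "\<bar>r\<bar> \<le> 1" by (simp add: r_def indicator_def)
          ultimately show ?thesis using square_lincomb_le[of r r] by simp
        qed
      qed
      also have "\<dots> = 2 * ((LINT x|lborel. (f (t + x))\<^sup>2) + (LINT x|lborel. (f ((2 * a + t) - x))\<^sup>2))"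
        using integrable_affine(1)[OF sq_int_square[OF f], of t] integrable_affine(2)[OF sq_int_square[OF f], of "2 * a + t"]
        by simp
      also have "\<dots> = 4 * (LINT s|lborel. (f s)\<^sup>2)"
        unfolding integral_affine(1)[of "\<lambda>s. (f s)\<^sup>2"] integral_affine(2)[of "\<lambda>s. (f s)\<^sup>2"] by simp
      finally show ?thesis .
    qed
    ultimately have "sqrt ((L2_norm_on {a<..<b} (\<lambda>x. u (x, t)))\<^sup>2 + (L2_norm_on {a<..<b} (\<lambda>x. u\<^sub>x (x, t)))\<^sup>2) \<le> C"
      unfolding C_def by (intro real_sqrt_le_mono add_mono)
    moreover have "(\<lambda>x. u (x, t)) \<in> H10 {a<..<b}"
      by (rule H10_prim[OF k' k'0 ab]) (simp add: ueq)
    moreover have "H1_deriv {a<..<b} (\<lambda>x. u (x, t)) (\<lambda>x. u\<^sub>x (x, t))"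
      by (rule H1_deriv_prim[OF k' ab, of _ 0]) (simp_all add: ueq uxeq)
    ultimately show ?thesis by blast
  qed
  then show ?thesis
    unfolding Linf_H10_grad_def using L2_on_strip unfolding L2_on_def
    by (intro conjI exI[of _ C]) auto
qed

text \<open>\<open>u\<close> is continuous up to t = 0 with values between 0 and \<open>m\<close>,
  so differences are at most \<open>m\<close> and dominated convergence applies along every sequence
  of times tending to 0.\<close>

lemma u_trace:
  assumes "L2_on {a<..<b} u\<^sub>0" "AE x in lborel. x \<in> {a<..<b} \<longrightarrow> u\<^sub>0 x = u (x, 0)"
  shows "L2_tendsto {a<..<b} (\<lambda>t x. u (x, t)) u\<^sub>0 (at_right 0)"
proof -
  let ?I = "indicator {a<..<b} :: real \<Rightarrow> real"
  have c: "continuous_on UNIV (\<lambda>x. u (x, t))" for t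
    by (intro continuous_on_compose2[OF u_continuous[of UNIV]] continuous_intros) auto
  have um: "(\<lambda>x. ?I x * u (x, t)) \<in> borel_measurable borel" for t
    using borel_measurable_continuous_onI[OF c] by simp
  have s: "sq_int a b (\<lambda>x. ?I x * u (x, t))" for t
    using u_bound um by (intro sq_int_bounded[of _ _ _ m]) (auto simp: indicator_def intro: order_trans[OF u_bound])
  have L2: "L2_on {a<..<b} (\<lambda>x. u (x, t))" for t
    by (rule L2_on_cong[OF sq_int_L2_on[OF s]]) simp
  have "AE x in lborel. x \<in> {a<..<b} \<longrightarrow> u\<^sub>0 x = ?I x * u (x, 0)"
    using assms(2) by eventually_elim simp
  from L2_norm_on_representative[OF assms(1) s this s]
  have norm: "L2_norm_on {a<..<b} (\<lambda>x. u (x, t) - u\<^sub>0 x) =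
      sqrt (LINT x|lborel. (?I x * u (x, t) - ?I x * u (x, 0))\<^sup>2)" for t
    by (subst L2_norm_on_cong[of _ _ "\<lambda>x. ?I x * u (x, t) - u\<^sub>0 x"]) simp_all
  have "((\<lambda>t. LINT x|lborel. (?I x * u (x, t) - ?I x * u (x, 0))\<^sup>2) \<longlongrightarrow> 0) (at_right 0)"
  proof (rule tendsto_at_right_sequentially[of 0 1])
    fix S :: "nat \<Rightarrow> real" assume S: "S \<longlonglongrightarrow> 0"
    show "(\<lambda>n. LINT x|lborel. (?I x * u (x, S n) - ?I x * u (x, 0))\<^sup>2) \<longlonglongrightarrow> 0"
    proof (rule square_dominated_convergence[OF um um])
      show "integrable lborel (\<lambda>x. m\<^sup>2 * ?I x)"
        by (intro integrable_mult_right integrable_indicator_interval)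
      show "(?I x * u (x, S n) - ?I x * u (x, 0))\<^sup>2 \<le> m\<^sup>2 * ?I x" for n x
      proof -
        have "\<bar>u (x, S n) - u (x, 0)\<bar> \<le> m"
          using u_bound(1)[of "(x, S n)"] u_bound(2)[of "(x, S n)"] u_bound(1)[of "(x, 0)"] u_bound(2)[of "(x, 0)"]
          by (simp add: abs_le_iff)
        then have "(u (x, S n) - u (x, 0))\<^sup>2 \<le> m\<^sup>2"
          using power_mono[of "\<bar>u (x, S n) - u (x, 0)\<bar>" m 2] by simp
        then show ?thesis by (simp add: indicator_def)
      qed
      have "isCont u (x, 0)" for x
        using u_continuous[of UNIV] by (auto simp: continuous_on_eq_continuous_at)
      then show "(\<lambda>n. ?I x * u (x, S n)) \<longlonglongrightarrow> ?I x * u (x, 0)" for x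
        by (intro tendsto_mult tendsto_const isCont_tendsto_compose[of _ u] tendsto_Pair S)
    qed
  qed simp
  from tendsto_real_sqrt[OF this]
  show ?thesis unfolding L2_tendsto_def norm using L2 assms(1) by simp
qed

text \<open>The truncation is invisible to the test function: on its support \<open>pos\<close> is
  1, so \<open>u\<^sub>t\<close> and \<open>u\<^sub>x\<close> are the formal derivatives of
  \<open>w\<close>, and off the support both derivatives of \<open>\<phi>\<close> vanish.\<close>

lemma u_weak_form:
  assumes \<phi>: "test_function (positivity_set {a<..<b} T u) \<phi>"
    and v: "L2_on {a<..<b} v\<^sub>0" "AE x in lborel. x \<in> {a<..<b} \<longrightarrow> v\<^sub>0 x = f x - f (2 * a - x)"
  shows "(LINT p:{a<..<b} \<times> {0<..<T}|lebesgue.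
              - u\<^sub>t p * deriv (\<lambda>t. \<phi> (fst p, t)) (snd p)
              + u\<^sub>x p * deriv (\<lambda>x. \<phi> (x, snd p)) (fst p))
           - (LINT x:{a<..<b}|lebesgue. v\<^sub>0 x * \<phi> (x, 0)) = 0"
proof -
  obtain K P Q C where K: "K \<subseteq> positivity_set {a<..<b} T u"
    and z: "\<And>p. p \<notin> K \<Longrightarrow> P p = 0 \<and> Q p = 0 \<and> \<phi> p = 0"
    and PQ: "P \<in> borel_measurable borel" "Q \<in> borel_measurable borel"
    and C: "\<And>p. \<bar>P p\<bar> \<le> C \<and> \<bar>Q p\<bar> \<le> C"
    and der: "\<And>x t. 0 \<le> t \<Longrightarrow>
      (\<phi> has_derivative (\<lambda>h. P (x, t) * fst h + Q (x, t) * snd h)) (at (x, t) within UNIV \<times> {0..})"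
    using test_function_spacetime[OF open_greaterThanLessThan u_continuous \<phi>] by blast
  \<comment> \<open>The support lies in t < T, so there is no contribution at the final
    time.\<close>
  have final: "\<phi> (x, T) = 0" for x
  proof -
    have "(x, T) \<notin> K" using K by (auto simp: positivity_set_def)
    then show ?thesis using z by blast
  qed
  let ?G = "\<lambda>\<sigma> q. \<lambda>(x, t). indicator {0<..<T} t * f (q + \<sigma> * x + t) * (Q (x, t) - \<sigma> * P (x, t))"
  note W1 = wave_weak_form[OF T fi disjI1[OF refl] PQ C der final, of 0]
  note W2 = wave_weak_form[OF T fi disjI2[OF refl] PQ C der final, of "2 * a"]
  \<comment> \<open>With f_1 and f_2 the values of \<open>f\<close> at x + t and at 2 a - x + t, the
    integrand is -(f_1 - f_2) Q + (f_1 + f_2) P. Sorted by profile this is -f_1 (Q - P) + f_2 (Q +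
    P), one term for each family of characteristics.\<close>
  have "indicator ({a<..<b} \<times> {0<..<T}) p *\<^sub>R (- u\<^sub>t p * deriv (\<lambda>t. \<phi> (fst p, t)) (snd p)
      + u\<^sub>x p * deriv (\<lambda>x. \<phi> (x, snd p)) (fst p)) = - ?G 1 0 p + ?G (-1) (2 * a) p" for p
  proof (cases "snd p \<in> {0<..<T}")
    case True
    obtain x t where p: "p = (x, t)" by (cases p)
    have d: "deriv (\<lambda>t. \<phi> (x, t)) t = Q p" "deriv (\<lambda>x. \<phi> (x, t)) x = P p"
      using deriv_spacetime[OF der, of t x] True by (auto simp: p)
    show ?thesis
    proof (cases "p \<in> K")
      case True
      then have "x \<in> {a<..<b}" "pos p = 1"
        using K by (auto simp: positivity_set_def p u_def pos_def max_def split: if_splits)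
      then show ?thesis using \<open>snd p \<in> {0<..<T}\<close> d unfolding p
        by (simp add: u\<^sub>t_def u\<^sub>x_def algebra_simps)
    next
      case False
      then show ?thesis using z[OF False] d by (simp add: p)
    qed
  next
    case False
    then show ?thesis by (cases p) auto
  qed
  then have "(LINT p:{a<..<b} \<times> {0<..<T}|lebesgue. - u\<^sub>t p * deriv (\<lambda>t. \<phi> (fst p, t)) (snd p)
      + u\<^sub>x p * deriv (\<lambda>x. \<phi> (x, snd p)) (fst p)) = (LINT p|lebesgue. - ?G 1 0 p + ?G (-1) (2 * a) p)"
    unfolding set_lebesgue_integral_def by presburger
  also have "\<dots> = (LINT p|lborel. - ?G 1 0 p + ?G (-1) (2 * a) p)"
    using W1(1) W2(1) by (intro integral_completion borel_measurable_add borel_measurable_uminus) auto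
  also have "\<dots> = - (LINT p|lborel. ?G 1 0 p) + (LINT p|lborel. ?G (-1) (2 * a) p)"
    using W1(1) W2(1)
    by (subst Bochner_Integration.integral_add) (auto simp only: integral_minus Bochner_Integration.integrable_minus)
  also have "\<dots> = (LINT x|lborel. f (0 + 1 * x) * \<phi> (x, 0)) - (LINT x|lborel. f (2 * a + (-1) * x) * \<phi> (x, 0))"
    using W1(2) W2(2) by simp
  also have "\<dots> = (LINT x|lborel. f (0 + 1 * x) * \<phi> (x, 0) - f (2 * a + (-1) * x) * \<phi> (x, 0))"
    using W1(3) W2(3) by (rule Bochner_Integration.integral_diff[symmetric])
  also have "\<dots> = (LINT x|lborel. (f x - f (2 * a - x)) * \<phi> (x, 0))"
    by (simp add: algebra_simps)
  \<comment> \<open>The initial velocity is matched only almost everywhere in (a,b); this is enough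
    because \<open>\<phi>\<close> at t = 0 vanishes outside the interval.\<close>
  also have "\<dots> = (LINT x:{a<..<b}|lebesgue. v\<^sub>0 x * \<phi> (x, 0))"
  proof -
    have "continuous_on (UNIV \<times> {0..}) \<phi>"
      by (rule has_derivative_continuous_on) (use der in auto)
    then have "continuous_on UNIV (\<lambda>x. \<phi> (x, 0))"
      by (rule continuous_on_compose2) (auto intro!: continuous_intros)
    then have [measurable]: "(\<lambda>x. \<phi> (x, 0)) \<in> borel_measurable borel"
      by (rule borel_measurable_continuous_onI)
    have vm: "(\<lambda>x. indicator {a<..<b} x * v\<^sub>0 x) \<in> borel_measurable lebesgue"
      using v(1) unfolding L2_on_def set_borel_measurable_def by simp
    have \<phi>m: "(\<lambda>x. \<phi> (x, 0)) \<in> borel_measurable lebesgue" by (rule measurable_completion) simp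
    have \<phi>0: "\<phi> (x, 0) = 0" if "x \<notin> {a<..<b}" for x
    proof -
      have "(x, 0) \<notin> K" using K that by (auto simp: positivity_set_def)
      then show ?thesis using z by blast
    qed
    have "(LINT x|lborel. (f x - f (2 * a - x)) * \<phi> (x, 0)) = (LINT x|lebesgue. (f x - f (2 * a - x)) * \<phi> (x, 0))"
      by (rule integral_completion[symmetric]) measurable
    also have "\<dots> = (LINT x|lebesgue. (indicator {a<..<b} x * v\<^sub>0 x) * \<phi> (x, 0))"
    proof (rule integral_cong_AE)
      show "(\<lambda>x. (f x - f (2 * a - x)) * \<phi> (x, 0)) \<in> borel_measurable lebesgue"
        by (rule measurable_completion) measurable
      show "(\<lambda>x. (indicator {a<..<b} x * v\<^sub>0 x) * \<phi> (x, 0)) \<in> borel_measurable lebesgue"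
        by (rule borel_measurable_times[OF vm \<phi>m])
      show "AE x in lebesgue. (f x - f (2 * a - x)) * \<phi> (x, 0) = (indicator {a<..<b} x * v\<^sub>0 x) * \<phi> (x, 0)"
        using AE_completion[OF v(2)]
      proof eventually_elim
        case (elim x)
        then show ?case by (cases "x \<in> {a<..<b}") (simp_all add: \<phi>0)
      qed
    qed
    finally show ?thesis by (simp add: set_lebesgue_integral_def mult.assoc)
  qed
  finally show ?thesis by simp
qed

theorem u_weak_solution:
  assumes "L2_on {a<..<b} u\<^sub>0" "AE x in lborel. x \<in> {a<..<b} \<longrightarrow> u\<^sub>0 x = u (x, 0)"
    and "L2_on {a<..<b} v\<^sub>0" "AE x in lborel. x \<in> {a<..<b} \<longrightarrow> v\<^sub>0 x = f x - f (2 * a - x)"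
  shows "weak_solution {a<..<b} T u\<^sub>0 v\<^sub>0 u"
proof -
  have "\<forall>p \<in> {a<..<b} \<times> {0..<T} - positivity_set {a<..<b} T u. u p = 0"
    using u_bound(1) by (auto simp: positivity_set_def intro: antisym)
  then show ?thesis
    unfolding weak_solution_def
    using u_continuous H1_L2_deriv_u Linf_H10_grad_u u_weak_form[OF _ assms(3,4)] u_trace[OF assms(1,2)]
    by blast
qed

end

theorem theorem4p5:
  fixes \<Omega> :: "real set" and T :: real and u\<^sub>0 v\<^sub>0 :: "real \<Rightarrow> real"
  assumes "open \<Omega>" and "connected \<Omega>" and "\<Omega> \<noteq> {}" and "bounded \<Omega>"
    and "T > 0"
    and "u\<^sub>0 \<in> H10 \<Omega>" and "v\<^sub>0 \<in> H10 \<Omega>"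
    and "AE x in lebesgue. x \<in> \<Omega> \<longrightarrow> 0 \<le> u\<^sub>0 x"
    and "\<forall>\<^sub>F h in at_right 0. AE x in lebesgue. x \<in> \<Omega> \<longrightarrow> 0 \<le> u\<^sub>0 x + h * v\<^sub>0 x"
  shows "\<exists>u. weak_solution \<Omega> T u\<^sub>0 v\<^sub>0 u"
proof -
  obtain a b where ab: "a < b" and \<Omega>: "\<Omega> = {a<..<b}"
    using open_connected_bounded_real[OF assms(1-4)] by blast
  obtain g where g: "sq_int a b g" "(LINT x|lborel. g x) = 0"
    "AE x in lborel. x \<in> {a<..<b} \<longrightarrow> u\<^sub>0 x = prim g x"
    using H10_representative[OF assms(6)[unfolded \<Omega>] ab] by blast
  have L2: "L2_on {a<..<b} u\<^sub>0" "L2_on {a<..<b} v\<^sub>0"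
    using assms(6,7) unfolding \<Omega> H10_def H1_deriv_def by auto
  obtain v where v: "sq_int a b v" "AE x in lborel. x \<in> {a<..<b} \<longrightarrow> v\<^sub>0 x = v x"
    using L2_on_representative[OF L2(2)] by blast
  obtain B f where prof: "sq_int (2 * a - b) B f"
    "\<And>x. x \<in> {a<..<b} \<Longrightarrow> f x - f (2 * a - x) = v x"
    "\<And>x. x \<in> {a..b} \<Longrightarrow> prim f x - prim f (2 * a - x) = prim g x"
    "\<And>t. 0 \<le> t \<Longrightarrow> t \<le> T \<Longrightarrow> prim f (b + t) = prim f (2 * a - b + t)"
  proof (rule dalembert_profile[OF ab assms(5) g(1) v(1) g(2)])
    fix f B
    assume "sq_int (2 * a - b) B f"
      "\<And>x. x \<in> {a<..<b} \<Longrightarrow> f x - f (2 * a - x) = v x"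
      "\<And>x. x \<in> {a..b} \<Longrightarrow> prim f x - prim f (2 * a - x) = prim g x"
      "\<And>t. 0 \<le> t \<Longrightarrow> t \<le> T \<Longrightarrow> prim f (b + t) = prim f (2 * a - b + t)"
    then show thesis by (rule that)
  qed
  interpret dalembert a b T B f
    by unfold_locales (use ab assms(5) prof in auto)
  \<comment> \<open>At t = 0 the wave equals \<open>prim g\<close>, hence \<open>u\<^sub>0\<close>
    almost everywhere; nonnegativity is what prevents the truncation from changing it.\<close>
  have nonneg: "AE x in lborel. x \<in> {a<..<b} \<longrightarrow> 0 \<le> u\<^sub>0 x"
    using assms(8) unfolding \<Omega> by (simp add: AE_completion_iff)
  have "AE x in lborel. x \<in> {a<..<b} \<longrightarrow> u\<^sub>0 x = u (x, 0)"
    using g(3) nonneg by eventually_elim (auto simp: u_def w_def prof(3))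
  moreover have "AE x in lborel. x \<in> {a<..<b} \<longrightarrow> v\<^sub>0 x = f x - f (2 * a - x)"
    using v(2) by eventually_elim (auto simp: prof(2))
  ultimately have "weak_solution {a<..<b} T u\<^sub>0 v\<^sub>0 u"
    using u_weak_solution L2 by blast
  then show ?thesis unfolding \<Omega> by blast
qed

end
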